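(* At least one of the following two assertions is false: (A) For every finitely generated residually finite group $G$ and every nested sequence $N_1\ge N_2\ge\cdots$ of finite index normal subgroups of $G$ with $\bigcap_{i} N_i=\{1\}$, one has $$\beta_1^{(2)}(G)=\lim_{i\to\infty}\frac{b_1(N_i)}{[G:N_i]}$$ (that is, the limit exists and equals $\beta_1^{(2)}(G)$). (B) Every hyperbolic group is residually finite.
   Context: $\beta_1^{(2)}(G)$ denotes the first $L^2$-Betti number of a discrete countable group $G$, in the standard sense (e.g. $\beta_1^{(2)}(G)=\dim_{\mathcal N(G)}H_1(G;\mathcal N(G))$, where $\mathcal N(G)$ is the group von Neumann algebra of $G$ and $\dim_{\mathcal N(G)}$ is Lück's extended von Neumann dimension). $b_1(N)$ denotes the ordinary first Betti number of the group $N$, i.e. $\dim_{\mathbb Q}H_1(N;\mathbb Q)$. A group $G$ is residually finite if for every element $g\neq 1$ of $G$ there is a homomorphism $\varepsilon\colon G\to Q$ with $Q$ finite such that $\varepsilon(g)\neq 1$. Hyperbolic means (word) hyperbolic in the sense of Gromov. *)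

theory Defs
  imports
    "HOL-Algebra.Generated_Groups"
    "HOL-Algebra.AbelCoset"
    "HOL-Analysis.Infinite_Sum"
    "HOL-Library.Extended_Real"
    "Jordan_Normal_Form.VS_Connect"
begin

hide_const (open) Multiset.mult Polynomial.smult

section \<open>Finitely generated, residually finite and hyperbolic groups\<close>

definition finitely_generated_group :: "('a, 'm) monoid_scheme \<Rightarrow> bool" where
  "finitely_generated_group G \<longleftrightarrow>
     group G \<and> (\<exists>S. finite S \<and> S \<subseteq> carrier G \<and> generate G S = carrier G)"

text \<open>Every countable group, in particular every finite and every finitely generated one, is
  isomorphic to a group whose carrier is a subset of \<open>nat\<close>. Hence it is no restriction to let
  finite quotients, or finitely generated groups, range over the type \<open>nat monoid\<close>.\<close>

definition residually_finite_group :: "('a, 'm) monoid_scheme \<Rightarrow> bool" where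
  "residually_finite_group G \<longleftrightarrow>
     group G \<and>
     (\<forall>g \<in> carrier G. g \<noteq> \<one>\<^bsub>G\<^esub> \<longrightarrow>
        (\<exists>(Q :: nat monoid) \<epsilon>. group Q \<and> finite (carrier Q) \<and> \<epsilon> \<in> hom G Q \<and> \<epsilon> g \<noteq> \<one>\<^bsub>Q\<^esub>))"

definition word_length :: "('a, 'm) monoid_scheme \<Rightarrow> 'a set \<Rightarrow> 'a \<Rightarrow> nat" where
  "word_length G S g =
     (LEAST n. \<exists>ws. length ws = n \<and> set ws \<subseteq> S \<union> m_inv G ` S \<and> foldr (\<otimes>\<^bsub>G\<^esub>) ws \<one>\<^bsub>G\<^esub> = g)"

definition word_dist :: "('a, 'm) monoid_scheme \<Rightarrow> 'a set \<Rightarrow> 'a \<Rightarrow> 'a \<Rightarrow> real" where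
  "word_dist G S x y = real (word_length G S (inv\<^bsub>G\<^esub> x \<otimes>\<^bsub>G\<^esub> y))"

definition gromov_product :: "('a, 'm) monoid_scheme \<Rightarrow> 'a set \<Rightarrow> 'a \<Rightarrow> 'a \<Rightarrow> 'a \<Rightarrow> real" where
  "gromov_product G S w x y = (word_dist G S x w + word_dist G S y w - word_dist G S x y) / 2"

text \<open>Gromov's four-point condition for the word metric; whether it holds for some \<open>\<delta>\<close> does not
  depend on the finite generating set \<open>S\<close>.\<close>

definition hyperbolic_group :: "('a, 'm) monoid_scheme \<Rightarrow> bool" where
  "hyperbolic_group G \<longleftrightarrow>
     group G \<and>
     (\<exists>S. finite S \<and> S \<subseteq> carrier G \<and> generate G S = carrier G \<and>
       (\<exists>\<delta>. \<forall>w \<in> carrier G. \<forall>x \<in> carrier G. \<forall>y \<in> carrier G. \<forall>z \<in> carrier G.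
          gromov_product G S w x z \<ge>
            min (gromov_product G S w x y) (gromov_product G S w y z) - \<delta>))"


section \<open>Left modules over a not necessarily commutative ring\<close>

text \<open>The locale \<open>module\<close> of HOL-Algebra requires a commutative ring of scalars; here only
  its record type is used. The ring multiplication and unit of that record play no role.\<close>

definition free_module :: "('r, 'm) ring_scheme \<Rightarrow> 'i set \<Rightarrow> ('r, 'i \<Rightarrow> 'r) module" where
  "free_module R I =
     \<lparr>carrier = {c. (\<forall>i \<in> I. c i \<in> carrier R) \<and> (\<forall>i. i \<notin> I \<longrightarrow> c i = \<zero>\<^bsub>R\<^esub>) \<and>
                    finite {i. c i \<noteq> \<zero>\<^bsub>R\<^esub>}},
      mult = undefined, one = undefined,
      zero = (\<lambda>i. \<zero>\<^bsub>R\<^esub>), add = (\<lambda>c d i. c i \<oplus>\<^bsub>R\<^esub> d i),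
      smult = (\<lambda>r c i. r \<otimes>\<^bsub>R\<^esub> c i)\<rparr>"

definition free_single :: "('r, 'm) ring_scheme \<Rightarrow> 'i \<Rightarrow> 'r \<Rightarrow> 'i \<Rightarrow> 'r" where
  "free_single R i r = (\<lambda>j. if j = i then r else \<zero>\<^bsub>R\<^esub>)"

definition quotient_module :: "('r, 'b, 'm) module_scheme \<Rightarrow> 'b set \<Rightarrow> ('r, 'b set) module" where
  "quotient_module M B =
     \<lparr>carrier = a_rcosets\<^bsub>M\<^esub> B, mult = undefined, one = undefined,
      zero = B, add = set_add M, smult = (\<lambda>r X. \<Union>x \<in> X. B +>\<^bsub>M\<^esub> (r \<odot>\<^bsub>M\<^esub> x))\<rparr>"

definition left_submodule ::
    "('r, 'n) ring_scheme \<Rightarrow> ('r, 'b, 'm) module_scheme \<Rightarrow> 'b set \<Rightarrow> bool" where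
  "left_submodule R M P \<longleftrightarrow>
     P \<subseteq> carrier M \<and> \<zero>\<^bsub>M\<^esub> \<in> P \<and> (\<forall>x \<in> P. \<forall>y \<in> P. x \<oplus>\<^bsub>M\<^esub> y \<in> P) \<and>
     (\<forall>r \<in> carrier R. \<forall>x \<in> P. r \<odot>\<^bsub>M\<^esub> x \<in> P)"

definition left_module_iso ::
    "('r, 'n) ring_scheme \<Rightarrow> ('r, 'b, 'm) module_scheme \<Rightarrow> ('r, 'c, 'k) module_scheme
      \<Rightarrow> ('b \<Rightarrow> 'c) set" where
  "left_module_iso R M N =
     {\<phi>. bij_betw \<phi> (carrier M) (carrier N) \<and>
         (\<forall>x \<in> carrier M. \<forall>y \<in> carrier M. \<phi> (x \<oplus>\<^bsub>M\<^esub> y) = \<phi> x \<oplus>\<^bsub>N\<^esub> \<phi> y) \<and>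
         (\<forall>r \<in> carrier R. \<forall>x \<in> carrier M. \<phi> (r \<odot>\<^bsub>M\<^esub> x) = r \<odot>\<^bsub>N\<^esub> \<phi> x)}"

text \<open>An \<open>n\<close> by \<open>n\<close> matrix is a function of two indices, used only below \<open>n\<close>. Right
  multiplication of row vectors by an idempotent matrix \<open>A\<close> is a projection of the left module
  \<open>R\<^sup>n\<close>; up to isomorphism its images are exactly the finitely generated projective left
  \<open>R\<close>-modules.\<close>

definition idempotent_matrix ::
    "('r, 'm) ring_scheme \<Rightarrow> nat \<Rightarrow> (nat \<Rightarrow> nat \<Rightarrow> 'r) \<Rightarrow> bool" where
  "idempotent_matrix R n A \<longleftrightarrow>
     (\<forall>i<n. \<forall>j<n. A i j \<in> carrier R) \<and>
     (\<forall>i<n. \<forall>j<n. (\<Oplus>\<^bsub>R\<^esub>k\<in>{..<n}. A i k \<otimes>\<^bsub>R\<^esub> A k j) = A i j)"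

definition row_mult ::
    "('r, 'm) ring_scheme \<Rightarrow> nat \<Rightarrow> (nat \<Rightarrow> nat \<Rightarrow> 'r) \<Rightarrow> (nat \<Rightarrow> 'r) \<Rightarrow> nat \<Rightarrow> 'r" where
  "row_mult R n A v = (\<lambda>j. if j < n then (\<Oplus>\<^bsub>R\<^esub>i\<in>{..<n}. v i \<otimes>\<^bsub>R\<^esub> A i j) else \<zero>\<^bsub>R\<^esub>)"

definition matrix_image ::
    "('r, 'm) ring_scheme \<Rightarrow> nat \<Rightarrow> (nat \<Rightarrow> nat \<Rightarrow> 'r) \<Rightarrow> ('r, nat \<Rightarrow> 'r) module" where
  "matrix_image R n A =
     (free_module R {..<n})\<lparr>carrier := row_mult R n A ` carrier (free_module R {..<n})\<rparr>"


section \<open>First group homology\<close>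

text \<open>A ring \<open>R\<close> together with a homomorphism \<open>\<eta>\<close> from \<open>G\<close> to its unit group is an
  \<open>R\<close>-\<open>\<int>G\<close>-bimodule, \<open>g\<close> acting from the right by \<open>r \<mapsto> r \<otimes> \<eta> g\<close>. The maps below are the
  differentials in degrees 1 and 2 of \<open>R\<close> tensored over \<open>\<int>G\<close> with the (inhomogeneous) bar
  resolution,
    \<open>r[g] \<mapsto> r\<cdot>g - r\<close>  and  \<open>r[g|h] \<mapsto> (r\<cdot>g)[h] - r[gh] + r[g]\<close>,
  so that \<open>first_homology R \<eta> G\<close> is the left \<open>R\<close>-module \<open>H\<^sub>1(G; R)\<close>.\<close>

definition bar_diff1 ::
    "('r, 'n) ring_scheme \<Rightarrow> ('a \<Rightarrow> 'r) \<Rightarrow> ('a \<Rightarrow> 'r) \<Rightarrow> 'r" where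
  "bar_diff1 R \<eta> c = (\<Oplus>\<^bsub>R\<^esub>g \<in> {g. c g \<noteq> \<zero>\<^bsub>R\<^esub>}. c g \<otimes>\<^bsub>R\<^esub> \<eta> g \<ominus>\<^bsub>R\<^esub> c g)"

definition bar_diff2 ::
    "('r, 'n) ring_scheme \<Rightarrow> ('a \<Rightarrow> 'r) \<Rightarrow> ('a, 'm) monoid_scheme \<Rightarrow> ('a \<times> 'a \<Rightarrow> 'r) \<Rightarrow> 'a \<Rightarrow> 'r" where
  "bar_diff2 R \<eta> G c =
     (let C = free_module R (carrier G) in
      \<Oplus>\<^bsub>C\<^esub>p \<in> {p. c p \<noteq> \<zero>\<^bsub>R\<^esub>}.
        free_single R (snd p) (c p \<otimes>\<^bsub>R\<^esub> \<eta> (fst p))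
        \<ominus>\<^bsub>C\<^esub> free_single R (fst p \<otimes>\<^bsub>G\<^esub> snd p) (c p)
        \<oplus>\<^bsub>C\<^esub> free_single R (fst p) (c p))"

definition first_homology ::
    "('r, 'n) ring_scheme \<Rightarrow> ('a \<Rightarrow> 'r) \<Rightarrow> ('a, 'm) monoid_scheme \<Rightarrow> ('r, ('a \<Rightarrow> 'r) set) module" where
  "first_homology R \<eta> G =
     (let C\<^sub>1 = free_module R (carrier G);
          C\<^sub>2 = free_module R (carrier G \<times> carrier G)
      in quotient_module
           (C\<^sub>1\<lparr>carrier := {c \<in> carrier C\<^sub>1. bar_diff1 R \<eta> c = \<zero>\<^bsub>R\<^esub>}\<rparr>)
           (bar_diff2 R \<eta> G ` carrier C\<^sub>2))"

text \<open>\<open>vectorspace.dim\<close> is meaningful for finite-dimensional spaces only; \<open>H\<^sub>1(N; \<rat>)\<close> is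
  finite-dimensional whenever \<open>N\<close> is finitely generated.\<close>

definition betti1 :: "('a, 'm) monoid_scheme \<Rightarrow> nat" where
  "betti1 N = vectorspace.dim (class_ring :: rat ring) (first_homology class_ring (\<lambda>g. 1) N)"


section \<open>The group von Neumann algebra and the first \<open>L\<^sup>2\<close>-Betti number\<close>

definition ell2 :: "('a, 'm) monoid_scheme \<Rightarrow> ('a \<Rightarrow> complex) set" where
  "ell2 G = {f. (\<forall>x. x \<notin> carrier G \<longrightarrow> f x = 0) \<and> (\<lambda>x. (cmod (f x))\<^sup>2) summable_on carrier G}"

definition ell2_norm :: "('a, 'm) monoid_scheme \<Rightarrow> ('a \<Rightarrow> complex) \<Rightarrow> real" where
  "ell2_norm G f = sqrt (\<Sum>\<^sub>\<infinity>x \<in> carrier G. (cmod (f x))\<^sup>2)"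

definition left_translation ::
    "('a, 'm) monoid_scheme \<Rightarrow> 'a \<Rightarrow> ('a \<Rightarrow> complex) \<Rightarrow> 'a \<Rightarrow> complex" where
  "left_translation G g f = (\<lambda>x. if x \<in> carrier G then f (inv\<^bsub>G\<^esub> g \<otimes>\<^bsub>G\<^esub> x) else 0)"

text \<open>The bounded operators on \<open>\<ell>\<^sup>2(G)\<close> that commute with left translations. Outside
  \<open>\<ell>\<^sup>2(G)\<close> an operator is given the value 0, so that equality of operators is equality of
  functions.\<close>

definition vN_algebra ::
    "('a, 'm) monoid_scheme \<Rightarrow> (('a \<Rightarrow> complex) \<Rightarrow> 'a \<Rightarrow> complex) ring" where
  "vN_algebra G =
     \<lparr>carrier =
        {T. (\<forall>f. f \<notin> ell2 G \<longrightarrow> T f = (\<lambda>x. 0)) \<and>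
            (\<forall>f \<in> ell2 G. T f \<in> ell2 G) \<and>
            (\<forall>f \<in> ell2 G. \<forall>h \<in> ell2 G. T (\<lambda>x. f x + h x) = (\<lambda>x. T f x + T h x)) \<and>
            (\<forall>a. \<forall>f \<in> ell2 G. T (\<lambda>x. a * f x) = (\<lambda>x. a * T f x)) \<and>
            (\<exists>K. \<forall>f \<in> ell2 G. ell2_norm G (T f) \<le> K * ell2_norm G f) \<and>
            (\<forall>g \<in> carrier G. \<forall>f \<in> ell2 G.
               T (left_translation G g f) = left_translation G g (T f))},
      mult = (\<lambda>S T f. S (T f)),
      one = (\<lambda>f. if f \<in> ell2 G then f else (\<lambda>x. 0)),
      zero = (\<lambda>f x. 0),
      add = (\<lambda>S T f x. S f x + T f x)\<rparr>"

text \<open>The right regular representation, which embeds \<open>G\<close> into the units of \<open>vN_algebra G\<close>.\<close>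

definition right_translation ::
    "('a, 'm) monoid_scheme \<Rightarrow> 'a \<Rightarrow> ('a \<Rightarrow> complex) \<Rightarrow> 'a \<Rightarrow> complex" where
  "right_translation G g f =
     (\<lambda>x. if f \<in> ell2 G \<and> x \<in> carrier G then f (x \<otimes>\<^bsub>G\<^esub> g) else 0)"

text \<open>\<open>\<langle>T \<delta>\<^sub>1, \<delta>\<^sub>1\<rangle>\<close>, where \<open>\<delta>\<^sub>1\<close> is the indicator function of the unit.\<close>

definition vN_trace ::
    "('a, 'm) monoid_scheme \<Rightarrow> (('a \<Rightarrow> complex) \<Rightarrow> 'a \<Rightarrow> complex) \<Rightarrow> complex" where
  "vN_trace G T = T (\<lambda>x. if x = \<one>\<^bsub>G\<^esub> then 1 else 0) \<one>\<^bsub>G\<^esub>"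

text \<open>Lueck's extended dimension: the supremum of the von Neumann dimensions of the finitely
  generated projective submodules \<open>P\<close> of \<open>M\<close>, where \<open>P\<close> has dimension \<open>tr A\<close> if it is
  isomorphic to the image of the idempotent matrix \<open>A\<close>. The trace of an idempotent matrix is a
  nonnegative real number, and \<open>tr A\<close> depends only on the isomorphism class of \<open>P\<close>.\<close>

definition vN_dim ::
    "('a, 'm) monoid_scheme \<Rightarrow> (('a \<Rightarrow> complex) \<Rightarrow> 'a \<Rightarrow> complex, 'b, 'k) module_scheme \<Rightarrow> ereal" where
  "vN_dim G M =
     Sup {ereal (Re (\<Sum>i<n. vN_trace G (A i i))) | n A P.
            idempotent_matrix (vN_algebra G) n A \<and>
            left_submodule (vN_algebra G) M P \<and>
            left_module_iso (vN_algebra G) (matrix_image (vN_algebra G) n A) (M\<lparr>carrier := P\<rparr>) \<noteq> {}}"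

definition l2_betti1 :: "('a, 'm) monoid_scheme \<Rightarrow> ereal" where
  "l2_betti1 G = vN_dim G (first_homology (vN_algebra G) (right_translation G) G)"

end

theory Submission
  imports Defs "HOL-Algebra.Weak_Morphisms" "HOL-Library.Function_Algebras"
begin

text \<open>Assertion (A) fails on its own: for a finitely generated residually finite group that is not
  finitely presented, the quotients \<open>b\<^sub>1(N\<^sub>i) / [G : N\<^sub>i]\<close> need not converge at all, so neither
  \<open>L\<^sup>2\<close>-invariants nor hyperbolicity have to be looked at.

  Let \<open>F\<close> be free of rank 2. One constructs finite index normal subgroups
  \<open>A\<^sub>0 \<ge> B\<^sub>0 \<ge> A\<^sub>1 \<ge> B\<^sub>1 \<ge> \<dots>\<close> of \<open>F\<close> and a growing set of relators \<open>x\<^sup>k\<close>, where \<open>k\<close> is the exact order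
  of \<open>x\<close> modulo every later \<open>A\<^sub>n\<close>, and puts \<open>G = F / K\<close> with \<open>K\<close> the intersection of the chain.
  Such a relator costs only \<open>[F : A\<^sub>n] / k\<close> of the more than \<open>[F : A\<^sub>n]\<close> dimensions of rational
  characters of \<open>A\<^sub>n\<close>, so as long as the sum of all \<open>1 / k\<close> stays below \<open>1 / 2\<close>, the characters of
  \<open>A\<^sub>n\<close> killing the relators have dimension more than \<open>[F : A\<^sub>n] / 2\<close>. Given \<open>A\<^sub>n\<close>, let \<open>B\<^sub>n\<close> consist of
  the elements at which all integral characters of \<open>A\<^sub>n\<close> are divisible by a huge number. Adding
  high powers of finitely many elements in the common kernel of the characters of \<open>A\<^sub>n\<close> leaves
  these characters alone, but kills all characters of \<open>B\<^sub>n\<close> except those extending to \<open>A\<^sub>n\<close>, which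
  are few compared with \<open>[F : B\<^sub>n]\<close>. Since the divisors tend to infinity, the surviving characters
  vanish on \<open>K\<close>. So the quotients exceed \<open>1 / 2\<close> at the \<open>A\<^sub>n\<close> and are at most \<open>1 / 4\<close> at the \<open>B\<^sub>n\<close>.\<close>

section \<open>Rational first homology\<close>

text \<open>No dimension of a space of characters is computed. A bound "at most d" appears as d
  elements or functionals that only the zero character kills, a bound "more than d" as a nonzero
  character killed by any d prescribed functionals; both forms move easily along quotient maps. The
  obstacle is that \<open>K\<close> depends on infinitely many later choices, while the bound for
  \<open>A n\<close> must be settled when only finitely many relators are known. What closes the gap
  is that later relators are powers of elements which no present character sees, so that the
  characters counted at stage n are never lost again. The order of the choices matters. The number
  of generators of \<open>A n\<close> bounds what can remain of the characters of
  \<open>B n\<close>, and the index of \<open>B n\<close> may be made large afterwards. Likewise the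
  number of new relators is known before the next subgroup is chosen, so their orders can be forced
  to be as large as the budget for the sum of all 1/k demands. The constant 1/2 comes from the coset
  graph of a subgroup of index m: 2m edges, m conditions that remove gradients, fewer than m/2
  conditions for relators, and so more than m/2 degrees of freedom.\<close>

definition fsupp_on :: "'a set \<Rightarrow> ('a \<Rightarrow> rat) set" where
  "fsupp_on S = {c. (\<forall>g. g \<notin> S \<longrightarrow> c g = 0) \<and> finite {g. c g \<noteq> 0}}"

lemma carrier_free_module_rat:
  "carrier (free_module (class_ring :: rat ring) S) = fsupp_on S"
  by (auto simp: free_module_def fsupp_on_def)

lemma zero_free_module_rat: "\<zero>\<^bsub>free_module (class_ring :: rat ring) S\<^esub> = 0"
  by (auto simp: free_module_def fun_eq_iff)

lemma add_free_module_rat: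
  "c \<oplus>\<^bsub>free_module (class_ring :: rat ring) S\<^esub> d = c + d"
  by (auto simp: free_module_def fun_eq_iff)

lemma smult_free_module_rat:
  "r \<odot>\<^bsub>free_module (class_ring :: rat ring) S\<^esub> c = (\<lambda>x. r * c x)"
  by (auto simp: free_module_def)

lemma fsupp_on_add: "c \<in> fsupp_on S \<Longrightarrow> d \<in> fsupp_on S \<Longrightarrow> c + d \<in> fsupp_on S"
  unfolding fsupp_on_def by (auto intro: finite_subset[of _ "{g. c g \<noteq> 0} \<union> {g. d g \<noteq> 0}"])

lemma fsupp_on_smult: "c \<in> fsupp_on S \<Longrightarrow> (\<lambda>x. r * c x) \<in> fsupp_on S"
  unfolding fsupp_on_def by (auto intro: finite_subset[of _ "{g. c g \<noteq> 0}"])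

lemma fsupp_on_zero: "0 \<in> fsupp_on S"
  by (simp add: fsupp_on_def)

lemma fsupp_on_uminus: "c \<in> fsupp_on S \<Longrightarrow> - c \<in> fsupp_on S"
  using fsupp_on_smult[of c S "-1"] by (simp add: fun_Compl_def)

lemma abelian_group_free_module_rat: "abelian_group (free_module (class_ring :: rat ring) S)"
  by (rule abelian_groupI)
    (auto simp: carrier_free_module_rat add_free_module_rat zero_free_module_rat
        fsupp_on_add fsupp_on_zero algebra_simps intro!: bexI[of _ "- _"] fsupp_on_uminus)

lemma a_minus_free_module_rat:
  assumes "c \<in> fsupp_on S" "d \<in> fsupp_on S"
  shows "c \<ominus>\<^bsub>free_module (class_ring :: rat ring) S\<^esub> d = c - d"
proof -
  interpret abelian_group "free_module (class_ring :: rat ring) S"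
    by (rule abelian_group_free_module_rat)
  have "\<ominus>\<^bsub>free_module (class_ring :: rat ring) S\<^esub> d = - d"
    using assms by (intro minus_equality)
      (auto simp: carrier_free_module_rat add_free_module_rat zero_free_module_rat fsupp_on_uminus)
  then show ?thesis
    by (simp add: a_minus_def add_free_module_rat)
qed

lemma finsum_free_module_rat:
  assumes "\<And>p. p \<in> P \<Longrightarrow> f p \<in> fsupp_on S"
  shows "finsum (free_module (class_ring :: rat ring) S) f P = sum f P"
proof -
  interpret abelian_group "free_module (class_ring :: rat ring) S"
    by (rule abelian_group_free_module_rat)
  show ?thesis
    using assms
    by (induction P rule: infinite_finite_induct)
      (auto simp: carrier_free_module_rat add_free_module_rat zero_free_module_rat)
qed

abbreviation chain1 :: "'a \<Rightarrow> 'a \<Rightarrow> rat" where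
  "chain1 g \<equiv> (\<lambda>i. of_bool (i = g))"

text \<open>The boundary of \<open>[g|h]\<close> for trivial coefficients. Modulo these chains,
  sending \<open>g\<close> to its class is the universal homomorphism to a rational vector
  space.\<close>

definition bar_relation :: "('a, 'm) monoid_scheme \<Rightarrow> 'a \<times> 'a \<Rightarrow> 'a \<Rightarrow> rat" where
  "bar_relation N p = chain1 (snd p) - chain1 (fst p \<otimes>\<^bsub>N\<^esub> snd p) + chain1 (fst p)"

definition rat_boundary :: "('a, 'm) monoid_scheme \<Rightarrow> ('a \<times> 'a \<Rightarrow> rat) \<Rightarrow> 'a \<Rightarrow> rat" where
  "rat_boundary N c = (\<Sum>p | c p \<noteq> 0. (\<lambda>i. c p * bar_relation N p i))"

lemma free_single_rat: "free_single (class_ring :: rat ring) i r = (\<lambda>j. r * of_bool (j = i))"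
  by (auto simp: free_single_def)

lemma of_bool_fsupp_on: "g \<in> S \<Longrightarrow> (\<lambda>j. r * of_bool (j = g)) \<in> fsupp_on S"
  by (auto simp: fsupp_on_def)

lemma chain1_fsupp_on: "g \<in> S \<Longrightarrow> chain1 g \<in> fsupp_on S"
  by (auto simp: fsupp_on_def)

lemma bar_diff2_rat:
  assumes "group N" "c \<in> fsupp_on (carrier N \<times> carrier N)"
  shows "bar_diff2 (class_ring :: rat ring) (\<lambda>g. 1) N c = rat_boundary N c"
proof -
  interpret group N by fact
  let ?C = "free_module (class_ring :: rat ring) (carrier N)"
  have *: "free_single class_ring (snd p) (c p \<otimes>\<^bsub>class_ring\<^esub> 1) \<ominus>\<^bsub>?C\<^esub>
      free_single class_ring (fst p \<otimes>\<^bsub>N\<^esub> snd p) (c p) \<oplus>\<^bsub>?C\<^esub> free_single class_ring (fst p) (c p) =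
      (\<lambda>i. c p * bar_relation N p i) \<and> (\<lambda>i. c p * bar_relation N p i) \<in> fsupp_on (carrier N)"
    if "c p \<noteq> 0" for p
  proof -
    have p: "fst p \<in> carrier N" "snd p \<in> carrier N"
      using assms(2) that by (cases p; auto simp: fsupp_on_def)+
    have 1: "(\<lambda>j. c p * of_bool (j = fst p)) \<in> fsupp_on (carrier N)"
      "(\<lambda>j. c p * of_bool (j = snd p)) \<in> fsupp_on (carrier N)"
      "(\<lambda>j. c p * of_bool (j = fst p \<otimes>\<^bsub>N\<^esub> snd p)) \<in> fsupp_on (carrier N)"
      using p by (auto intro!: of_bool_fsupp_on)
    show ?thesis
      using fsupp_on_add[OF fsupp_on_add[OF 1(2) fsupp_on_uminus[OF 1(3)]] 1(1)]
      by (simp add: a_minus_free_module_rat free_single_rat add_free_module_rat 1 bar_relation_def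
          algebra_simps plus_fun_def fun_diff_def fun_Compl_def)
  qed
  show ?thesis
    unfolding bar_diff2_def rat_boundary_def Let_def
    by (subst finsum_free_module_rat) (use * in \<open>auto intro!: sum.cong\<close>)
qed

text \<open>The pairing that turns homomorphisms to the rationals into functionals on first
  homology. It is linear in \<open>\<phi>\<close> as well, so chains also serve as functionals on
  characters.\<close>

definition chain_eval :: "('a \<Rightarrow> rat) \<Rightarrow> ('a \<Rightarrow> rat) \<Rightarrow> rat" where
  "chain_eval y \<phi> = (\<Sum>g | y g \<noteq> 0. y g * \<phi> g)"

lemma chain_eval_superset:
  assumes "finite S" "{g. y g \<noteq> 0} \<subseteq> S"
  shows "chain_eval y \<phi> = (\<Sum>g\<in>S. y g * \<phi> g)"
  unfolding chain_eval_def by (rule sum.mono_neutral_left) (use assms in auto)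

lemma chain_eval_add:
  assumes "c \<in> fsupp_on S" "d \<in> fsupp_on S"
  shows "chain_eval (c + d) \<phi> = chain_eval c \<phi> + chain_eval d \<phi>"
proof -
  let ?S = "{g. c g \<noteq> 0} \<union> {g. d g \<noteq> 0}"
  have "finite ?S"
    using assms by (auto simp: fsupp_on_def)
  then have "chain_eval e \<phi> = (\<Sum>g\<in>?S. e g * \<phi> g)" if "e = c + d \<or> e = c \<or> e = d" for e
    by (intro chain_eval_superset) (use that in auto)
  then show ?thesis
    by (simp add: algebra_simps sum.distrib)
qed

lemma chain_eval_smult: "chain_eval (\<lambda>x. r * c x) \<phi> = r * chain_eval c \<phi>"
  by (cases "r = 0") (simp_all add: chain_eval_def sum_distrib_left mult.assoc)

lemma chain_eval_chain1: "chain_eval (chain1 g) \<phi> = \<phi> g"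
  by (simp add: chain_eval_def)

lemma sum_fun_apply: "sum f A x = (\<Sum>a\<in>A. f a x)"
  by (induction A rule: infinite_finite_induct) auto

lemma rat_boundary_superset:
  assumes "finite S" "{p. c p \<noteq> 0} \<subseteq> S"
  shows "rat_boundary N c = (\<lambda>i. \<Sum>p\<in>S. c p * bar_relation N p i)"
proof -
  have "rat_boundary N c = (\<Sum>p\<in>S. (\<lambda>i. c p * bar_relation N p i))"
    unfolding rat_boundary_def
    by (rule sum.mono_neutral_left[OF assms]) (simp add: fun_eq_iff)
  then show ?thesis
    by (simp add: fun_eq_iff sum_fun_apply)
qed

definition rat_boundaries :: "('a, 'm) monoid_scheme \<Rightarrow> ('a \<Rightarrow> rat) set" where
  "rat_boundaries N = rat_boundary N ` fsupp_on (carrier N \<times> carrier N)"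

context group
begin

lemma bar_relation_fsupp:
  assumes "p \<in> carrier G \<times> carrier G"
  shows "bar_relation G p \<in> fsupp_on (carrier G)"
proof -
  have "chain1 (snd p) + - chain1 (fst p \<otimes> snd p) + chain1 (fst p) \<in> fsupp_on (carrier G)"
    using assms by (intro fsupp_on_add fsupp_on_uminus chain1_fsupp_on) auto
  then show ?thesis
    by (simp add: bar_relation_def)
qed

lemma fsupp_on_sum: "(\<And>p. p \<in> P \<Longrightarrow> f p \<in> fsupp_on S) \<Longrightarrow> sum f P \<in> fsupp_on S"
  by (induction P rule: infinite_finite_induct) (auto intro: fsupp_on_add fsupp_on_zero)

lemma rat_boundaries_subset: "rat_boundaries G \<subseteq> fsupp_on (carrier G)"
proof
  fix b assume "b \<in> rat_boundaries G"
  then obtain c where c: "c \<in> fsupp_on (carrier G \<times> carrier G)" "b = rat_boundary G c"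
    by (auto simp: rat_boundaries_def)
  then show "b \<in> fsupp_on (carrier G)"
    unfolding c rat_boundary_def
    by (intro fsupp_on_sum fsupp_on_smult bar_relation_fsupp) (auto simp: fsupp_on_def)
qed

lemma rat_boundaries_add:
  assumes "b \<in> rat_boundaries G" "b' \<in> rat_boundaries G"
  shows "b + b' \<in> rat_boundaries G"
proof -
  obtain c d where c: "c \<in> fsupp_on (carrier G \<times> carrier G)" "b = rat_boundary G c"
    and d: "d \<in> fsupp_on (carrier G \<times> carrier G)" "b' = rat_boundary G d"
    using assms by (auto simp: rat_boundaries_def)
  let ?S = "{p. c p \<noteq> 0} \<union> {p. d p \<noteq> 0}"
  have "finite ?S"
    using c d by (auto simp: fsupp_on_def)
  then have *: "rat_boundary G e = (\<lambda>i. \<Sum>p\<in>?S. e p * bar_relation G p i)"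
    if "{p. e p \<noteq> 0} \<subseteq> ?S" for e
    by (intro rat_boundary_superset) (use that in auto)
  have "b + b' = rat_boundary G (c + d)"
    unfolding c d *[of c, OF Un_upper1] *[of d, OF Un_upper2]
    by (subst *) (auto simp: fun_eq_iff distrib_right sum.distrib)
  then show ?thesis
    using c d by (auto simp: rat_boundaries_def intro!: imageI fsupp_on_add)
qed

lemma rat_boundaries_smult:
  assumes "b \<in> rat_boundaries G"
  shows "(\<lambda>x. r * b x) \<in> rat_boundaries G"
proof -
  obtain c where c: "c \<in> fsupp_on (carrier G \<times> carrier G)" "b = rat_boundary G c"
    using assms by (auto simp: rat_boundaries_def)
  have "finite {p. c p \<noteq> 0}"
    using c by (auto simp: fsupp_on_def)
  then have *: "rat_boundary G e = (\<lambda>i. \<Sum>p | c p \<noteq> 0. e p * bar_relation G p i)"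
    if "{p. e p \<noteq> 0} \<subseteq> {p. c p \<noteq> 0}" for e
    by (intro rat_boundary_superset) (use that in auto)
  have "(\<lambda>x. r * b x) = rat_boundary G (\<lambda>x. r * c x)"
    unfolding c *[of c, OF subset_refl]
    by (subst *) (auto simp: mult.assoc sum_distrib_left)
  then show ?thesis
    using c by (auto simp: rat_boundaries_def intro!: imageI fsupp_on_smult)
qed

lemma rat_boundaries_zero: "0 \<in> rat_boundaries G"
  unfolding rat_boundaries_def
  by (rule image_eqI[of _ _ 0]) (auto simp: rat_boundary_def fsupp_on_zero)

lemma rat_boundaries_uminus: "b \<in> rat_boundaries G \<Longrightarrow> - b \<in> rat_boundaries G"
  using rat_boundaries_smult[of b "-1"] by (simp add: fun_Compl_def)

lemma bar_relation_in_boundaries: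
  assumes "p \<in> carrier G \<times> carrier G"
  shows "bar_relation G p \<in> rat_boundaries G"
  unfolding rat_boundaries_def
  by (rule image_eqI[of _ _ "chain1 p"])
    (use assms in \<open>auto simp: rat_boundary_def fsupp_on_def fun_eq_iff\<close>)

lemma chain_eval_boundary:
  assumes hom: "\<And>g h. g \<in> carrier G \<Longrightarrow> h \<in> carrier G \<Longrightarrow> \<phi> (g \<otimes> h) = \<phi> g + \<phi> h"
    and b: "b \<in> rat_boundaries G"
  shows "chain_eval b \<phi> = 0"
proof -
  obtain c where c: "c \<in> fsupp_on (carrier G \<times> carrier G)" "b = rat_boundary G c"
    using b by (auto simp: rat_boundaries_def)
  have 1: "chain_eval (bar_relation G p) \<phi> = 0" if p: "p \<in> carrier G \<times> carrier G" for p
  proof -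
    obtain g h where p: "p = (g, h)" "g \<in> carrier G" "h \<in> carrier G" using p by auto
    have "chain_eval (bar_relation G p) \<phi> + chain_eval (chain1 (g \<otimes> h)) \<phi> =
        chain_eval (bar_relation G p + chain1 (g \<otimes> h)) \<phi>"
      using p by (intro chain_eval_add[symmetric, of _ "carrier G"] bar_relation_fsupp chain1_fsupp_on) auto
    also have "bar_relation G p + chain1 (g \<otimes> h) = chain1 h + chain1 g"
      by (simp add: bar_relation_def p)
    also have "chain_eval (chain1 h + chain1 g) \<phi> = chain_eval (chain1 h) \<phi> + chain_eval (chain1 g) \<phi>"
      using p by (intro chain_eval_add[of _ "carrier G"] chain1_fsupp_on)
    finally show ?thesis
      using p by (simp add: chain_eval_chain1 hom)
  qed
  have "sum f P \<in> fsupp_on (carrier G) \<and> chain_eval (sum f P) \<phi> = 0"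
    if "\<forall>p\<in>P. f p \<in> fsupp_on (carrier G) \<and> chain_eval (f p) \<phi> = 0" for f and P :: "('a \<times> 'a) set"
    using that by (induction P rule: infinite_finite_induct)
      (simp_all add: fsupp_on_add fsupp_on_zero chain_eval_add[of _ "carrier G"], simp_all add: chain_eval_def)
  note 2 = this[THEN conjunct2]
  show ?thesis
    unfolding c rat_boundary_def
  proof (intro 2 ballI conjI fsupp_on_smult bar_relation_fsupp)
    fix p assume "p \<in> {p. c p \<noteq> 0}"
    then show p: "p \<in> carrier G \<times> carrier G"
      using c(1) unfolding fsupp_on_def by blast
    show "chain_eval (\<lambda>i. c p * bar_relation G p i) \<phi> = 0"
      by (simp add: chain_eval_smult 1[OF p])
  qed
qed

end

text \<open>Take a basis \<open>B\<close> of \<open>U\<close>, add \<open>y\<close>, prescribe 0 on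
  \<open>B\<close> and 1 at \<open>y\<close>, and extend linearly. The ambient space consists of all
  functions, so no support condition has to be carried along.\<close>

lemma rat_functional_separation:
  fixes U :: "('a \<Rightarrow> rat) set"
  assumes zero: "0 \<in> U" and add: "\<And>c d. c \<in> U \<Longrightarrow> d \<in> U \<Longrightarrow> c + d \<in> U"
    and smult: "\<And>r c. c \<in> U \<Longrightarrow> (\<lambda>x. r * c x) \<in> U" and y: "y \<notin> U"
  shows "\<exists>f :: ('a \<Rightarrow> rat) \<Rightarrow> rat. (\<forall>c d. f (c + d) = f c + f d) \<and> (\<forall>r c. f (\<lambda>x. r * c x) = r * f c) \<and>
    (\<forall>c\<in>U. f c = 0) \<and> f y = 1"
proof -
  let ?s = "\<lambda>(r :: rat) (f :: 'a \<Rightarrow> rat) x. r * f x"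
  interpret V: vector_space ?s
    by unfold_locales (auto simp: fun_eq_iff algebra_simps)
  interpret W: vector_space "(*) :: rat \<Rightarrow> rat \<Rightarrow> rat"
    by unfold_locales (auto simp: algebra_simps)
  interpret P: vector_space_pair ?s "(*) :: rat \<Rightarrow> rat \<Rightarrow> rat" ..
  have sub: "V.subspace U"
    using zero add smult by (intro V.subspaceI)
  obtain B where B: "B \<subseteq> U" "V.independent B" "U \<subseteq> V.span B"
    using V.maximal_independent_subset by blast
  have spB: "V.span B \<subseteq> U"
    using V.span_minimal[OF B(1) sub] .
  then have yB: "y \<notin> V.span B"
    using y by auto
  then have "V.independent (insert y B)"
    using B(2) by (simp add: V.independent_insert)
  from P.linear_independent_extend[OF this, of "\<lambda>x. if x = y then 1 else 0"]
  obtain f where f: "Vector_Spaces.linear ?s (*) f"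
    "\<And>x. x \<in> insert y B \<Longrightarrow> f x = (if x = y then 1 else 0)"
    by blast
  have y': "y \<notin> B"
    using yB V.span_superset by blast
  interpret f: Vector_Spaces.linear ?s "(*)" f by fact
  have "f c = 0" if "c \<in> U" for c
    using P.linear_eq_0_on_span[OF f(1), of B c] f(2) y' that B(3) by (metis insertCI subsetD)
  then show ?thesis
    using f(2)[of y] f.add f.scale by (intro exI[of _ f] conjI allI ballI) auto
qed

lemma additive_sum:
  fixes f :: "'a :: ab_group_add \<Rightarrow> 'b :: ab_group_add"
  assumes "\<And>c d. f (c + d) = f c + f d"
  shows "f (sum h P) = (\<Sum>p\<in>P. f (h p))"
proof -
  have "f 0 = 0"
    using assms[of 0 0] by simp
  then show ?thesis
    by (induction P rule: infinite_finite_induct) (simp_all add: assms)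
qed

lemma fsupp_on_as_sum:
  assumes "c \<in> fsupp_on S"
  shows "c = (\<Sum>g | c g \<noteq> 0. (\<lambda>x. c g * chain1 g x))"
proof
  fix x
  have "finite {g. c g \<noteq> 0}"
    using assms by (simp add: fsupp_on_def)
  then show "c x = (\<Sum>g | c g \<noteq> 0. (\<lambda>x. c g * chain1 g x)) x"
    by (simp add: sum_fun_apply of_bool_def if_distrib[of "\<lambda>x. _ * x"] sum.delta' cong: if_cong)
qed

text \<open>For trivial coefficients \<open>r[g]\<close> is sent to \<open>r - r\<close>, so every
  1-chain is a cycle.\<close>

lemma first_homology_rat:
  fixes N :: "('a, 'm) monoid_scheme"
  assumes "group N"
  shows "first_homology (class_ring :: rat ring) (\<lambda>g. 1) N =
    quotient_module (free_module (class_ring :: rat ring) (carrier N)) (rat_boundaries N)"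
proof -
  have "bar_diff1 (class_ring :: rat ring) (\<lambda>g. 1) c = 0" for c :: "'a \<Rightarrow> rat"
    unfolding bar_diff1_def by (simp add: class_ring_simps)
  moreover have "bar_diff2 (class_ring :: rat ring) (\<lambda>g. 1) N ` fsupp_on (carrier N \<times> carrier N) = rat_boundaries N"
    unfolding rat_boundaries_def using bar_diff2_rat[OF assms] by (auto intro!: image_cong)
  ultimately show ?thesis
    unfolding first_homology_def Let_def by (simp add: carrier_free_module_rat flip: carrier_free_module_rat)
qed

definition rat_characters :: "('a, 'm) monoid_scheme \<Rightarrow> ('a \<Rightarrow> rat) set" where
  "rat_characters N = {\<phi>. \<forall>g\<in>carrier N. \<forall>h\<in>carrier N. \<phi> (g \<otimes>\<^bsub>N\<^esub> h) = \<phi> g + \<phi> h}"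

section \<open>Chains modulo boundaries as a vector space, in duality with the characters\<close>

locale rat_homology = group N for N :: "('a, 'm) monoid_scheme"
begin

abbreviation "C1 \<equiv> free_module (class_ring :: rat ring) (carrier N)"
abbreviation "B1 \<equiv> rat_boundaries N"
abbreviation "H1 \<equiv> quotient_module C1 B1"

sublocale C1: abelian_group C1
  by (rule abelian_group_free_module_rat)

sublocale C1B1: abelian_subgroup B1 C1
proof (rule abelian_subgroupI3)
  show "additive_subgroup B1 C1"
  proof
    show "inv\<^bsub>add_monoid C1\<^esub> b \<in> B1" if "b \<in> B1" for b
    proof -
      have "\<ominus>\<^bsub>C1\<^esub> b = - b"
        using that rat_boundaries_subset
        by (intro C1.minus_equality)
          (auto simp: carrier_free_module_rat add_free_module_rat zero_free_module_rat intro!: fsupp_on_uminus)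
      then show ?thesis
        using rat_boundaries_uminus[OF that] by (simp add: a_inv_def)
    qed
  qed (use rat_boundaries_subset in \<open>auto simp: carrier_free_module_rat add_free_module_rat
      zero_free_module_rat rat_boundaries_add rat_boundaries_zero\<close>)
  show "abelian_group C1" ..
qed

text \<open>The homology class of a chain.\<close>

definition q :: "('a \<Rightarrow> rat) \<Rightarrow> ('a \<Rightarrow> rat) set" where
  "q c = B1 +>\<^bsub>C1\<^esub> c"

lemma q_eq: "q c = (\<lambda>b. b + c) ` B1"
  by (auto simp: q_def a_r_coset_def' add_free_module_rat)

lemma carrier_H1: "carrier H1 = q ` fsupp_on (carrier N)"
  by (auto simp: quotient_module_def A_RCOSETS_def' q_def carrier_free_module_rat)

lemma q_eq_iff:
  "q c = q d \<longleftrightarrow> c - d \<in> B1"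
proof
  assume "q c = q d"
  moreover have "c \<in> q c"
    unfolding q_eq by (rule image_eqI[of _ _ 0]) (auto simp: rat_boundaries_zero)
  ultimately show "c - d \<in> B1"
    unfolding q_eq by auto
next
  assume *: "c - d \<in> B1"
  have "b + c \<in> q d" "b + d \<in> q c" if "b \<in> B1" for b
  proof -
    show "b + c \<in> q d"
      unfolding q_eq by (rule image_eqI[of _ _ "b + (c - d)"]) (auto intro: rat_boundaries_add * that)
    show "b + d \<in> q c"
      unfolding q_eq
      by (rule image_eqI[of _ _ "b + - (c - d)"]) (simp, rule rat_boundaries_add[OF that rat_boundaries_uminus[OF *]])
  qed
  then show "q c = q d"
    by (auto simp: q_eq)
qed

lemma mem_q: "d \<in> q c \<longleftrightarrow> d - c \<in> B1"
proof
  assume "d - c \<in> B1"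
  then show "d \<in> q c"
    unfolding q_eq by (intro image_eqI[of _ _ "d - c"]) auto
qed (auto simp: q_eq image_iff)

lemma add_H1:
  assumes "c \<in> fsupp_on (carrier N)" "d \<in> fsupp_on (carrier N)"
  shows "q c \<oplus>\<^bsub>H1\<^esub> q d = q (c + d)"
  using C1B1.a_rcos_sum[of c d] assms
  by (simp add: quotient_module_def q_def carrier_free_module_rat add_free_module_rat)

lemma smult_H1: "r \<odot>\<^bsub>H1\<^esub> q c = q (\<lambda>x. r * c x)"
proof -
  have "r \<odot>\<^bsub>H1\<^esub> q c = (\<Union>d\<in>q c. q (\<lambda>x. r * d x))"
    by (simp add: quotient_module_def q_def smult_free_module_rat)
  \<comment> \<open>Scalar multiplication on the quotient unites the cosets of all multiples of
    members; as boundaries are closed under scaling, these cosets coincide.\<close>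
  also have "\<dots> = (\<Union>d\<in>q c. q (\<lambda>x. r * c x))"
  proof (rule SUP_cong)
    fix d assume "d \<in> q c"
    then have "(\<lambda>x. r * (d - c) x) \<in> B1"
      by (simp add: mem_q rat_boundaries_smult del: minus_apply)
    moreover have "(\<lambda>x. r * (d - c) x) = (\<lambda>x. r * d x) - (\<lambda>x. r * c x)"
      by (simp add: fun_eq_iff algebra_simps)
    ultimately show "q (\<lambda>x. r * d x) = q (\<lambda>x. r * c x)"
      by (simp only: q_eq_iff)
  qed simp
  also have "\<dots> = q (\<lambda>x. r * c x)"
    using rat_boundaries_zero mem_q[of c c] by auto
  finally show ?thesis .
qed

lemma zero_H1: "\<zero>\<^bsub>H1\<^esub> = q 0"
  by (simp add: quotient_module_def q_eq)

lemma vectorspace_H1: "vectorspace (class_ring :: rat ring) H1"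
proof -
  have "abelian_group H1"
  proof (rule abelian_groupI)
    fix x assume "x \<in> carrier H1"
    then obtain c where c: "c \<in> fsupp_on (carrier N)" "x = q c"
      by (auto simp: carrier_H1)
    show "\<exists>y\<in>carrier H1. y \<oplus>\<^bsub>H1\<^esub> x = \<zero>\<^bsub>H1\<^esub>"
      using c by (intro bexI[of _ "q (- c)"]) (auto simp: carrier_H1 add_H1 zero_H1 fsupp_on_uminus)
  qed (auto simp: carrier_H1 add_H1 zero_H1 fsupp_on_add fsupp_on_zero algebra_simps)
  then have "module (class_ring :: rat ring) H1"
    by (intro moduleI)
     (auto simp: carrier_H1 add_H1 smult_H1 zero_H1 fsupp_on_add fsupp_on_smult algebra_simps
       plus_fun_def intro!: class_cring.cring_axioms)
  then show ?thesis
    by (intro vectorspace.intro) (auto intro: class_field)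
qed

text \<open>The classes with a representative annihilated by \<open>\<phi>\<close> form a submodule,
  so annihilation passes from generators to the whole span.\<close>

lemma span_subset_kernel:
  assumes hom: "\<And>g h. g \<in> carrier N \<Longrightarrow> h \<in> carrier N \<Longrightarrow> \<phi> (g \<otimes>\<^bsub>N\<^esub> h) = \<phi> g + \<phi> h"
    and A: "A \<subseteq> q ` {c \<in> fsupp_on (carrier N). chain_eval c \<phi> = 0}"
  shows "LinearCombinations.module.span (class_ring :: rat ring) H1 A \<subseteq> q ` {c \<in> fsupp_on (carrier N). chain_eval c \<phi> = 0}"
proof -
  interpret V: vectorspace "class_ring :: rat ring" H1
    by (rule vectorspace_H1)
  have "submodule (class_ring :: rat ring) (q ` {c \<in> fsupp_on (carrier N). chain_eval c \<phi> = 0}) H1"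
  proof
    show "q ` {c \<in> fsupp_on (carrier N). chain_eval c \<phi> = 0} \<subseteq> carrier H1"
      by (auto simp: carrier_H1)
    show "\<zero>\<^bsub>H1\<^esub> \<in> q ` {c \<in> fsupp_on (carrier N). chain_eval c \<phi> = 0}"
      unfolding zero_H1 by (rule imageI) (simp add: fsupp_on_def chain_eval_def)
  next
    fix r X assume "X \<in> q ` {c \<in> fsupp_on (carrier N). chain_eval c \<phi> = 0}"
    then obtain c where c: "X = q c" "c \<in> fsupp_on (carrier N)" "chain_eval c \<phi> = 0"
      by blast
    show "r \<odot>\<^bsub>H1\<^esub> X \<in> q ` {c \<in> fsupp_on (carrier N). chain_eval c \<phi> = 0}"
      unfolding c(1) smult_H1
      using fsupp_on_smult[OF c(2)] chain_eval_smult[of r c \<phi>] c(3) by auto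
  qed (auto simp: add_H1 chain_eval_add[of _ "carrier N"] V.module_axioms intro!: imageI fsupp_on_add)
  then show ?thesis
    using A V.span_is_subset by blast
qed

lemma betti1_eq: "betti1 N = vectorspace.dim (class_ring :: rat ring) H1"
  unfolding betti1_def by (simp add: first_homology_rat group_axioms)

text \<open>Were the span proper, a linear functional would kill its preimage \<open>U\<close> but
  not some chain \<open>y\<close>. It kills the boundaries, hence restricts to a character on group
  elements; this vanishes on \<open>E\<close>, so everywhere, and the functional would vanish at
  \<open>y\<close>.\<close>

lemma gen_set_if_detects:
  assumes E: "E \<subseteq> carrier N"
    and detects: "\<forall>\<phi>\<in>rat_characters N. (\<forall>e\<in>E. \<phi> e = 0) \<longrightarrow> (\<forall>g\<in>carrier N. \<phi> g = 0)"
  shows "LinearCombinations.module.span (class_ring :: rat ring) H1 ((\<lambda>e. q (chain1 e)) ` E) = carrier H1"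
proof -
  interpret V: vectorspace "class_ring :: rat ring" H1
    by (rule vectorspace_H1)
  let ?A = "(\<lambda>e. q (chain1 e)) ` E"
  have A: "?A \<subseteq> carrier H1"
    using E by (auto simp: carrier_H1 intro!: imageI chain1_fsupp_on)
  interpret W: submodule "class_ring :: rat ring" "V.span ?A" H1
    by (rule V.span_is_submodule[OF A])
  define U where "U = {c \<in> fsupp_on (carrier N). q c \<in> V.span ?A}"
  have "y \<in> U" if y: "y \<in> fsupp_on (carrier N)" for y
  proof (rule ccontr)
    assume yU: "y \<notin> U"
    have U0: "0 \<in> U"
      using W.zero_closed by (auto simp: U_def fsupp_on_zero zero_H1)
    have Uadd: "c + d \<in> U" if "c \<in> U" "d \<in> U" for c d
      using that W.m_closed[of "q c" "q d"] by (simp add: U_def fsupp_on_add add_H1)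
    have Usmult: "(\<lambda>x. r * c x) \<in> U" if "c \<in> U" for r c
      using that W.smult_closed[of r "q c"] fsupp_on_smult[of c "carrier N" r] by (simp add: U_def smult_H1)
    have "\<exists>f :: ('a \<Rightarrow> rat) \<Rightarrow> rat. (\<forall>c d. f (c + d) = f c + f d) \<and> (\<forall>r c. f (\<lambda>x. r * c x) = r * f c) \<and>
        (\<forall>c\<in>U. f c = 0) \<and> f y = 1"
    proof (rule rat_functional_separation)
      show "0 \<in> U" by (rule U0)
      show "y \<notin> U" by (rule yU)
      show "c + d \<in> U" if "c \<in> U" "d \<in> U" for c d
        using that by (rule Uadd)
      show "(\<lambda>x. r * c x) \<in> U" if "c \<in> U" for r c
        using that by (rule Usmult)
    qed
    then obtain f :: "('a \<Rightarrow> rat) \<Rightarrow> rat" where f: "\<And>c d. f (c + d) = f c + f d"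
      "\<And>r c. f (\<lambda>x. r * c x) = r * f c" "\<And>c. c \<in> U \<Longrightarrow> f c = 0" "f y = 1"
      by blast
    have BU: "B1 \<subseteq> U"
    proof
      fix b assume b: "b \<in> B1"
      then have "q b = q 0"
        by (simp add: q_eq_iff)
      then show "b \<in> U"
        using b U0 rat_boundaries_subset by (auto simp: U_def)
    qed
    have chi: "(\<lambda>g. f (chain1 g)) \<in> rat_characters N"
      unfolding rat_characters_def
    proof (intro CollectI ballI)
      fix g h assume gh: "g \<in> carrier N" "h \<in> carrier N"
      then have "f (bar_relation N (g, h)) = 0"
        using BU bar_relation_in_boundaries[of "(g, h)"] by (intro f(3)) auto
      moreover have "bar_relation N (g, h) + chain1 (g \<otimes>\<^bsub>N\<^esub> h) = chain1 g + chain1 h"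
        by (simp add: bar_relation_def)
      ultimately show "f (chain1 (g \<otimes>\<^bsub>N\<^esub> h)) = f (chain1 g) + f (chain1 h)"
        using f(1)[of "bar_relation N (g, h)" "chain1 (g \<otimes>\<^bsub>N\<^esub> h)"] f(1)[of "chain1 g" "chain1 h"] by simp
    qed
    have chi_E: "f (chain1 e) = 0" if e: "e \<in> E" for e
    proof -
      have "q (chain1 e) \<in> V.span ?A"
        using V.in_own_span[OF A] e by auto
      then show "f (chain1 e) = 0"
        using e E by (intro f(3)) (auto simp: U_def chain1_fsupp_on)
    qed
    have "\<forall>g\<in>carrier N. f (chain1 g) = 0"
      by (rule mp[OF bspec[OF detects chi]], rule ballI, rule chi_E)
    then have 0: "f (\<lambda>x. y g * chain1 g x) = 0" if "g \<in> {g. y g \<noteq> 0}" for g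
    proof -
      have "g \<in> carrier N"
        using that y unfolding fsupp_on_def by blast
      then show ?thesis
        using f(2)[of "y g" "chain1 g"] \<open>\<forall>g\<in>carrier N. f (chain1 g) = 0\<close> by simp
    qed
    have f_sum: "f (sum h P) = (\<Sum>p\<in>P. f (h p))" for h and P :: "'a set"
    proof (rule additive_sum[of f h P])
      show "f (c + d) = f c + f d" for c d
        by (rule f(1))
    qed
    have "f y = f (\<Sum>g | y g \<noteq> 0. (\<lambda>x. y g * chain1 g x))"
      by (rule arg_cong[OF fsupp_on_as_sum[OF y]])
    also have "\<dots> = 0"
      unfolding f_sum by (rule sum.neutral) (use 0 in blast)
    finally show False
      using f(4) by simp
  qed
  then have "carrier H1 \<subseteq> V.span ?A"
    by (auto simp: carrier_H1 U_def)
  then show ?thesis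
    using W.subset by auto
qed

end

section \<open>Betti numbers and finite sets that detect characters\<close>

lemma betti1_le_card:
  fixes N :: "('a, 'm) monoid_scheme"
  assumes "group N" "finite E" "E \<subseteq> carrier N"
    and "\<forall>\<phi>\<in>rat_characters N. (\<forall>e\<in>E. \<phi> e = 0) \<longrightarrow> (\<forall>g\<in>carrier N. \<phi> g = 0)"
  shows "betti1 N \<le> card E"
proof -
  interpret rat_homology N
    by (rule rat_homology.intro) fact
  interpret V: vectorspace "class_ring :: rat ring" H1
    by (rule vectorspace_H1)
  let ?A = "(\<lambda>e. q (chain1 e)) ` E"
  have "V.dim \<le> card ?A"
  proof (rule V.gen_ge_dim)
    show "?A \<subseteq> carrier H1"
      using assms(3) by (auto simp: carrier_H1 intro!: imageI chain1_fsupp_on)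
    show "finite ?A"
      using assms(2) by (rule finite_imageI)
    show "V.gen_set ?A"
      by (rule gen_set_if_detects[OF assms(3,4)])
  qed
  also have "\<dots> \<le> card E"
    by (rule card_image_le[OF assms(2)])
  finally show ?thesis
    by (simp add: betti1_eq)
qed

text \<open>Serves lower bounds by contradiction: a small Betti number leaves few linear conditions
  that only the zero character satisfies. The conditions are representatives of a generating set of
  minimal size.\<close>

lemma betti1_detecting_chains:
  fixes N :: "('a, 'm) monoid_scheme"
  assumes "group N" "finite E" "E \<subseteq> carrier N"
    and "\<forall>\<phi>\<in>rat_characters N. (\<forall>e\<in>E. \<phi> e = 0) \<longrightarrow> (\<forall>g\<in>carrier N. \<phi> g = 0)"
  obtains Y where "finite Y" "card Y \<le> betti1 N" "Y \<subseteq> fsupp_on (carrier N)"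
    "\<forall>\<phi>\<in>rat_characters N. (\<forall>y\<in>Y. chain_eval y \<phi> = 0) \<longrightarrow> (\<forall>g\<in>carrier N. \<phi> g = 0)"
proof -
  interpret rat_homology N
    by (rule rat_homology.intro) fact
  interpret V: vectorspace "class_ring :: rat ring" H1
    by (rule vectorspace_H1)
  let ?A = "(\<lambda>e. q (chain1 e)) ` E"
  have "?A \<subseteq> carrier H1"
    using assms(3) by (auto simp: carrier_H1 intro!: imageI chain1_fsupp_on)
  moreover have "finite ?A"
    using assms(2) by simp
  moreover have "V.gen_set ?A"
    by (rule gen_set_if_detects[OF assms(3,4)])
  ultimately have ex: "\<exists>n A. finite A \<and> card A = n \<and> A \<subseteq> carrier H1 \<and> V.gen_set A"
    by (intro exI conjI) (assumption | rule refl)+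
  \<comment> \<open>The dimension is the least size of a finite generating set; the classes of
    \<open>E\<close> form one, so the minimum is attained.\<close>
  have "\<exists>A. finite A \<and> card A = V.dim \<and> A \<subseteq> carrier H1 \<and> V.gen_set A"
    unfolding V.dim_def by (rule LeastI_ex[OF ex])
  then obtain A where A: "finite A" "card A = V.dim" "A \<subseteq> carrier H1" "V.gen_set A"
    by (elim exE conjE)
  from A(3) have "\<exists>Y. Y \<subseteq> fsupp_on (carrier N) \<and> inj_on q Y \<and> A = q ` Y"
    unfolding carrier_H1 subset_image_inj .
  then obtain Y where Y: "Y \<subseteq> fsupp_on (carrier N)" "inj_on q Y" "A = q ` Y"
    by (elim exE conjE)
  show thesis
  proof (rule that[of Y])
    show "finite Y"
      by (rule finite_imageD[OF _ Y(2)]) (use A(1) Y(3) in simp)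
    show "card Y \<le> betti1 N"
      using A(2) Y by (simp add: card_image betti1_eq)
    show "Y \<subseteq> fsupp_on (carrier N)"
      by fact
    show "\<forall>\<phi>\<in>rat_characters N. (\<forall>y\<in>Y. chain_eval y \<phi> = 0) \<longrightarrow> (\<forall>g\<in>carrier N. \<phi> g = 0)"
    proof (intro ballI impI)
      fix \<phi> g
      assume \<phi>: "\<phi> \<in> rat_characters N" and 0: "\<forall>y\<in>Y. chain_eval y \<phi> = 0" and g: "g \<in> carrier N"
      have hom: "\<And>g h. g \<in> carrier N \<Longrightarrow> h \<in> carrier N \<Longrightarrow> \<phi> (g \<otimes>\<^bsub>N\<^esub> h) = \<phi> g + \<phi> h"
        using \<phi> by (simp add: rat_characters_def)
      have "q (chain1 g) \<in> carrier H1"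
        using g by (auto simp: carrier_H1 intro!: imageI chain1_fsupp_on)
      also have "carrier H1 = V.span A"
        using A(4) by simp
      also have "\<dots> \<subseteq> q ` {c \<in> fsupp_on (carrier N). chain_eval c \<phi> = 0}"
      proof (rule span_subset_kernel)
        show "A \<subseteq> q ` {c \<in> fsupp_on (carrier N). chain_eval c \<phi> = 0}"
          unfolding Y(3) by (rule image_mono) (use Y(1) 0 in blast)
        show "\<phi> (g \<otimes>\<^bsub>N\<^esub> h) = \<phi> g + \<phi> h" if "g \<in> carrier N" "h \<in> carrier N" for g h
          using that by (rule hom)
      qed
      finally obtain c where c: "c \<in> fsupp_on (carrier N)" "chain_eval c \<phi> = 0" "chain1 g - c \<in> B1"
        by (auto simp: q_eq_iff)
      have "chain_eval ((chain1 g - c) + c) \<phi> = chain_eval (chain1 g - c) \<phi> + chain_eval c \<phi>"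
        using c rat_boundaries_subset by (intro chain_eval_add[of _ "carrier N"]) auto
      moreover have "chain_eval (chain1 g - c) \<phi> = 0"
        by (rule chain_eval_boundary[OF _ c(3)]) (rule hom)
      moreover have "chain1 g - c + c = chain1 g"
        by simp
      ultimately show "\<phi> g = 0"
        by (simp only: c(2) chain_eval_chain1)
    qed
  qed
qed

section \<open>Linear systems over the rationals\<close>

definition lin_fun :: "(('i \<Rightarrow> rat) \<Rightarrow> rat) \<Rightarrow> bool" where
  "lin_fun L \<longleftrightarrow> (\<forall>c d r. L (\<lambda>i. c i + r * d i) = L c + r * L d)"

lemma lin_funD: "lin_fun L \<Longrightarrow> L (\<lambda>i. c i + r * d i) = L c + r * L d"
  unfolding lin_fun_def by (elim allE) assumption

lemma lin_fun_zero: "lin_fun L \<Longrightarrow> L (\<lambda>i. 0) = 0"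
  using lin_funD[of L "\<lambda>i. 0" "-1" "\<lambda>i. 0"] by simp

lemma lin_fun_expand:
  assumes L: "lin_fun L" and "finite I" and "\<And>i. i \<notin> I \<Longrightarrow> c i = 0"
  shows "L c = (\<Sum>i\<in>I. c i * L (chain1 i))"
  using assms(2,3)
proof (induction I arbitrary: c)
  case empty
  then have "c = (\<lambda>i. 0)" by auto
  then show ?case using lin_fun_zero[OF L] by simp
next
  case (insert i I)
  let ?d = "c(i := 0)"
  have "c = (\<lambda>j. ?d j + c i * chain1 i j)"
    by auto
  then have "L c = L (\<lambda>j. ?d j + c i * chain1 i j)"
    by (rule arg_cong)
  also have "\<dots> = L ?d + c i * L (chain1 i)"
    by (rule lin_funD[OF L])
  also have "L ?d = (\<Sum>j\<in>I. ?d j * L (chain1 j))"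
    by (rule insert.IH) (use insert.prems in auto)
  also have "\<dots> = (\<Sum>j\<in>I. c j * L (chain1 j))"
    by (rule sum.cong) (use insert.hyps in auto)
  finally show ?case
    using insert.hyps by simp
qed

text \<open>Gaussian elimination by induction on the equations: either equation \<open>j\<close> has
  a pivot variable \<open>k\<close>, which is eliminated, or it holds for every vector supported on
  \<open>I\<close>.\<close>

lemma homogeneous_system_nontrivial:
  fixes L :: "'j \<Rightarrow> ('i \<Rightarrow> rat) \<Rightarrow> rat"
  assumes "finite J" "finite I" "card J < card I" "\<And>j. j \<in> J \<Longrightarrow> lin_fun (L j)"
  shows "\<exists>c. (\<forall>i. i \<notin> I \<longrightarrow> c i = 0) \<and> (\<exists>i\<in>I. c i \<noteq> 0) \<and> (\<forall>j\<in>J. L j c = 0)"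
  using assms
proof (induction J arbitrary: I L)
  case empty
  then obtain i where "i \<in> I" by fastforce
  then show ?case by (intro exI[of _ "chain1 i"]) auto
next
  case (insert j J)
  have Lj: "lin_fun (L j)" using insert.prems by simp
  show ?case
  proof (cases "\<exists>i\<in>I. L j (chain1 i) \<noteq> 0")
    case True
    then obtain k where k: "k \<in> I" "L j (chain1 k) \<noteq> 0" by blast
    define l where "l = L j (chain1 k)"
    \<comment> \<open>The projection onto the kernel of \<open>L j\<close> along coordinate
      \<open>k\<close>. It changes only this coordinate, so a nonzero vector supported on
      \<open>I - {k}\<close> stays nonzero.\<close>
    define T where "T c = (\<lambda>i. c i + (- L j c / l) * chain1 k i)" for c
    have lin: "lin_fun (\<lambda>c. L j' (T c))" if j': "j' \<in> J" for j'
      unfolding lin_fun_def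
    proof (intro allI)
      fix c d r
      have Lj': "lin_fun (L j')" using insert.prems j' by simp
      have "L j' (T e) = L j' e + (- L j e / l) * L j' (chain1 k)" for e
        unfolding T_def by (rule lin_funD[OF Lj'])
      then show "L j' (T (\<lambda>i. c i + r * d i)) = L j' (T c) + r * L j' (T d)"
        by (simp add: lin_funD[OF Lj] lin_funD[OF Lj'] ring_distribs diff_divide_distrib add_divide_distrib)
    qed
    have cJ: "card J < card (I - {k})"
      using insert.prems insert.hyps k by simp
    have "\<exists>c. (\<forall>i. i \<notin> I - {k} \<longrightarrow> c i = 0) \<and> (\<exists>i\<in>I - {k}. c i \<noteq> 0) \<and> (\<forall>j'\<in>J. L j' (T c) = 0)"
      by (rule insert.IH[OF _ cJ lin]) (use insert.prems(1) in simp)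
    then obtain c where c: "\<forall>i. i \<notin> I - {k} \<longrightarrow> c i = 0" "\<exists>i\<in>I - {k}. c i \<noteq> 0" "\<forall>j'\<in>J. L j' (T c) = 0"
      by (elim exE conjE)
    have "L j (T c) = L j c + (- L j c / l) * L j (chain1 k)"
      unfolding T_def by (rule lin_funD[OF Lj])
    then have "L j (T c) = 0"
      using k by (simp add: l_def)
    moreover have Tc: "T c i = c i" if "i \<noteq> k" for i
      using that by (simp add: T_def)
    moreover have "\<forall>i. i \<notin> I \<longrightarrow> T c i = 0"
    proof (intro allI impI)
      fix i assume "i \<notin> I"
      then have "i \<noteq> k" "c i = 0"
        using k c(1) by blast+
      then show "T c i = 0"
        using Tc by simp
    qed
    moreover obtain i where i: "i \<in> I - {k}" "c i \<noteq> 0"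
      using c(2) by (elim bexE)
    then have "\<exists>i\<in>I. T c i \<noteq> 0"
      using Tc[of i] by (intro bexI[of _ i]) auto
    ultimately show ?thesis
      using c(3) by (intro exI[of _ "T c"] conjI ballI) auto
  next
    case False
    have cJ: "card J < card I"
      using insert.prems insert.hyps by simp
    have "\<exists>c. (\<forall>i. i \<notin> I \<longrightarrow> c i = 0) \<and> (\<exists>i\<in>I. c i \<noteq> 0) \<and> (\<forall>j'\<in>J. L j' c = 0)"
      by (rule insert.IH[OF _ cJ]) (use insert.prems in auto)
    then obtain c where c: "\<forall>i. i \<notin> I \<longrightarrow> c i = 0" "\<exists>i\<in>I. c i \<noteq> 0" "\<forall>j'\<in>J. L j' c = 0"
      by (elim exE conjE)
    have "L j c = (\<Sum>i\<in>I. c i * L j (chain1 i))"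
      by (rule lin_fun_expand[OF Lj]) (use insert.prems c in auto)
    also have "\<dots> = 0"
      by (rule sum.neutral) (use False in auto)
    finally show ?thesis
      using c by (intro exI[of _ c] conjI ballI) auto
  qed
qed

text \<open>Restricted to \<open>D\<close>, the space \<open>H\<close> is determined by finitely
  many coordinates, because \<open>E\<close> detects it; the exchange selects coordinates inside
  \<open>D\<close> itself. That every chosen point is seen by some member of \<open>H\<close> later
  makes it possible to give it a large order modulo a congruence kernel.\<close>

lemma finite_detecting_subset:
  fixes H :: "('a \<Rightarrow> rat) set"
  assumes "finite E" and "\<And>\<phi> \<psi> c. \<phi> \<in> H \<Longrightarrow> \<psi> \<in> H \<Longrightarrow> (\<lambda>x. \<phi> x + c * \<psi> x) \<in> H"
    and "\<And>\<phi> d. \<phi> \<in> H \<Longrightarrow> \<forall>e\<in>E. \<phi> e = 0 \<Longrightarrow> d \<in> D \<Longrightarrow> \<phi> d = 0"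
  shows "\<exists>X\<subseteq>D. finite X \<and> (\<forall>x\<in>X. \<exists>\<phi>\<in>H. \<phi> x \<noteq> 0) \<and>
    (\<forall>\<phi>\<in>H. (\<forall>x\<in>X. \<phi> x = 0) \<longrightarrow> (\<forall>d\<in>D. \<phi> d = 0))"
  using assms
proof (induction E arbitrary: H)
  case empty
  then show ?case by (intro exI[of _ "{}"]) auto
next
  case (insert e E)
  note lin = insert.prems(1) and det = insert.prems(2)
  show ?case
  proof (cases "\<exists>\<phi>\<in>H. (\<forall>e\<in>E. \<phi> e = 0) \<and> (\<exists>d\<in>D. \<phi> d \<noteq> 0)")
    case False
    show ?thesis
    proof (rule insert.IH)
      show "(\<lambda>y. \<phi> y + c * \<psi> y) \<in> H" if "\<phi> \<in> H" "\<psi> \<in> H" for \<phi> \<psi> c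
        using that by (rule lin)
      show "\<phi> d = 0" if "\<phi> \<in> H" "\<forall>e\<in>E. \<phi> e = 0" "d \<in> D" for \<phi> d
        using False that by blast
    qed
  next
    case True
    then obtain \<phi>0 x where \<phi>0: "\<phi>0 \<in> H" "\<forall>e\<in>E. \<phi>0 e = 0" "x \<in> D" "\<phi>0 x \<noteq> 0"
      by (elim bexE conjE)
    have e: "\<phi>0 e \<noteq> 0"
    proof
      assume "\<phi>0 e = 0"
      then have "\<phi>0 x = 0"
        using \<phi>0 by (intro det) simp_all
      then show False
        using \<phi>0(4) by simp
    qed
    \<comment> \<open>The point \<open>x\<close> of \<open>D\<close> is exchanged for \<open>e\<close>: on \<open>H'\<close> the smaller set \<open>E\<close> still detects.\<close>
    define H' where "H' = {\<phi> \<in> H. \<phi> x = 0}"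
    have "\<exists>X\<subseteq>D. finite X \<and> (\<forall>x\<in>X. \<exists>\<phi>\<in>H'. \<phi> x \<noteq> 0) \<and>
      (\<forall>\<phi>\<in>H'. (\<forall>x\<in>X. \<phi> x = 0) \<longrightarrow> (\<forall>d\<in>D. \<phi> d = 0))"
    proof (rule insert.IH)
      show "(\<lambda>y. \<phi> y + c * \<psi> y) \<in> H'" if "\<phi> \<in> H'" "\<psi> \<in> H'" for \<phi> \<psi> c
        using lin[of \<phi> \<psi> c] that by (simp add: H'_def)
      show "\<phi> d = 0" if \<phi>: "\<phi> \<in> H'" "\<forall>e\<in>E. \<phi> e = 0" "d \<in> D" for \<phi> d
      proof -
        have \<phi>': "\<phi> \<in> H" "\<phi> x = 0"
          using \<phi>(1) by (simp_all add: H'_def)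
        let ?\<chi> = "\<lambda>y. \<phi> y + (- \<phi> e / \<phi>0 e) * \<phi>0 y"
        have "?\<chi> \<in> H"
          using \<phi>'(1) \<phi>0(1) by (rule lin)
        moreover have "\<forall>e'\<in>insert e E. ?\<chi> e' = 0"
          using e \<phi>(2) \<phi>0(2) by simp
        ultimately have "?\<chi> x = 0"
          using \<phi>0(3) by (rule det)
        then have "\<phi> e = 0"
          using \<phi>'(2) \<phi>0(4) e by simp
        then show "\<phi> d = 0"
          using \<phi>(2) by (intro det[OF \<phi>'(1) _ \<phi>(3)]) simp
      qed
    qed
    then obtain X where X: "X \<subseteq> D" "finite X" "\<forall>x\<in>X. \<exists>\<phi>\<in>H'. \<phi> x \<noteq> 0"
      "\<forall>\<phi>\<in>H'. (\<forall>x\<in>X. \<phi> x = 0) \<longrightarrow> (\<forall>d\<in>D. \<phi> d = 0)"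
      by (elim exE conjE)
    show ?thesis
    proof (intro exI[of _ "insert x X"] conjI)
      show "insert x X \<subseteq> D"
        using X(1) \<phi>0(3) by simp
      show "finite (insert x X)"
        using X(2) by simp
      show "\<forall>x'\<in>insert x X. \<exists>\<phi>\<in>H. \<phi> x' \<noteq> 0"
        using X(3) \<phi>0 unfolding H'_def by blast
      show "\<forall>\<phi>\<in>H. (\<forall>x'\<in>insert x X. \<phi> x' = 0) \<longrightarrow> (\<forall>d\<in>D. \<phi> d = 0)"
        using X(4) unfolding H'_def by blast
    qed
  qed
qed

lemma ex_common_denominator:
  fixes f :: "'a \<Rightarrow> rat"
  assumes "finite E"
  shows "\<exists>q>0. \<forall>e\<in>E. of_nat q * f e \<in> \<int>"
  using assms
proof (induction E)
  case empty
  then show ?case by auto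
next
  case (insert e E)
  then obtain q where q: "q > 0" "\<forall>e\<in>E. of_nat q * f e \<in> \<int>" by blast
  obtain a b where ab: "f e = Rat.Fract a b" "b > 0" by (cases "f e")
  then have fe: "of_nat (nat b) * f e = of_int a"
    by (simp add: Fract_of_int_quotient)
  have "of_nat (q * nat b) * f e' \<in> \<int>" if e': "e' \<in> insert e E" for e'
  proof (cases "e' = e")
    case True
    have "of_nat (q * nat b) * f e = of_nat q * of_int a"
      unfolding of_nat_mult mult.assoc fe ..
    then show ?thesis using True by (simp del: of_nat_mult)
  next
    case False
    then have "of_nat q * f e' \<in> \<int>" using q(2) e' by blast
    then have "of_nat (nat b) * (of_nat q * f e') \<in> \<int>"
      by (rule Ints_mult[OF Ints_of_nat])
    then show ?thesis
      by (simp only: of_nat_mult mult.assoc mult.left_commute)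
  qed
  then show ?case
    using q ab by (intro exI[of _ "q * nat b"]) auto
qed

section \<open>Characters of finite index subgroups\<close>

text \<open>These represent the characters of \<open>A\<close> that vanish on the normal closure of \<open>R\<close> in \<open>G\<close>. The
  values outside \<open>A\<close> are irrelevant; a character of \<open>A\<close> has many representatives.\<close>

definition rat_homs :: "('a, 'm) monoid_scheme \<Rightarrow> 'a set \<Rightarrow> 'a set \<Rightarrow> ('a \<Rightarrow> rat) set" where
  "rat_homs G A R = {\<phi>. (\<forall>a\<in>A. \<forall>b\<in>A. \<phi> (a \<otimes>\<^bsub>G\<^esub> b) = \<phi> a + \<phi> b) \<and>
     (\<forall>g\<in>carrier G. \<forall>r\<in>R. \<phi> (g \<otimes>\<^bsub>G\<^esub> r \<otimes>\<^bsub>G\<^esub> inv\<^bsub>G\<^esub> g) = 0)}"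

text \<open>For finitely generated \<open>A\<close> and positive \<open>k\<close>, the preimage in
  \<open>A\<close> of the \<open>k\<close>-fold multiples in the abelianization modulo relators and
  torsion. The quotient is a sum of copies of Z/k, one for each independent character.\<close>

definition cong_kernel :: "('a, 'm) monoid_scheme \<Rightarrow> nat \<Rightarrow> 'a set \<Rightarrow> 'a set \<Rightarrow> 'a set" where
  "cong_kernel G k A R = {a \<in> A. \<forall>\<phi>\<in>rat_homs G A R. \<phi> ` A \<subseteq> \<int> \<longrightarrow> \<phi> a / of_nat k \<in> \<int>}"

lemma rat_homs_mono: "A' \<subseteq> A \<Longrightarrow> R' \<subseteq> R \<Longrightarrow> rat_homs G A R \<subseteq> rat_homs G A' R'"
  unfolding rat_homs_def by blast

context group
begin

lemma rat_homs_mult: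
  "\<phi> \<in> rat_homs G A R \<Longrightarrow> a \<in> A \<Longrightarrow> b \<in> A \<Longrightarrow> \<phi> (a \<otimes> b) = \<phi> a + \<phi> b"
  unfolding rat_homs_def by blast

lemma rat_homs_conj:
  "\<phi> \<in> rat_homs G A R \<Longrightarrow> g \<in> carrier G \<Longrightarrow> r \<in> R \<Longrightarrow> \<phi> (g \<otimes> r \<otimes> inv g) = 0"
  unfolding rat_homs_def by blast

lemma rat_homs_relator:
  assumes "\<phi> \<in> rat_homs G A R" "r \<in> R" "r \<in> carrier G"
  shows "\<phi> r = 0"
  using rat_homs_conj[OF assms(1) one_closed assms(2)] assms(3) by simp

lemma rat_homs_combination:
  assumes "\<phi> \<in> rat_homs G A R" "\<psi> \<in> rat_homs G A R"
  shows "(\<lambda>x. \<phi> x + c * \<psi> x) \<in> rat_homs G A R"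
  unfolding rat_homs_def
  using rat_homs_mult[OF assms(1)] rat_homs_mult[OF assms(2)] rat_homs_conj[OF assms(1)] rat_homs_conj[OF assms(2)]
  by (simp add: ring_distribs)

lemma rat_homs_scale:
  assumes "\<phi> \<in> rat_homs G A R"
  shows "(\<lambda>x. c * \<phi> x) \<in> rat_homs G A R"
  unfolding rat_homs_def
  using rat_homs_mult[OF assms(1)] rat_homs_conj[OF assms(1)]
  by (simp add: ring_distribs)

lemma rat_homs_one:
  assumes "\<phi> \<in> rat_homs G A R" "subgroup A G"
  shows "\<phi> \<one> = 0"
  using rat_homs_mult[OF assms(1), of \<one> \<one>] subgroup.one_closed[OF assms(2)] by simp

lemma rat_homs_inv:
  assumes "\<phi> \<in> rat_homs G A R" "subgroup A G" "a \<in> A"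
  shows "\<phi> (inv a) = - \<phi> a"
proof -
  have "a \<in> carrier G"
    using assms subgroup.mem_carrier by metis
  then show ?thesis
    using rat_homs_mult[OF assms(1), of a "inv a"] rat_homs_one[OF assms(1,2)]
      subgroup.m_inv_closed[OF assms(2,3)] assms(3) by simp
qed

lemma subgroup_nat_pow_closed:
  assumes "subgroup A G" "a \<in> A"
  shows "a [^] (n :: nat) \<in> A"
  by (induction n) (use assms in \<open>auto intro: subgroup.one_closed subgroup.m_closed\<close>)

lemma rat_homs_pow:
  assumes "\<phi> \<in> rat_homs G A R" "subgroup A G" "a \<in> A"
  shows "\<phi> (a [^] (n :: nat)) = of_nat n * \<phi> a"
proof (induction n)
  case 0
  then show ?case using rat_homs_one[OF assms(1,2)] by simp
next
  case (Suc n)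
  have "\<phi> (a [^] Suc n) = \<phi> (a [^] n) + \<phi> a"
    using rat_homs_mult[OF assms(1) subgroup_nat_pow_closed[OF assms(2,3), of n] assms(3)] by simp
  then show ?case
    using Suc.IH by (simp add: ring_distribs)
qed

lemma conj_mult:
  assumes "g \<in> carrier G" "a \<in> carrier G" "b \<in> carrier G"
  shows "g \<otimes> (a \<otimes> b) \<otimes> inv g = (g \<otimes> a \<otimes> inv g) \<otimes> (g \<otimes> b \<otimes> inv g)"
  using assms by (simp add: m_assoc inv_solve_left)

lemma conj_conj:
  assumes "g \<in> carrier G" "h \<in> carrier G" "a \<in> carrier G"
  shows "g \<otimes> (h \<otimes> a \<otimes> inv h) \<otimes> inv g = (g \<otimes> h) \<otimes> a \<otimes> inv (g \<otimes> h)"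
  using assms by (simp add: m_assoc inv_mult_group)

text \<open>The big group acts on the characters of a normal subgroup because
  \<open>rat_homs\<close> demands vanishing at all conjugates of the relators. This makes congruence
  kernels normal in the big group.\<close>

lemma rat_homs_conjugate:
  assumes \<phi>: "\<phi> \<in> rat_homs G A R" and A: "A \<lhd> G" and R: "R \<subseteq> A" and g: "g \<in> carrier G"
  shows "(\<lambda>a. \<phi> (g \<otimes> a \<otimes> inv g)) \<in> rat_homs G A R"
proof -
  interpret A: normal A G by fact
  have cA: "a \<in> A \<Longrightarrow> a \<in> carrier G" for a
    using A.subset by blast
  show ?thesis
    unfolding rat_homs_def
  proof (intro CollectI conjI ballI)
    fix a b assume ab: "a \<in> A" "b \<in> A"
    then show "\<phi> (g \<otimes> (a \<otimes> b) \<otimes> inv g) = \<phi> (g \<otimes> a \<otimes> inv g) + \<phi> (g \<otimes> b \<otimes> inv g)"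
      using rat_homs_mult[OF \<phi> A.inv_op_closed2[OF g ab(1)] A.inv_op_closed2[OF g ab(2)]]
      by (simp add: conj_mult g cA)
  next
    fix h r assume "h \<in> carrier G" "r \<in> R"
    then show "\<phi> (g \<otimes> (h \<otimes> r \<otimes> inv h) \<otimes> inv g) = 0"
      using rat_homs_conj[OF \<phi>, of "g \<otimes> h" r] R g cA by (simp add: conj_conj subset_iff)
  qed
qed

lemma rat_homs_Ints_generate:
  assumes \<phi>: "\<phi> \<in> rat_homs G A R" and A: "subgroup A G" and E: "E \<subseteq> A" "generate G E = A"
    and int: "\<forall>e\<in>E. c * \<phi> e \<in> \<int>" and a: "a \<in> A"
  shows "c * \<phi> a \<in> \<int>"
proof -
  have "a \<in> generate G E"
    using a E by simp
  then show ?thesis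
  proof induction
    case one
    then show ?case using rat_homs_one[OF \<phi> A] by simp
  next
    case (incl h)
    then show ?case using int by simp
  next
    case (inv h)
    then show ?case using rat_homs_inv[OF \<phi> A, of h] E int by auto
  next
    case (eng h1 h2)
    then have "c * \<phi> (h1 \<otimes> h2) = c * \<phi> h1 + c * \<phi> h2"
      using rat_homs_mult[OF \<phi>, of h1 h2] E by (simp add: ring_distribs)
    then show ?case using eng.IH by simp
  qed
qed

lemma rat_homs_zero_generate:
  assumes \<phi>: "\<phi> \<in> rat_homs G A R" and A: "subgroup A G" and E: "E \<subseteq> A" "generate G E = A"
    and zero: "\<forall>e\<in>E. \<phi> e = 0" and a: "a \<in> A"
  shows "\<phi> a = 0"
proof -
  have "a \<in> generate G E"
    using a E by simp
  then show ?thesis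
  proof induction
    case one
    then show ?case using rat_homs_one[OF \<phi> A] by simp
  next
    case (incl h)
    then show ?case using zero by simp
  next
    case (inv h)
    then show ?case using rat_homs_inv[OF \<phi> A, of h] E zero by auto
  next
    case (eng h1 h2)
    then show ?case using rat_homs_mult[OF \<phi>, of h1 h2] E by simp
  qed
qed

text \<open>Congruence kernels speak of integral characters only; a common denominator on the
  generators reaches all others.\<close>

lemma rat_homs_integral_multiple:
  assumes \<phi>: "\<phi> \<in> rat_homs G A R" and A: "subgroup A G" and E: "finite E" "E \<subseteq> A" "generate G E = A"
  obtains q :: nat where "q > 0" "(\<lambda>x. of_nat q * \<phi> x) \<in> rat_homs G A R" "(\<lambda>x. of_nat q * \<phi> x) ` A \<subseteq> \<int>"
proof -
  from ex_common_denominator[OF E(1), of \<phi>]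
  obtain q :: nat where q: "q > 0" "\<forall>e\<in>E. of_nat q * \<phi> e \<in> \<int>"
    by (elim exE conjE)
  show thesis
  proof (rule that[OF q(1)])
    show "(\<lambda>x. of_nat q * \<phi> x) \<in> rat_homs G A R"
      by (rule rat_homs_scale[OF \<phi>])
    show "(\<lambda>x. of_nat q * \<phi> x) ` A \<subseteq> \<int>"
      using rat_homs_Ints_generate[OF \<phi> A E(2,3) q(2)] by blast
  qed
qed

section \<open>Finite index: counting cosets, orders modulo a subgroup, generators\<close>

lemma finite_rcosets_if_finite_signature:
  assumes B: "subgroup B G" and fin: "finite (\<tau> ` carrier G)"
    and \<tau>: "\<And>g h. g \<in> carrier G \<Longrightarrow> h \<in> carrier G \<Longrightarrow> \<tau> g = \<tau> h \<Longrightarrow> g \<otimes> inv h \<in> B"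
  shows "finite (rcosets B)"
proof -
  define s where "s t = (SOME g. g \<in> carrier G \<and> \<tau> g = t)" for t
  have "rcosets B \<subseteq> (\<lambda>t. B #> s t) ` \<tau> ` carrier G"
  proof
    fix C assume "C \<in> rcosets B"
    then obtain g where g: "g \<in> carrier G" "C = B #> g"
      unfolding RCOSETS_def by blast
    have s: "s (\<tau> g) \<in> carrier G \<and> \<tau> (s (\<tau> g)) = \<tau> g"
      unfolding s_def by (rule someI[of _ g]) (use g in simp)
    then have "g \<otimes> inv (s (\<tau> g)) \<in> B"
      using g by (intro \<tau>) auto
    then have "g \<in> B #> s (\<tau> g)"
      using s g B subgroup.rcos_module_rev is_group by metis
    then have "B #> s (\<tau> g) = B #> g"
      using s B by (intro repr_independence) auto
    then show "C \<in> (\<lambda>t. B #> s t) ` \<tau> ` carrier G"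
      using g by blast
  qed
  then show ?thesis
    using fin finite_surj by blast
qed

text \<open>Two powers of \<open>x\<close> lie in one coset by the pigeonhole principle, which gives
  a positive exponent; division with remainder shows that the least one divides all others.\<close>

lemma exact_order_mod_subgroup:
  assumes N: "subgroup N G" "finite (rcosets N)" and x: "x \<in> carrier G"
  obtains k :: nat where "k > 0" "\<And>j :: nat. x [^] j \<in> N \<longleftrightarrow> k dvd j"
proof -
  have "\<not> inj_on (\<lambda>n :: nat. N #> (x [^] n)) UNIV"
  proof
    assume "inj_on (\<lambda>n :: nat. N #> (x [^] n)) UNIV"
    moreover have "finite (range (\<lambda>n :: nat. N #> (x [^] n)))"
      by (rule finite_subset[OF _ N(2)]) (use N x in \<open>auto simp: RCOSETS_def\<close>)
    ultimately show False
      using finite_imageD infinite_UNIV_nat by blast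
  qed
  then obtain m n :: nat where "m < n" "N #> (x [^] m) = N #> (x [^] n)"
    unfolding inj_on_def by (metis UNIV_I nat_neq_iff)
  moreover from this have "x [^] n \<in> N #> (x [^] m)"
    using rcos_self[OF _ N(1), of "x [^] n"] x by simp
  ultimately have "x [^] n \<otimes> inv (x [^] m) \<in> N"
    using subgroup.rcos_module_imp[OF N(1) is_group] x by simp
  moreover have "x [^] n = x [^] (n - m) \<otimes> x [^] m"
    using \<open>m < n\<close> x by (simp add: nat_pow_mult)
  ultimately have "x [^] (n - m) \<in> N"
    using x by (simp add: m_assoc)
  then have ex: "\<exists>k>0. x [^] (k :: nat) \<in> N"
    using \<open>m < n\<close> by (intro exI[of _ "n - m"]) simp
  define k where "k = (LEAST k :: nat. k > 0 \<and> x [^] k \<in> N)"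
  have k: "k > 0 \<and> x [^] k \<in> N"
    unfolding k_def by (rule LeastI_ex[OF ex])
  show thesis
  proof (rule that[of k])
    show "k > 0" using k by simp
    fix j :: nat
    show "x [^] j \<in> N \<longleftrightarrow> k dvd j"
    proof
      assume j: "x [^] j \<in> N"
      have "x [^] j = x [^] (j mod k) \<otimes> x [^] (k * (j div k))"
        using x by (simp add: nat_pow_mult)
      moreover have kN: "x [^] (k * (j div k)) \<in> N"
        using subgroup_nat_pow_closed[OF N(1), of "x [^] k" "j div k"] k x by (simp add: nat_pow_pow)
      ultimately have "x [^] (j mod k) = x [^] j \<otimes> inv (x [^] (k * (j div k)))"
        using x by (simp add: m_assoc)
      then have "x [^] (j mod k) \<in> N"
        using j kN N(1) by (simp add: subgroup.m_closed subgroup.m_inv_closed)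
      then have "\<not> j mod k > 0"
        using not_less_Least[of "j mod k" "\<lambda>k. k > 0 \<and> x [^] k \<in> N"] k unfolding k_def[symmetric]
        by auto
      then show "k dvd j" by auto
    next
      assume "k dvd j"
      then obtain i where "j = k * i" by blast
      then show "x [^] j \<in> N"
        using subgroup_nat_pow_closed[OF N(1), of "x [^] k" i] k x by (simp add: nat_pow_pow)
    qed
  qed
qed

text \<open>Schreier's argument: \<open>w C g\<close> compares the representative of
  \<open>C\<close> moved by \<open>g\<close> with the representative of the coset it reaches. The
  cocycle identity \<open>w_mult\<close> reduces \<open>w\<close> at arbitrary elements to its
  values at the generators.\<close>

lemma finite_index_finitely_generated:
  assumes S: "finite S" "S \<subseteq> carrier G" "generate G S = carrier G"
    and A: "subgroup A G" "finite (rcosets A)"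
  obtains E where "finite E" "E \<subseteq> A" "generate G E = A"
proof -
  define rep :: "'a set \<Rightarrow> 'a" where "rep C = (SOME t. t \<in> C)" for C
  have rep: "rep C \<in> C" "rep C \<in> carrier G" "A #> rep C = C" if C: "C \<in> rcosets A" for C
  proof -
    obtain g where g: "g \<in> carrier G" "C = A #> g"
      using C unfolding RCOSETS_def by blast
    then have "g \<in> C"
      using rcos_self[OF g(1) A(1)] by simp
    then show r: "rep C \<in> C"
      unfolding rep_def by (rule someI)
    then show rc: "rep C \<in> carrier G"
      using r_coset_subset_G[OF subgroup.subset[OF A(1)] g(1)] g(2) by blast
    show "A #> rep C = C"
      using repr_independence[OF _ g(1) A(1), of "rep C"] r g(2) by simp
  qed
  \<comment> \<open>Schreier generators\<close>
  define w where "w C g = rep C \<otimes> g \<otimes> inv (rep (A #> (rep C \<otimes> g)))" for C g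
  have next_coset: "A #> (rep C \<otimes> g) \<in> rcosets A" if "C \<in> rcosets A" "g \<in> carrier G" for C g
    using rep(2)[OF that(1)] that(2) subgroup.subset[OF A(1)] by (intro rcosetsI) auto
  have wA: "w C g \<in> A" if C: "C \<in> rcosets A" and g: "g \<in> carrier G" for C g
  proof -
    let ?D = "A #> (rep C \<otimes> g)"
    have "rep C \<otimes> g \<in> A #> rep ?D"
      using rep(3)[OF next_coset[OF C g]] rcos_self[OF _ A(1), of "rep C \<otimes> g"] rep(2)[OF C] g by simp
    then show ?thesis
      unfolding w_def
      using subgroup.rcos_module_imp[OF A(1) is_group] rep(2)[OF next_coset[OF C g]] by simp
  qed
  have A_rcos: "A \<in> rcosets A"
    using subgroup.subgroup_in_rcosets[OF A(1) is_group] .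
  \<comment> \<open>The representative of \<open>A\<close> is an arbitrary member, possibly not the
    unit. It is therefore added as a generator, and \<open>a\<close> is recovered from
    \<open>w A a\<close> by conjugation with it.\<close>
  define E where "E = insert (rep A) ((\<lambda>(C, s). w C s) ` ((rcosets A) \<times> S))"
  have "finite E"
    unfolding E_def using A(2) S(1) by simp
  moreover have EA: "E \<subseteq> A"
    unfolding E_def using rep(1)[OF A_rcos] wA S(2) by auto
  moreover have "generate G E = A"
  proof
    show "generate G E \<subseteq> A"
      by (rule generate_subgroup_incl[OF EA A(1)])
    interpret gE: subgroup "generate G E" G
      by (rule generate_is_subgroup) (use EA subgroup.subset[OF A(1)] in blast)
    have step: "A #> (rep (A #> (rep C \<otimes> g)) \<otimes> h) = A #> (rep C \<otimes> (g \<otimes> h))"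
      if C: "C \<in> rcosets A" and g: "g \<in> carrier G" and h: "h \<in> carrier G" for C g h
    proof -
      have "A #> (rep (A #> (rep C \<otimes> g)) \<otimes> h) = (A #> rep (A #> (rep C \<otimes> g))) #> h"
        using rep(2)[OF next_coset[OF C g]] h subgroup.subset[OF A(1)] by (simp add: coset_mult_assoc)
      also have "\<dots> = (A #> (rep C \<otimes> g)) #> h"
        by (simp add: rep(3)[OF next_coset[OF C g]])
      also have "\<dots> = A #> (rep C \<otimes> (g \<otimes> h))"
        using rep(2)[OF C] g h subgroup.subset[OF A(1)] by (simp add: coset_mult_assoc m_assoc)
      finally show ?thesis .
    qed
    have w_mult: "w C (g \<otimes> h) = w C g \<otimes> w (A #> (rep C \<otimes> g)) h"
      if C: "C \<in> rcosets A" and g: "g \<in> carrier G" and h: "h \<in> carrier G" for C g h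
    proof -
      let ?D = "A #> (rep C \<otimes> g)"
      have "rep (A #> (rep C \<otimes> (g \<otimes> h))) \<in> carrier G"
        using rep(2)[OF next_coset[OF C, of "g \<otimes> h"]] g h by simp
      then show ?thesis
        unfolding w_def step[OF C g h]
        using rep(2)[OF C] rep(2)[OF next_coset[OF C g]] g h by (simp add: m_assoc inv_solve_left)
    qed
    have w_one: "w C \<one> = \<one>" if C: "C \<in> rcosets A" for C
      unfolding w_def using rep(2,3)[OF C] by simp
    have "\<forall>C\<in>rcosets A. w C g \<in> generate G E" if "g \<in> generate G S" for g
      using that
    proof induction
      case one
      then show ?case using w_one by simp
    next
      case (incl s)
      then show ?case unfolding E_def by (auto intro!: generate.incl)
    next
      case (inv s)
      show ?case
      proof
        fix C assume C: "C \<in> rcosets A"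
        have s: "s \<in> carrier G" using inv S by blast
        let ?D = "A #> (rep C \<otimes> inv s)"
        have D: "?D \<in> rcosets A" using next_coset[OF C] s by simp
        have "w C (inv s) \<otimes> w ?D s = \<one>"
          using w_mult[OF C, of "inv s" s] w_one[OF C] s by simp
        moreover have "w C (inv s) \<in> carrier G" "w ?D s \<in> carrier G"
          using wA[OF C] wA[OF D] s subgroup.subset[OF A(1)] by auto
        ultimately have "w C (inv s) = inv (w ?D s)"
          by (simp add: inv_equality)
        moreover have "w ?D s \<in> generate G E"
          using D inv unfolding E_def by (auto intro!: generate.incl)
        ultimately show "w C (inv s) \<in> generate G E"
          by simp
      qed
    next
      case (eng g h)
      show ?case
      proof
        fix C assume C: "C \<in> rcosets A"
        have gh: "g \<in> carrier G" "h \<in> carrier G" using eng.hyps S by auto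
        show "w C (g \<otimes> h) \<in> generate G E"
          using w_mult[OF C gh] eng.IH C next_coset[OF C gh(1)] by simp
      qed
    qed
    then have wE: "w A g \<in> generate G E" if "g \<in> carrier G" for g
      using that A_rcos S(3) by blast
    show "A \<subseteq> generate G E"
    proof
      fix a assume a: "a \<in> A"
      have ac: "a \<in> carrier G" using a subgroup.subset[OF A(1)] by blast
      have rA: "rep A \<in> A" "rep A \<in> carrier G"
        using rep[OF A_rcos] by auto
      have "A #> (rep A \<otimes> a) = A"
        using a rA A(1) ac by (intro coset_join2) (auto intro: subgroup.m_closed)
      then have "w A a = rep A \<otimes> a \<otimes> inv (rep A)"
        unfolding w_def by simp
      then have "a = inv (rep A) \<otimes> w A a \<otimes> rep A"
        using ac rA by (simp add: m_assoc inv_solve_left)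
      moreover have "rep A \<in> generate G E"
        unfolding E_def by (auto intro: generate.incl)
      ultimately show "a \<in> generate G E"
        using wE[OF ac] by (metis gE.m_closed gE.m_inv_closed)
    qed
  qed
  ultimately show thesis
    by (rule that)
qed

end

lemma Ints_div_if_floor_mod_eq:
  fixes x y :: rat
  assumes "x \<in> \<int>" "y \<in> \<int>" "k > 0" "\<lfloor>x\<rfloor> mod int k = \<lfloor>y\<rfloor> mod int k"
  shows "(x - y) / of_nat k \<in> \<int>"
proof -
  obtain a b where ab: "x = of_int a" "y = of_int b"
    using assms(1,2) by (auto elim!: Ints_cases)
  then have "int k dvd a - b"
    using assms(4) by (simp add: mod_eq_dvd_iff)
  then obtain c where "a - b = int k * c" by blast
  then have "x - y = of_nat k * of_int c"
    unfolding ab by (metis of_int_diff of_int_mult of_int_of_nat_eq)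
  then show ?thesis
    using assms(3) by simp
qed

section \<open>Congruence kernels: normality, finite index, orders of elements\<close>

context group
begin

lemma cong_kernel_subset: "cong_kernel G k A R \<subseteq> A"
  by (auto simp: cong_kernel_def)

lemma cong_kernelD:
  "a \<in> cong_kernel G k A R \<Longrightarrow> \<phi> \<in> rat_homs G A R \<Longrightarrow> \<phi> ` A \<subseteq> \<int> \<Longrightarrow> \<phi> a / of_nat k \<in> \<int>"
  by (simp add: cong_kernel_def)

lemma cong_kernelI:
  "a \<in> A \<Longrightarrow> (\<And>\<phi>. \<phi> \<in> rat_homs G A R \<Longrightarrow> \<phi> ` A \<subseteq> \<int> \<Longrightarrow> \<phi> a / of_nat k \<in> \<int>) \<Longrightarrow> a \<in> cong_kernel G k A R"
  by (simp add: cong_kernel_def)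

lemma relators_subset_cong_kernel:
  assumes "A \<lhd> G" "R \<subseteq> A"
  shows "R \<subseteq> cong_kernel G k A R"
proof
  fix r assume r: "r \<in> R"
  have "r \<in> carrier G"
    using r assms normal_imp_subgroup subgroup.subset by blast
  then show "r \<in> cong_kernel G k A R"
  proof (intro cong_kernelI)
    show "r \<in> A" using r assms(2) by blast
    show "\<phi> r / of_nat k \<in> \<int>" if "\<phi> \<in> rat_homs G A R" for \<phi>
      using rat_homs_relator[OF that r] \<open>r \<in> carrier G\<close> by simp
  qed
qed

lemma cong_kernel_normal:
  assumes A: "A \<lhd> G" and R: "R \<subseteq> A"
  shows "cong_kernel G k A R \<lhd> G"
proof -
  interpret A: normal A G by fact
  have sA: "subgroup A G" ..
  let ?B = "cong_kernel G k A R"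
  have "subgroup ?B G"
  proof
    show "?B \<subseteq> carrier G"
      using cong_kernel_subset A.subset by blast
  next
    fix x y assume x: "x \<in> ?B" and y: "y \<in> ?B"
    have xy: "x \<in> A" "y \<in> A"
      using x y cong_kernel_subset by blast+
    show "x \<otimes> y \<in> ?B"
    proof (rule cong_kernelI)
      fix \<phi> assume \<phi>: "\<phi> \<in> rat_homs G A R" "\<phi> ` A \<subseteq> \<int>"
      show "\<phi> (x \<otimes> y) / of_nat k \<in> \<int>"
        using cong_kernelD[OF x \<phi>] cong_kernelD[OF y \<phi>]
        by (simp add: rat_homs_mult[OF \<phi>(1) xy] add_divide_distrib)
    qed (use xy in simp)
  next
    show "\<one> \<in> ?B"
      by (rule cong_kernelI) (simp_all add: rat_homs_one[OF _ sA])
  next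
    fix x assume x: "x \<in> ?B"
    have xA: "x \<in> A"
      using x cong_kernel_subset by blast
    show "inv x \<in> ?B"
    proof (rule cong_kernelI)
      fix \<phi> assume \<phi>: "\<phi> \<in> rat_homs G A R" "\<phi> ` A \<subseteq> \<int>"
      show "\<phi> (inv x) / of_nat k \<in> \<int>"
        using cong_kernelD[OF x \<phi>] by (simp add: rat_homs_inv[OF \<phi>(1) sA xA])
    qed (use xA in simp)
  qed
  moreover have "g \<otimes> x \<otimes> inv g \<in> ?B" if g: "g \<in> carrier G" and x: "x \<in> ?B" for g x
  proof (rule cong_kernelI)
    show "g \<otimes> x \<otimes> inv g \<in> A"
      using A.inv_op_closed2[OF g] x cong_kernel_subset by blast
    fix \<phi> assume \<phi>: "\<phi> \<in> rat_homs G A R" "\<phi> ` A \<subseteq> \<int>"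
    have "(\<lambda>a. \<phi> (g \<otimes> a \<otimes> inv g)) ` A \<subseteq> \<int>"
      using A.inv_op_closed2[OF g] \<phi>(2) by blast
    from cong_kernelD[OF x rat_homs_conjugate[OF \<phi>(1) A R g] this]
    show "\<phi> (g \<otimes> x \<otimes> inv g) / of_nat k \<in> \<int>" .
  qed
  ultimately show ?thesis
    by (simp add: normal_inv_iff)
qed

lemma cong_kernel_finite_index:
  assumes A: "A \<lhd> G" and R: "R \<subseteq> A" and k: "k > 0"
    and fin: "finite (rcosets A)" and E: "finite E" "E \<subseteq> A" "generate G E = A"
  shows "finite (rcosets (cong_kernel G k A R))"
proof -
  interpret A: normal A G by fact
  have sA: "subgroup A G" ..
  \<comment> \<open>Modulo \<open>k\<close>, an integral character is determined by its residues on \<open>E\<close>, so finitely many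
    representatives \<open>p v\<close> suffice to define the congruence kernel.\<close>
  define I where "I = {\<phi> \<in> rat_homs G A R. \<phi> ` A \<subseteq> \<int>}"
  define r where "r \<phi> = (\<lambda>e. if e \<in> E then \<lfloor>\<phi> e :: rat\<rfloor> mod int k else 0)" for \<phi>
  define p where "p v = (SOME \<phi>. \<phi> \<in> I \<and> r \<phi> = v)" for v
  have pI: "p (r \<phi>) \<in> I" "r (p (r \<phi>)) = r \<phi>" if "\<phi> \<in> I" for \<phi>
  proof -
    have "p (r \<phi>) \<in> I \<and> r (p (r \<phi>)) = r \<phi>"
      unfolding p_def by (rule someI[of _ \<phi>]) (use that in simp)
    then show "p (r \<phi>) \<in> I" "r (p (r \<phi>)) = r \<phi>" by auto
  qed
  have finV: "finite (r ` I)"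
  proof (rule finite_subset)
    show "r ` I \<subseteq> {f. \<forall>x. (x \<in> E \<longrightarrow> f x \<in> {0..<int k}) \<and> (x \<notin> E \<longrightarrow> f x = 0)}"
      using k by (auto simp: r_def)
    show "finite {f. \<forall>x. (x \<in> E \<longrightarrow> f x \<in> {0..<int k}) \<and> (x \<notin> E \<longrightarrow> f x = 0)}"
      by (rule finite_set_of_finite_funs) (use E in auto)
  qed
  define \<sigma> where "\<sigma> a = (\<lambda>v. if v \<in> r ` I then \<lfloor>p v a\<rfloor> mod int k else 0)" for a
  have fin\<sigma>: "finite (range \<sigma>)"
  proof (rule finite_subset)
    show "range \<sigma> \<subseteq> {f. \<forall>v. (v \<in> r ` I \<longrightarrow> f v \<in> {0..<int k}) \<and> (v \<notin> r ` I \<longrightarrow> f v = 0)}"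
      using k by (auto simp: \<sigma>_def)
    show "finite {f. \<forall>v. (v \<in> r ` I \<longrightarrow> f v \<in> {0..<int k}) \<and> (v \<notin> r ` I \<longrightarrow> f v = 0)}"
      by (rule finite_set_of_finite_funs) (use finV in auto)
  qed
  define rep :: "'a set \<Rightarrow> 'a" where "rep C = (SOME t. t \<in> C)" for C
  have rep: "rep (A #> g) \<in> carrier G" "g \<otimes> inv (rep (A #> g)) \<in> A" if g: "g \<in> carrier G" for g
  proof -
    have "rep (A #> g) \<in> A #> g"
      unfolding rep_def by (rule someI[of _ g]) (rule rcos_self[OF g sA])
    then show c: "rep (A #> g) \<in> carrier G"
      using r_coset_subset_G[OF A.subset g] by blast
    have "A #> rep (A #> g) = A #> g"
      using repr_independence[OF \<open>rep (A #> g) \<in> A #> g\<close> g sA] by simp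
    then have "g \<in> A #> rep (A #> g)"
      using rcos_self[OF g sA] by simp
    then show "g \<otimes> inv (rep (A #> g)) \<in> A"
      by (rule A.rcos_module_imp[OF is_group c])
  qed
  \<comment> \<open>An element is recorded by its coset modulo \<open>A\<close> and by the residues
    of its \<open>A\<close>-part under the finitely many chosen characters.\<close>
  define \<tau> where "\<tau> g = (A #> g, \<sigma> (g \<otimes> inv (rep (A #> g))))" for g
  show ?thesis
  proof (rule finite_rcosets_if_finite_signature)
    show "subgroup (cong_kernel G k A R) G"
      using cong_kernel_normal[OF A R] by (rule normal_imp_subgroup)
    have "\<tau> ` carrier G \<subseteq> (rcosets A) \<times> range \<sigma>"
      by (auto simp: \<tau>_def intro!: rcosetsI A.subset)
    then show "finite (\<tau> ` carrier G)"
      using fin fin\<sigma> finite_subset by blast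
    fix g h assume g: "g \<in> carrier G" and h: "h \<in> carrier G" and eq: "\<tau> g = \<tau> h"
    define t where "t = rep (A #> g)"
    have t: "t = rep (A #> h)" "t \<in> carrier G"
      using eq rep(1)[OF g] by (auto simp: t_def \<tau>_def)
    let ?a = "g \<otimes> inv t" and ?b = "h \<otimes> inv t"
    have a: "?a \<in> A" and b: "?b \<in> A"
      using rep(2)[OF g] rep(2)[OF h] t t_def by auto
    have ab: "g \<otimes> inv h = ?a \<otimes> inv ?b"
      using g h t by (simp add: inv_mult_group m_assoc inv_solve_left)
    have s: "\<sigma> ?a = \<sigma> ?b"
      using eq t t_def by (auto simp: \<tau>_def)
    show "g \<otimes> inv h \<in> cong_kernel G k A R"
      unfolding ab
    proof (rule cong_kernelI)
      show "?a \<otimes> inv ?b \<in> A"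
        using a b by simp
      fix \<phi> assume \<phi>: "\<phi> \<in> rat_homs G A R" "\<phi> ` A \<subseteq> \<int>"
      then have \<phi>I: "\<phi> \<in> I" by (simp add: I_def)
      define \<psi> where "\<psi> = p (r \<phi>)"
      have \<psi>: "\<psi> \<in> rat_homs G A R" "\<psi> ` A \<subseteq> \<int>"
        using pI[OF \<phi>I] unfolding \<psi>_def I_def by auto
      \<comment> \<open>\<open>\<phi>\<close> and its representative \<open>\<psi>\<close> agree
        modulo \<open>k\<close> on \<open>E\<close>, hence on all of \<open>A\<close>, so the
        residues of \<open>\<psi>\<close> recorded in \<open>\<sigma>\<close> decide the matter for
        \<open>\<phi>\<close>.\<close>
      let ?\<chi> = "\<lambda>x. \<phi> x + (- 1) * \<psi> x"
      have \<chi>: "?\<chi> \<in> rat_homs G A R"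
        by (rule rat_homs_combination[OF \<phi>(1) \<psi>(1)])
      have "\<forall>e\<in>E. 1 / of_nat k * ?\<chi> e \<in> \<int>"
      proof
        fix e assume e: "e \<in> E"
        have "\<lfloor>\<phi> e\<rfloor> mod int k = \<lfloor>\<psi> e\<rfloor> mod int k"
          using fun_cong[OF pI(2)[OF \<phi>I], of e] e unfolding \<psi>_def r_def by simp
        moreover have "\<phi> e \<in> \<int>" "\<psi> e \<in> \<int>"
          using e E \<phi>(2) \<psi>(2) by blast+
        ultimately have "(\<phi> e - \<psi> e) / of_nat k \<in> \<int>"
          using k by (intro Ints_div_if_floor_mod_eq)
        then show "1 / of_nat k * ?\<chi> e \<in> \<int>" by simp
      qed
      note int = rat_homs_Ints_generate[OF \<chi> sA E(2,3) this]
      have "\<lfloor>\<psi> ?a\<rfloor> mod int k = \<lfloor>\<psi> ?b\<rfloor> mod int k"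
        using fun_cong[OF s, of "r \<phi>"] \<phi>I unfolding \<sigma>_def \<psi>_def by auto
      moreover have "\<psi> ?a \<in> \<int>" "\<psi> ?b \<in> \<int>"
        using a b \<psi>(2) by blast+
      ultimately have "(\<psi> ?a - \<psi> ?b) / of_nat k \<in> \<int>"
        using k by (intro Ints_div_if_floor_mod_eq)
      then have "1 / of_nat k * ?\<chi> ?a - 1 / of_nat k * ?\<chi> ?b + (\<psi> ?a - \<psi> ?b) / of_nat k \<in> \<int>"
        using int[OF a] int[OF b] by (intro Ints_add Ints_diff)
      moreover have "1 / of_nat k * ?\<chi> ?a - 1 / of_nat k * ?\<chi> ?b + (\<psi> ?a - \<psi> ?b) / of_nat k
        = (\<phi> ?a - \<phi> ?b) / of_nat k"
        by (simp add: diff_divide_distrib)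
      moreover have "\<phi> (?a \<otimes> inv ?b) = \<phi> ?a - \<phi> ?b"
        using rat_homs_mult[OF \<phi>(1) a, of "inv ?b"] rat_homs_inv[OF \<phi>(1) sA b] b by simp
      ultimately show "\<phi> (?a \<otimes> inv ?b) / of_nat k \<in> \<int>"
        by simp
    qed
  qed
qed

text \<open>The source of all lower bounds on orders: \<open>\<phi>\<close> has the value
  \<open>i * j\<close> at the \<open>i\<close>-th power of \<open>a\<close>, so a modulus of the
  form \<open>c * \<bar>j\<bar>\<close> with nonzero \<open>j\<close> forces \<open>c\<close> to
  divide \<open>i\<close>.\<close>

lemma cong_kernel_pow_dvd:
  assumes A: "subgroup A G" and \<phi>: "\<phi> \<in> rat_homs G A R" "\<phi> ` A \<subseteq> \<int>" and a: "a \<in> A" "\<phi> a = of_int j"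
    and k: "k > 0" and i: "a [^] (i :: nat) \<in> cong_kernel G k A R"
  shows "k dvd i * nat \<bar>j\<bar>"
proof -
  have "\<phi> (a [^] i) / of_nat k \<in> \<int>"
    by (rule cong_kernelD[OF i \<phi>])
  then obtain z where "of_nat i * of_int j / of_nat k = (of_int z :: rat)"
    unfolding rat_homs_pow[OF \<phi>(1) A a(1)] a(2) by (elim Ints_cases)
  then have "of_nat i * of_int j = (of_int z * of_nat k :: rat)"
    using k by (simp add: field_simps)
  then have "of_int (int i * j) = (of_int (z * int k) :: rat)"
    by simp
  then have "int i * j = z * int k"
    by (simp only: of_int_eq_iff)
  then have "int k dvd int i * j"
    by simp
  moreover have "int (i * nat \<bar>j\<bar>) = \<bar>int i * j\<bar>"
    by (simp add: abs_mult)
  ultimately have "int k dvd int (i * nat \<bar>j\<bar>)"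
    by (simp only: dvd_abs_iff)
  then show ?thesis
    by (simp only: int_dvd_int_iff)
qed

lemma mult_inv_cancel_left:
  assumes "a \<in> carrier G" "b \<in> carrier G"
  shows "a \<otimes> (inv a \<otimes> b) = b" "inv a \<otimes> (a \<otimes> b) = b"
  using assms by (simp_all flip: m_assoc)

text \<open>Normality removes the conjugation by \<open>g\<close>: whether two powers of
  \<open>x\<close> move a coset to the same place does not depend on the coset.\<close>

lemma rcosets_pow_eq_iff:
  assumes N: "N \<lhd> G" and g: "g \<in> carrier G" and x: "x \<in> carrier G" and ij: "(i :: nat) \<le> j"
  shows "N #> (g \<otimes> x [^] i) = N #> (g \<otimes> x [^] j) \<longleftrightarrow> x [^] (j - i) \<in> N"
proof -
  interpret N: normal N G by fact
  have sN: "subgroup N G" ..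
  let ?u = "g \<otimes> x [^] i" and ?v = "g \<otimes> x [^] j"
  have uv: "?u \<in> carrier G" "?v \<in> carrier G" using g x by auto
  have "x [^] j = x [^] (j - i) \<otimes> x [^] i"
    using ij x by (simp add: nat_pow_mult)
  then have conj: "?v \<otimes> inv ?u = g \<otimes> x [^] (j - i) \<otimes> inv g"
    using g x by (simp add: inv_mult_group m_assoc mult_inv_cancel_left)
  have "N #> ?u = N #> ?v \<longleftrightarrow> ?v \<otimes> inv ?u \<in> N"
  proof
    assume "N #> ?u = N #> ?v"
    then have "?v \<in> N #> ?u" using rcos_self[OF uv(2) sN] by simp
    then show "?v \<otimes> inv ?u \<in> N" by (rule N.rcos_module_imp[OF is_group uv(1)])
  next
    assume "?v \<otimes> inv ?u \<in> N"
    then have "?v \<in> N #> ?u" by (rule N.rcos_module_rev[OF is_group uv])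
    then show "N #> ?u = N #> ?v" by (rule repr_independence[OF _ uv(1) sN])
  qed
  also have "\<dots> \<longleftrightarrow> x [^] (j - i) \<in> N"
  proof
    assume "?v \<otimes> inv ?u \<in> N"
    then have "inv g \<otimes> (g \<otimes> x [^] (j - i) \<otimes> inv g) \<otimes> g \<in> N"
      unfolding conj by (rule N.inv_op_closed1[OF g])
    then show "x [^] (j - i) \<in> N"
      using g x by (simp add: m_assoc mult_inv_cancel_left)
  next
    assume "x [^] (j - i) \<in> N"
    then show "?v \<otimes> inv ?u \<in> N"
      unfolding conj by (rule N.inv_op_closed2[OF g])
  qed
  finally show ?thesis .
qed

lemma order_mod_le_index:
  assumes N: "N \<lhd> G" "finite (rcosets N)" and x: "x \<in> carrier G"
    and k: "\<And>j :: nat. x [^] j \<in> N \<longleftrightarrow> k dvd j"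
  shows "k \<le> card (rcosets N)"
proof -
  interpret N: normal N G by fact
  have inj: "inj_on (\<lambda>i :: nat. N #> (\<one> \<otimes> x [^] i)) {..<k}"
  proof (rule linorder_inj_onI)
    fix i j :: nat assume ij: "i < j" "i \<in> {..<k}" "j \<in> {..<k}"
    then have "\<not> k dvd (j - i)"
      by (auto dest: dvd_imp_le)
    then show "N #> (\<one> \<otimes> x [^] i) \<noteq> N #> (\<one> \<otimes> x [^] j)"
      using rcosets_pow_eq_iff[OF N(1) one_closed x, of i j] ij k by simp
  qed auto
  have "card {..<k} \<le> card (rcosets N)"
    by (rule card_inj_on_le[OF inj _ N(2)]) (auto intro!: rcosetsI N.subset x)
  then show ?thesis by simp
qed

end

section \<open>The inductive step\<close>

definition relators :: "('a, 'm) monoid_scheme \<Rightarrow> ('a \<times> nat) set \<Rightarrow> 'a set" where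
  "relators G P = (\<lambda>(x, k). x [^]\<^bsub>G\<^esub> k) ` P"

text \<open>With \<open>k\<close> the exact order of \<open>x\<close> modulo \<open>A\<close>, all
  orbits of \<open>x\<close> on the cosets have length \<open>k\<close>, which is why killing the
  power is cheap. Pairs are stored because the relator \<open>x [^] k\<close> does not remember
  \<open>k\<close>.\<close>

definition good_state :: "('a, 'm) monoid_scheme \<Rightarrow> 'a set \<Rightarrow> ('a \<times> nat) set \<Rightarrow> bool" where
  "good_state G A P \<longleftrightarrow> A \<lhd> G \<and> finite (rcosets\<^bsub>G\<^esub> A) \<and> finite P \<and>
     (\<forall>(x, k)\<in>P. x \<in> carrier G \<and> k > 0 \<and> (\<forall>j :: nat. x [^]\<^bsub>G\<^esub> j \<in> A \<longleftrightarrow> k dvd j)) \<and>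
     (\<Sum>(x, k)\<in>P. 1 / real k) < 1 / 2"

text \<open>\<open>many_homs\<close> says that the characters of \<open>A\<close> killing the
  relators have dimension above half the index. This and finite generation are all that the
  construction takes from the free group.\<close>

locale large_group = group +
  fixes S
  assumes finite_gens: "finite S" "S \<subseteq> carrier G" "generate G S = carrier G"
    and many_homs: "good_state G A P \<Longrightarrow> finite Y \<Longrightarrow> 2 * card Y \<le> card (rcosets A) \<Longrightarrow> (\<And>y. y \<in> Y \<Longrightarrow> lin_fun y) \<Longrightarrow>
      \<exists>\<phi>\<in>rat_homs G A (relators G P). (\<exists>a\<in>A. \<phi> a \<noteq> 0) \<and> (\<forall>y\<in>Y. y \<phi> = 0)"
begin

lemma relators_subset:
  assumes "good_state G A P"
  shows "relators G P \<subseteq> A"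
  using assms unfolding relators_def good_state_def by auto

lemma finite_index_generators:
  assumes "A \<lhd> G" "finite (rcosets A)"
  obtains E where "finite E" "E \<subseteq> A" "generate G E = A"
  using finite_index_finitely_generated[OF finite_gens normal_imp_subgroup[OF assms(1)] assms(2)] .

lemma rat_homs_integral:
  assumes \<phi>: "\<phi> \<in> rat_homs G A R" "\<phi> a \<noteq> 0" "a \<in> A" and A: "A \<lhd> G" "finite (rcosets A)"
  obtains \<psi> j where "\<psi> \<in> rat_homs G A R" "\<psi> ` A \<subseteq> \<int>" "\<psi> a = of_int j" "j \<noteq> 0"
proof -
  have sA: "subgroup A G" by (rule normal_imp_subgroup[OF A(1)])
  obtain E where E: "finite E" "E \<subseteq> A" "generate G E = A"
    by (rule finite_index_generators[OF A])
  obtain q :: nat where q: "q > 0" "(\<lambda>x. of_nat q * \<phi> x) \<in> rat_homs G A R" "(\<lambda>x. of_nat q * \<phi> x) ` A \<subseteq> \<int>"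
    by (rule rat_homs_integral_multiple[OF \<phi>(1) sA E])
  have "of_nat q * \<phi> a \<in> \<int>"
    using q(3) \<phi>(3) by blast
  then obtain j where j: "of_nat q * \<phi> a = of_int j"
    by (elim Ints_cases)
  then have "j \<noteq> 0"
    using q(1) \<phi>(2) by auto
  then show thesis
    by (rule that[OF q(2,3) j])
qed

text \<open>Two congruence kernels in turn. The modulus of the first, \<open>B\<close>, is chosen
  once the generators of \<open>A\<close> are counted, that of the second, \<open>A'\<close>, once
  the elements to be killed are known. The first two clauses on \<open>rat_homs\<close> let the
  characters of \<open>A\<close> survive and, in the limit, vanish on the intersection of the chain;
  the last one makes the Betti number at \<open>B\<close> small.\<close>

lemma next_good_state:
  assumes st: "good_state G A P" and n: "n > 0"
  shows "\<exists>B A' P'. B \<lhd> G \<and> finite (rcosets B) \<and> B \<subseteq> A \<and> A' \<subseteq> B \<and> good_state G A' P' \<and> P \<subseteq> P' \<and>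
    rat_homs G A (relators G P) \<subseteq> rat_homs G A (relators G P') \<and>
    (\<forall>\<phi>\<in>rat_homs G A (relators G P). \<phi> ` A \<subseteq> \<int> \<longrightarrow> (\<forall>b\<in>B. \<phi> b / of_nat n \<in> \<int>)) \<and>
    (\<exists>E\<subseteq>B. finite E \<and> 4 * card E \<le> card (rcosets B) \<and>
      (\<forall>\<phi>\<in>rat_homs G B (relators G P'). (\<forall>e\<in>E. \<phi> e = 0) \<longrightarrow> (\<forall>b\<in>B. \<phi> b = 0)))"
proof -
  define R where "R = relators G P"
  have A: "A \<lhd> G" "finite (rcosets A)" and finP: "finite P"
    and P: "\<And>x k. (x, k) \<in> P \<Longrightarrow> x \<in> carrier G \<and> k > 0 \<and> (\<forall>j :: nat. x [^] j \<in> A \<longleftrightarrow> k dvd j)"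
    and sum: "(\<Sum>(x, k)\<in>P. 1 / real k) < 1 / 2"
    using st unfolding good_state_def by auto
  interpret A: normal A G by fact
  have sA: "subgroup A G" ..
  have RA: "R \<subseteq> A"
    unfolding R_def by (rule relators_subset[OF st])
  obtain E where E: "finite E" "E \<subseteq> A" "generate G E = A"
    by (rule finite_index_generators[OF A])
  define r where "r = card E"
  \<comment> \<open>Without a nonzero character the congruence kernel would be all of
    \<open>A\<close>, and the index could not grow.\<close>
  have "\<exists>\<phi>\<in>rat_homs G A (relators G P). \<exists>a\<in>A. \<phi> a \<noteq> 0"
    using many_homs[OF st, of "{}"] by simp
  then obtain \<phi>0 a0 where \<phi>0: "\<phi>0 \<in> rat_homs G A R" "a0 \<in> A" "\<phi>0 a0 \<noteq> 0"
    unfolding R_def by (elim bexE)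
  obtain \<phi>1 j where \<phi>1: "\<phi>1 \<in> rat_homs G A R" "\<phi>1 ` A \<subseteq> \<int>" "\<phi>1 a0 = of_int j" "j \<noteq> 0"
    by (rule rat_homs_integral[OF \<phi>0(1,3,2) A])
  \<comment> \<open>The factor \<open>n\<close> gives the divisibility on \<open>B\<close>;
    \<open>nat \<bar>j\<bar>\<close> compensates for the value of \<open>\<phi>1\<close> at
    \<open>a0\<close>, so that \<open>4 * r + 1\<close> divides the order of \<open>a0\<close>
    modulo \<open>B\<close> and bounds the index from below. The added 1 keeps the modulus positive
    for every \<open>r\<close>.\<close>
  define k where "k = n * ((4 * r + 1) * nat \<bar>j\<bar>)"
  have k: "k > 0"
    using n \<phi>1(4) by (simp add: k_def)
  define B where "B = cong_kernel G k A R"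
  have B: "B \<lhd> G" "finite (rcosets B)"
    unfolding B_def by (rule cong_kernel_normal[OF A(1) RA]) (rule cong_kernel_finite_index[OF A(1) RA k A(2) E])
  interpret B: normal B G by fact
  have sB: "subgroup B G" ..
  have BA: "B \<subseteq> A" and RB: "R \<subseteq> B"
    unfolding B_def using cong_kernel_subset relators_subset_cong_kernel[OF A(1) RA] by auto
  have index: "4 * r + 1 \<le> card (rcosets B)"
  proof -
    have a0: "a0 \<in> carrier G" using \<phi>0(2) A.subset by blast
    obtain d :: nat where d: "d > 0" "\<And>i :: nat. a0 [^] i \<in> B \<longleftrightarrow> d dvd i"
      using exact_order_mod_subgroup[OF sB B(2) a0] by metis
    have "k dvd d * nat \<bar>j\<bar>"
      using d(2)[of d] unfolding B_def by (intro cong_kernel_pow_dvd[OF sA \<phi>1(1,2) \<phi>0(2) \<phi>1(3) k]) simp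
    then have "(4 * r + 1) * nat \<bar>j\<bar> dvd d * nat \<bar>j\<bar>"
      unfolding k_def by (rule dvd_mult_right)
    then have "4 * r + 1 dvd d"
    proof (elim dvdE)
      fix c assume "d * nat \<bar>j\<bar> = (4 * r + 1) * nat \<bar>j\<bar> * c"
      then have "d * nat \<bar>j\<bar> = ((4 * r + 1) * c) * nat \<bar>j\<bar>"
        by (simp only: mult_ac)
      then have "d = (4 * r + 1) * c"
        unfolding mult_cancel2 using \<phi>1(4) by simp
      then show ?thesis
        by (rule dvdI)
    qed
    then have "4 * r + 1 \<le> d"
      using d(1) by (rule dvd_imp_le)
    also have "d \<le> card (rcosets B)"
      by (rule order_mod_le_index[OF B a0 d(2)])
    finally show ?thesis .
  qed
  \<comment> \<open>New relators will be powers of elements of \<open>D\<close>, which no character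
    of \<open>A\<close> can see.\<close>
  define D where "D = {y \<in> A. \<forall>\<phi>\<in>rat_homs G A R. \<phi> y = 0}"
  have DB: "D \<subseteq> B"
    unfolding D_def B_def by (auto intro!: cong_kernelI)
  obtain EB where EB: "finite EB" "EB \<subseteq> B" "generate G EB = B"
    by (rule finite_index_generators[OF B])
  have "\<exists>X\<subseteq>D. finite X \<and> (\<forall>x\<in>X. \<exists>\<phi>\<in>rat_homs G B R. \<phi> x \<noteq> 0) \<and>
      (\<forall>\<phi>\<in>rat_homs G B R. (\<forall>x\<in>X. \<phi> x = 0) \<longrightarrow> (\<forall>d\<in>D. \<phi> d = 0))"
  proof (rule finite_detecting_subset[OF EB(1)])
    show "(\<lambda>x. \<phi> x + c * \<psi> x) \<in> rat_homs G B R" if "\<phi> \<in> rat_homs G B R" "\<psi> \<in> rat_homs G B R" for \<phi> \<psi> c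
      by (rule rat_homs_combination[OF that])
    show "\<phi> d = 0" if "\<phi> \<in> rat_homs G B R" "\<forall>e\<in>EB. \<phi> e = 0" "d \<in> D" for \<phi> d
      using rat_homs_zero_generate[OF that(1) sB EB(2,3) that(2)] that(3) DB by blast
  qed
  then obtain X where X: "X \<subseteq> D" "finite X" "\<forall>x\<in>X. \<exists>\<phi>\<in>rat_homs G B R. \<phi> x \<noteq> 0"
    "\<forall>\<phi>\<in>rat_homs G B R. (\<forall>x\<in>X. \<phi> x = 0) \<longrightarrow> (\<forall>d\<in>D. \<phi> d = 0)"
    by (elim exE conjE)
  have XB: "x \<in> B" "x \<in> A" "x \<in> carrier G" if "x \<in> X" for x
    using that X(1) DB BA A.subset by auto
  have "\<forall>x\<in>X. \<exists>m>0. \<exists>\<phi>\<in>rat_homs G B R. \<exists>i. \<phi> ` B \<subseteq> \<int> \<and> \<phi> x = of_int i \<and> nat \<bar>i\<bar> = m"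
  proof
    fix x assume x: "x \<in> X"
    from bspec[OF X(3) x] obtain \<phi> where \<phi>: "\<phi> \<in> rat_homs G B R" "\<phi> x \<noteq> 0"
      by (elim bexE)
    obtain \<psi> i where "\<psi> \<in> rat_homs G B R" "\<psi> ` B \<subseteq> \<int>" "\<psi> x = of_int i" "i \<noteq> 0"
      by (rule rat_homs_integral[OF \<phi> XB(1)[OF x] B])
    then show "\<exists>m>0. \<exists>\<phi>\<in>rat_homs G B R. \<exists>i. \<phi> ` B \<subseteq> \<int> \<and> \<phi> x = of_int i \<and> nat \<bar>i\<bar> = m"
      by - (rule exI[of _ "nat \<bar>i\<bar>"], rule conjI, simp, rule bexI[of _ \<psi>], rule exI[of _ i], simp_all)
  qed
  then obtain m where m: "\<forall>x\<in>X. m x > 0 \<and> (\<exists>\<phi>\<in>rat_homs G B R. \<exists>i. \<phi> ` B \<subseteq> \<int> \<and> \<phi> x = of_int i \<and> nat \<bar>i\<bar> = m x)"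
    by (rule bchoice[THEN exE])
  \<comment> \<open>All new exponents will be at least \<open>N0\<close>, so together they add at
    most \<open>card X / N0\<close> to the sum of reciprocals.\<close>
  obtain N0 :: nat where N0: "N0 > 0" "real (card X) / real N0 < 1 / 2 - (\<Sum>(x, k)\<in>P. 1 / real k)"
  proof -
    define \<epsilon> where "\<epsilon> = 1 / 2 - (\<Sum>(x, k)\<in>P. 1 / real k)"
    have \<epsilon>: "\<epsilon> > 0" using sum by (simp add: \<epsilon>_def)
    obtain N :: nat where N: "real (card X) / \<epsilon> < real N"
      using reals_Archimedean2 by blast
    have "0 \<le> real (card X) / \<epsilon>"
      using \<epsilon> by simp
    with N have "N > 0"
      by (cases N) simp_all
    moreover have "real (card X) / real N < \<epsilon>"
      using N \<epsilon> \<open>N > 0\<close> by (simp add: field_simps)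
    ultimately show thesis
      by (intro that[of N]) (simp_all add: \<epsilon>_def)
  qed
  \<comment> \<open>One modulus for all of \<open>X\<close>: it is a multiple of
    \<open>N0 * m x\<close> for each \<open>x\<close>, and some integral character of
    \<open>B\<close> has the value \<open>m x\<close> at \<open>x\<close> up to sign, so
    \<open>N0\<close> divides the order of \<open>x\<close> modulo \<open>A'\<close>.\<close>
  define L where "L = N0 * (\<Prod>x\<in>X. m x)"
  have L: "L > 0"
    unfolding L_def using N0(1) m by (simp add: prod_pos)
  define A' where "A' = cong_kernel G L B R"
  have A': "A' \<lhd> G" "finite (rcosets A')"
    unfolding A'_def by (rule cong_kernel_normal[OF B(1) RB]) (rule cong_kernel_finite_index[OF B(1) RB L B(2) EB])
  have sA': "subgroup A' G" by (rule normal_imp_subgroup[OF A'(1)])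
  have A'B: "A' \<subseteq> B" and RA': "R \<subseteq> A'"
    unfolding A'_def using cong_kernel_subset relators_subset_cong_kernel[OF B(1) RB] by auto
  have "\<forall>x\<in>X. \<exists>d>0. \<forall>i :: nat. x [^] i \<in> A' \<longleftrightarrow> d dvd i"
  proof
    fix x assume x: "x \<in> X"
    obtain d :: nat where "d > 0" "\<And>i :: nat. x [^] i \<in> A' \<longleftrightarrow> d dvd i"
      using exact_order_mod_subgroup[OF sA' A'(2) XB(3)[OF x]] by metis
    then show "\<exists>d>0. \<forall>i :: nat. x [^] i \<in> A' \<longleftrightarrow> d dvd i" by blast
  qed
  then obtain d where d: "\<forall>x\<in>X. d x > 0 \<and> (\<forall>i :: nat. x [^] i \<in> A' \<longleftrightarrow> d x dvd i)"
    by (rule bchoice[THEN exE])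
  have N0d: "N0 \<le> d x" if x: "x \<in> X" for x
  proof -
    obtain \<phi> i where \<phi>: "\<phi> \<in> rat_homs G B R" "\<phi> ` B \<subseteq> \<int>" "\<phi> x = of_int i" "nat \<bar>i\<bar> = m x"
      using bspec[OF m x] by (elim conjE bexE exE)
    have "x [^] d x \<in> cong_kernel G L B R"
      using d x unfolding A'_def by simp
    from cong_kernel_pow_dvd[OF sB \<phi>(1,2) XB(1)[OF x] \<phi>(3) L this]
    have "L dvd d x * m x"
      unfolding \<phi>(4) .
    moreover have "L = (N0 * (\<Prod>y\<in>X - {x}. m y)) * m x"
      unfolding L_def using x X(2) by (simp add: prod.remove mult_ac)
    ultimately have "N0 * (\<Prod>y\<in>X - {x}. m y) dvd d x"
      using m x by simp
    then have "N0 dvd d x"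
      by (rule dvd_mult_left)
    then show ?thesis
      using d x by (intro dvd_imp_le) auto
  qed
  \<comment> \<open>The exponents are orders modulo the new subgroup, so the new relators lie in
    \<open>A'\<close> and their exponents are exact from the start.\<close>
  define P' where "P' = P \<union> (\<lambda>x. (x, d x)) ` X"
  have PP': "P \<subseteq> P'" and finP': "finite P'"
    using finP X(2) by (auto simp: P'_def)
  have RR': "R \<subseteq> relators G P'"
    unfolding R_def relators_def using PP' by blast
  have F1: "good_state G A' P'"
    unfolding good_state_def
  proof (intro conjI A' finP')
    \<comment> \<open>Old exponents stay exact: shrinking the subgroup can only raise an order, and
      \<open>x [^] k\<close> remains in the congruence kernels because the characters defining them
      kill it.\<close>
    have "\<forall>j :: nat. x [^] j \<in> A' \<longleftrightarrow> k dvd j" if xk: "(x, k) \<in> P" for x k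
    proof (intro allI iffI)
      fix j :: nat assume "x [^] j \<in> A'"
      then show "k dvd j" using P[OF xk] A'B BA by blast
    next
      fix j :: nat assume "k dvd j"
      then obtain i where i: "j = k * i" by blast
      have "x [^] k \<in> A'"
        using RA' xk unfolding R_def relators_def by force
      then show "x [^] j \<in> A'"
        using subgroup_nat_pow_closed[OF sA', of "x [^] k" i] P[OF xk] by (simp add: i nat_pow_pow)
    qed
    then show "\<forall>(x, k)\<in>P'. x \<in> carrier G \<and> k > 0 \<and> (\<forall>j :: nat. x [^] j \<in> A' \<longleftrightarrow> k dvd j)"
      unfolding P'_def using P d XB(3) by auto
    \<comment> \<open>Only an inequality, since a new pair may coincide with an old one.\<close>
    have "(\<Sum>(x, k)\<in>P'. 1 / real k) \<le> (\<Sum>(x, k)\<in>P. 1 / real k) + (\<Sum>(x, k)\<in>(\<lambda>x. (x, d x)) ` X. 1 / real k)"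
    proof -
      have "0 \<le> (\<Sum>(x, k)\<in>P \<inter> (\<lambda>x. (x, d x)) ` X. 1 / real k)"
        by (rule sum_nonneg) auto
      then show ?thesis
        unfolding P'_def using sum.union_inter[OF finP, of "(\<lambda>x. (x, d x)) ` X" "\<lambda>(x, k). 1 / real k"] X(2)
        by simp
    qed
    also have "(\<Sum>(x, k)\<in>(\<lambda>x. (x, d x)) ` X. 1 / real k) = (\<Sum>x\<in>X. 1 / real (d x))"
      by (subst sum.reindex) (auto simp: inj_on_def)
    also have "\<dots> \<le> (\<Sum>x\<in>X. 1 / real N0)"
      using N0d N0(1) d by (intro sum_mono divide_left_mono) auto
    also have "\<dots> = real (card X) / real N0"
      by simp
    finally show "(\<Sum>(x, k)\<in>P'. 1 / real k) < 1 / 2"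
      using N0(2) by simp
  qed
  have F2: "rat_homs G A R \<subseteq> rat_homs G A (relators G P')"
  proof
    fix \<phi> assume \<phi>: "\<phi> \<in> rat_homs G A R"
    have kills: "\<phi> (g \<otimes> r \<otimes> inv g) = 0" if g: "g \<in> carrier G" and r: "r \<in> relators G P'" for g r
    proof (cases "r \<in> R")
      case True
      then show ?thesis using rat_homs_conj[OF \<phi> g] by simp
    next
      case False
      then obtain x where x: "x \<in> X" "r = x [^] d x"
        using r unfolding R_def relators_def P'_def by auto
      \<comment> \<open>The conjugation is moved from the relator to the character, which is then
        evaluated at a power of an element of \<open>D\<close>.\<close>
      note \<psi> = rat_homs_conjugate[OF \<phi> A(1) RA g]
      have "x \<in> D" using x X(1) by blast
      then have "\<forall>\<phi>\<in>rat_homs G A R. \<phi> x = 0"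
        by (simp add: D_def)
      from bspec[OF this \<psi>] have "\<phi> (g \<otimes> x \<otimes> inv g) = 0" .
      then show ?thesis
        using rat_homs_pow[OF \<psi> sA XB(2)[OF x(1)], of "d x"] x(2) by simp
    qed
    show "\<phi> \<in> rat_homs G A (relators G P')"
      unfolding rat_homs_def
    proof (intro CollectI conjI ballI)
      show "\<phi> (a \<otimes> b) = \<phi> a + \<phi> b" if "a \<in> A" "b \<in> A" for a b
        using that by (rule rat_homs_mult[OF \<phi>])
      show "\<phi> (g \<otimes> r \<otimes> inv g) = 0" if "g \<in> carrier G" "r \<in> relators G P'" for g r
        using that by (rule kills)
    qed
  qed
  have F3: "\<forall>\<phi>\<in>rat_homs G A R. \<phi> ` A \<subseteq> \<int> \<longrightarrow> (\<forall>b\<in>B. \<phi> b / of_nat n \<in> \<int>)"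
  proof (intro ballI impI)
    fix \<phi> b assume \<phi>: "\<phi> \<in> rat_homs G A R" "\<phi> ` A \<subseteq> \<int>" and b: "b \<in> B"
    have "\<phi> b / of_nat k * of_nat ((4 * r + 1) * nat \<bar>j\<bar>) \<in> \<int>"
      using cong_kernelD[OF b[unfolded B_def] \<phi>] by (intro Ints_mult Ints_of_nat)
    moreover have "of_nat ((4 * r + 1) * nat \<bar>j\<bar>) \<noteq> (0 :: rat)"
      using \<phi>1(4) by (simp del: of_nat_mult)
    then have "\<phi> b / of_nat k * of_nat ((4 * r + 1) * nat \<bar>j\<bar>) = \<phi> b / of_nat n"
      unfolding k_def of_nat_mult[of n] by simp
    ultimately show "\<phi> b / of_nat n \<in> \<int>"
      by (simp only:)
  qed
  \<comment> \<open>The detecting set consists of the \<open>k\<close>-th powers of the generators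
    of \<open>A\<close>: at most \<open>r\<close> elements, and in \<open>B\<close> because integral
    values get multiplied by \<open>k\<close>.\<close>
  have F4: "\<exists>E\<subseteq>B. finite E \<and> 4 * card E \<le> card (rcosets B) \<and>
      (\<forall>\<phi>\<in>rat_homs G B (relators G P'). (\<forall>e\<in>E. \<phi> e = 0) \<longrightarrow> (\<forall>b\<in>B. \<phi> b = 0))"
  proof (intro exI[of _ "(\<lambda>e. e [^] k) ` E"] conjI ballI impI)
    have powB: "a [^] k \<in> B" if a: "a \<in> A" for a
      unfolding B_def
    proof (rule cong_kernelI)
      show "a [^] k \<in> A" by (rule subgroup_nat_pow_closed[OF sA a])
      show "\<phi> (a [^] k) / of_nat k \<in> \<int>" if "\<phi> \<in> rat_homs G A R" "\<phi> ` A \<subseteq> \<int>" for \<phi>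
        using that(2) a k rat_homs_pow[OF that(1) sA a, of k] by auto
    qed
    then show "(\<lambda>e. e [^] k) ` E \<subseteq> B"
      using E(2) by blast
    show "finite ((\<lambda>e. e [^] k) ` E)"
      using E(1) by simp
    have "card ((\<lambda>e. e [^] k) ` E) \<le> r"
      unfolding r_def by (rule card_image_le[OF E(1)])
    then show "4 * card ((\<lambda>e. e [^] k) ` E) \<le> card (rcosets B)"
      using index by simp
    fix \<phi> b assume \<phi>: "\<phi> \<in> rat_homs G B (relators G P')" and zero: "\<forall>e\<in>(\<lambda>e. e [^] k) ` E. \<phi> e = 0"
      and b: "b \<in> B"
    have \<phi>R: "\<phi> \<in> rat_homs G B R"
      using \<phi> rat_homs_mono[OF subset_refl RR'] by blast
    \<comment> \<open>Rational values have no torsion, so a character that kills a positive power of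
      \<open>x\<close> kills \<open>x\<close>.\<close>
    have "\<forall>x\<in>X. \<phi> x = 0"
    proof
      fix x assume x: "x \<in> X"
      then have "x [^] d x \<in> relators G P'"
        unfolding relators_def P'_def by force
      then have "\<phi> (x [^] d x) = 0"
        using rat_homs_relator[OF \<phi>] XB(3)[OF x] by simp
      then show "\<phi> x = 0"
        using rat_homs_pow[OF \<phi> sB XB(1)[OF x], of "d x"] bspec[OF d x] by simp
    qed
    have \<phi>D: "\<phi> y = 0" if "y \<in> D" for y
      by (rule bspec[OF mp[OF bspec[OF X(4) \<phi>R] \<open>\<forall>x\<in>X. \<phi> x = 0\<close>] that])
    \<comment> \<open>Since \<open>\<phi>\<close> vanishes on \<open>D\<close>, it extends to the character \<open>a \<mapsto> \<phi> (a\<^sup>k) / k\<close> of \<open>A\<close>, and is thus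
      determined by its values at the \<open>k\<close>-th powers of the generators of \<open>A\<close>.\<close>
    have hom: "\<phi> ((a \<otimes> b) [^] k) = \<phi> (a [^] k) + \<phi> (b [^] k)" if ab: "a \<in> A" "b \<in> A" for a b
    proof -
      let ?u = "(a \<otimes> b) [^] k" and ?v = "a [^] k \<otimes> b [^] k"
      have abA: "a \<otimes> b \<in> A" using ab by simp
      have uA: "?u \<in> A" and aA: "a [^] k \<in> A" and bA: "b [^] k \<in> A"
        by (rule subgroup_nat_pow_closed[OF sA abA], rule subgroup_nat_pow_closed[OF sA ab(1)],
            rule subgroup_nat_pow_closed[OF sA ab(2)])
      have vA: "?v \<in> A" using aA bA by simp
      \<comment> \<open>In an abelian quotient the \<open>k\<close>-th power is multiplicative, so
        no character of \<open>A\<close> distinguishes \<open>?u\<close> from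
        \<open>?v\<close>.\<close>
      have "?u \<otimes> inv ?v \<in> D"
        unfolding D_def
      proof (intro CollectI conjI ballI)
        show "?u \<otimes> inv ?v \<in> A" using uA vA by blast
        fix \<chi> assume \<chi>: "\<chi> \<in> rat_homs G A R"
        have "\<chi> ?u = of_nat k * (\<chi> a + \<chi> b)"
          using rat_homs_pow[OF \<chi> sA abA] rat_homs_mult[OF \<chi> ab] by simp
        moreover have "\<chi> ?v = of_nat k * \<chi> a + of_nat k * \<chi> b"
          using rat_homs_mult[OF \<chi> aA bA] rat_homs_pow[OF \<chi> sA] ab by simp
        moreover have "\<chi> (?u \<otimes> inv ?v) = \<chi> ?u - \<chi> ?v"
          using rat_homs_mult[OF \<chi> uA, of "inv ?v"] rat_homs_inv[OF \<chi> sA vA] A.m_inv_closed[OF vA] by simp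
        ultimately show "\<chi> (?u \<otimes> inv ?v) = 0"
          by (simp add: ring_distribs)
      qed
      note D = this
      have uc: "?u \<in> carrier G" and vc: "?v \<in> carrier G"
        using uA vA A.subset by auto
      have "?u = (?u \<otimes> inv ?v) \<otimes> ?v"
        using uc vc by (simp only: m_assoc inv_closed l_inv r_one)
      then have "\<phi> ?u = \<phi> ((?u \<otimes> inv ?v) \<otimes> ?v)"
        by (rule arg_cong)
      also have "\<dots> = \<phi> (?u \<otimes> inv ?v) + \<phi> ?v"
        using D DB powB[OF ab(1)] powB[OF ab(2)] by (intro rat_homs_mult[OF \<phi>]) auto
      also have "\<phi> ?v = \<phi> (a [^] k) + \<phi> (b [^] k)"
        by (rule rat_homs_mult[OF \<phi> powB[OF ab(1)] powB[OF ab(2)]])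
      finally show ?thesis
        using \<phi>D[OF D] by simp
    qed
    then have \<psi>: "(\<lambda>a. \<phi> (a [^] k)) \<in> rat_homs G A {}"
      unfolding rat_homs_def by simp
    have bA: "b \<in> A" using b BA by blast
    have "\<forall>e\<in>E. \<phi> (e [^] k) = 0"
      using zero by simp
    from rat_homs_zero_generate[OF \<psi> sA E(2,3) this bA]
    have "\<phi> (b [^] k) = 0" .
    then show "\<phi> b = 0"
      using rat_homs_pow[OF \<phi> sB b, of k] k by simp
  qed
  show ?thesis
    unfolding R_def[symmetric]
    by (rule exI[of _ B], rule exI[of _ A'], rule exI[of _ P'], rule conjI[OF B(1) conjI[OF B(2) conjI[OF BA conjI[OF A'B conjI[OF F1 conjI[OF PP' conjI[OF F2 conjI[OF F3 F4]]]]]]]])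
qed

end

section \<open>Orbits of one element on the cosets of a normal subgroup\<close>

context group
begin

text \<open>Powers of \<open>x\<close> act by right translation. As \<open>N\<close> is normal, the
  same powers fix every coset, so all orbits have length exactly \<open>k\<close>; one coset is
  chosen from each.\<close>

lemma rcosets_orbit_representatives:
  assumes N: "N \<lhd> G" "finite (rcosets N)" and x: "x \<in> carrier G" and k: "k > 0"
    and ord: "\<And>j :: nat. x [^] j \<in> N \<longleftrightarrow> k dvd j"
  shows "\<exists>S\<subseteq>rcosets N. k * card S \<le> card (rcosets N) \<and>
    (\<forall>C\<in>rcosets N. \<exists>s\<in>S. \<exists>i :: nat. C = s #> x [^] i)"
proof -
  interpret N: normal N G by fact
  have sN: "subgroup N G" ..
  have act: "(C #> x [^] i) #> x [^] j = C #> x [^] (i + j)" if "C \<in> rcosets N" for C and i j :: nat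
    using that x N.rcosets_carrier[OF is_group] by (simp add: coset_mult_assoc nat_pow_mult)
  have act_closed: "C #> x [^] i \<in> rcosets N" if C: "C \<in> rcosets N" for C and i :: nat
  proof -
    obtain g where g: "g \<in> carrier G" "C = N #> g"
      using C unfolding RCOSETS_def by blast
    then have "C #> x [^] i = N #> (g \<otimes> x [^] i)"
      using x N.subset by (simp add: coset_mult_assoc)
    then show ?thesis
      using g x N.subset by (auto intro!: rcosetsI)
  qed
  have act_eq: "C #> x [^] i = C #> x [^] j \<longleftrightarrow> k dvd (j - i)" if C: "C \<in> rcosets N" and "i \<le> j" for C and i j :: nat
  proof -
    obtain g where g: "g \<in> carrier G" "C = N #> g"
      using C unfolding RCOSETS_def by blast
    then show ?thesis
      using rcosets_pow_eq_iff[OF N(1) g(1) x that(2)] x N.subset ord by (simp add: coset_mult_assoc)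
  qed
  define orb where "orb C = range (\<lambda>i :: nat. C #> x [^] i)" for C
  have orb_eq: "orb (C #> x [^] i) = orb C" if C: "C \<in> rcosets N" for C and i :: nat
  proof
    show "orb (C #> x [^] i) \<subseteq> orb C"
      unfolding orb_def using act[OF C] by auto
    show "orb C \<subseteq> orb (C #> x [^] i)"
    proof
      fix D assume "D \<in> orb C"
      then obtain j :: nat where j: "D = C #> x [^] j" unfolding orb_def by blast
      \<comment> \<open>Exponents are natural numbers: instead of \<open>i\<close> steps back,
        \<open>k * i - i\<close> further steps close the cycle.\<close>
      have "j \<le> i + (k * i - i + j)" by simp
      moreover have "i \<le> k * i"
        using k by (cases k) simp_all
      then have "i + (k * i - i + j) - j = k * i"
        by linarith
      then have "k dvd (i + (k * i - i + j) - j)"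
        by simp
      ultimately have "C #> x [^] j = C #> x [^] (i + (k * i - i + j))"
        using act_eq[OF C] by blast
      then show "D \<in> orb (C #> x [^] i)"
        unfolding orb_def j using act[OF C, of i "k * i - i + j"] by (metis rangeI)
    qed
  qed
  have self_orb: "C \<in> orb C" if C: "C \<in> rcosets N" for C
    unfolding orb_def using that N.rcosets_carrier[OF is_group C] by (intro range_eqI[of _ _ 0]) simp
  have orb_sub: "orb C \<subseteq> rcosets N" if C: "C \<in> rcosets N" for C
    unfolding orb_def using act_closed[OF C] by blast
  have card_orb: "card (orb C) = k" if C: "C \<in> rcosets N" for C
  proof -
    have "orb C = (\<lambda>i :: nat. C #> x [^] i) ` {..<k}"
    proof
      show "orb C \<subseteq> (\<lambda>i :: nat. C #> x [^] i) ` {..<k}"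
      proof
        fix D assume "D \<in> orb C"
        then obtain j :: nat where j: "D = C #> x [^] j" unfolding orb_def by blast
        have "C #> x [^] (j mod k) = C #> x [^] j"
          using act_eq[OF C, of "j mod k" j] by (simp add: minus_mod_eq_mult_div)
        then show "D \<in> (\<lambda>i :: nat. C #> x [^] i) ` {..<k}"
          using j k by (intro image_eqI[of _ _ "j mod k"]) auto
      qed
    qed (auto simp: orb_def)
    moreover have "inj_on (\<lambda>i :: nat. C #> x [^] i) {..<k}"
    proof (rule linorder_inj_onI)
      fix i j :: nat assume "i < j" "i \<in> {..<k}" "j \<in> {..<k}"
      then show "C #> x [^] i \<noteq> C #> x [^] j"
        using act_eq[OF C, of i j] by (auto dest: dvd_imp_le)
    qed auto
    ultimately show ?thesis
      by (simp add: card_image)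
  qed
  define Q where "Q = orb ` (rcosets N)"
  have UQ: "\<Union>Q = rcosets N"
    unfolding Q_def using self_orb orb_sub by blast
  have finQ: "finite Q"
    unfolding Q_def using N(2) by simp
  have "k * card Q = card (\<Union>Q)"
  proof (rule card_partition)
    show "finite Q" by fact
    show "finite (\<Union>Q)" using UQ N(2) by simp
    show "card c = k" if "c \<in> Q" for c
      using that card_orb unfolding Q_def by blast
    show "c1 \<inter> c2 = {}" if "c1 \<in> Q" "c2 \<in> Q" "c1 \<noteq> c2" for c1 c2
    proof (rule ccontr)
      assume "c1 \<inter> c2 \<noteq> {}"
      then obtain D where D: "D \<in> c1" "D \<in> c2" by blast
      obtain C1 C2 where C: "C1 \<in> rcosets N" "C2 \<in> rcosets N" "c1 = orb C1" "c2 = orb C2"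
        using \<open>c1 \<in> Q\<close> \<open>c2 \<in> Q\<close> unfolding Q_def by blast
      obtain i j :: nat where "D = C1 #> x [^] i" "D = C2 #> x [^] j"
        using D unfolding C orb_def by blast
      then have "orb D = c1" "orb D = c2"
        using orb_eq[OF C(1), of i] orb_eq[OF C(2), of j] C(3,4) by auto
      then show False using \<open>c1 \<noteq> c2\<close> by simp
    qed
  qed
  then have kQ: "k * card Q = card (rcosets N)"
    unfolding UQ .
  define s where "s X = (SOME C. C \<in> rcosets N \<and> X = orb C)" for X
  have s: "s X \<in> rcosets N \<and> X = orb (s X)" if "X \<in> Q" for X
    unfolding s_def by (rule someI_ex) (use that Q_def in blast)
  have "s ` Q \<subseteq> rcosets N"
    using s by blast
  moreover have "k * card (s ` Q) \<le> card (rcosets N)"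
    unfolding kQ[symmetric] using card_image_le[OF finQ, of s] by (rule mult_le_mono2)
  moreover have "\<forall>C\<in>rcosets N. \<exists>t\<in>s ` Q. \<exists>i :: nat. C = t #> x [^] i"
  proof
    fix C assume C: "C \<in> rcosets N"
    then have "orb C \<in> Q" unfolding Q_def by simp
    then have "C \<in> orb (s (orb C))"
      using s self_orb[OF C] by blast
    then obtain i :: nat where "C = s (orb C) #> x [^] i"
      unfolding orb_def by blast
    then show "\<exists>t\<in>s ` Q. \<exists>i :: nat. C = t #> x [^] i"
      using \<open>orb C \<in> Q\<close> by blast
  qed
  ultimately show ?thesis by blast
qed

end

section \<open>The free group of rank two\<close>

text \<open>A letter is a generator together with a flag that is false for its inverse; group elements are
  reduced words.\<close>

type_synonym word2 = "(bool \<times> bool) list"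

definition inv_letter :: "bool \<times> bool \<Rightarrow> bool \<times> bool" where
  "inv_letter x = (fst x, \<not> snd x)"

lemma inv_letter_inv_letter [simp]: "inv_letter (inv_letter x) = x"
  by (simp add: inv_letter_def)

lemma inv_letter_neq [simp]: "inv_letter x \<noteq> x"
  by (cases x) (simp add: inv_letter_def)

fun push :: "bool \<times> bool \<Rightarrow> word2 \<Rightarrow> word2" where
  "push x [] = [x]"
| "push x (y # w) = (if y = inv_letter x then w else x # y # w)"

fun reduced :: "word2 \<Rightarrow> bool" where
  "reduced [] = True"
| "reduced [x] = True"
| "reduced (x # y # w) = (y \<noteq> inv_letter x \<and> reduced (y # w))"

definition reduce :: "word2 \<Rightarrow> word2" where
  "reduce w = foldr push w []"

lemma reduced_tl: "reduced (x # w) \<Longrightarrow> reduced w"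
  by (cases w) auto

lemma reduced_push: "reduced w \<Longrightarrow> reduced (push x w)"
  by (cases w) (auto dest: reduced_tl)

lemma reduced_foldr_push: "reduced z \<Longrightarrow> reduced (foldr push w z)"
  by (induction w) (auto intro: reduced_push)

lemma reduced_reduce: "reduced (reduce w)"
  unfolding reduce_def by (rule reduced_foldr_push) simp

lemma push_eq_Cons: "reduced (x # w) \<Longrightarrow> push x w = x # w"
  by (cases w) auto

lemma reduce_reduced: "reduced w \<Longrightarrow> reduce w = w"
proof (induction w)
  case (Cons x w)
  then have "reduce w = w"
    using reduced_tl by blast
  then show ?case
    using push_eq_Cons[OF Cons.prems] by (simp add: reduce_def)
qed (simp add: reduce_def)

text \<open>Each letter permutes the reduced words, and the inverse letter acts as the inverse
  permutation (van der Waerden's trick). The group laws of \<open>free2\<close> become laws of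
  composition, with no confluence argument.\<close>

lemma push_push_inv: "reduced w \<Longrightarrow> push x (push (inv_letter x) w) = w"
  by (cases w) (auto intro: push_eq_Cons)

lemma push_inv_push: "reduced w \<Longrightarrow> push (inv_letter x) (push x w) = w"
  using push_push_inv[of w "inv_letter x"] by simp

lemma foldr_push_push:
  assumes "reduced z"
  shows "foldr push (push x v) z = push x (foldr push v z)"
  using push_push_inv[OF reduced_foldr_push[OF assms]] by (cases v) auto

text \<open>A word and its reduction act by the same permutation; this is the substance of
  associativity.\<close>

lemma foldr_push_reduce:
  assumes "reduced z"
  shows "foldr push (reduce u) z = foldr push u z"
proof (induction u)
  case (Cons x u)
  then show ?case
    using foldr_push_push[OF assms, of x "reduce u"] by (simp add: reduce_def)
qed (simp add: reduce_def)

definition free2 :: "word2 monoid" where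
  "free2 = \<lparr>carrier = {w. reduced w}, mult = (\<lambda>u v. reduce (u @ v)), one = []\<rparr>"

lemma carrier_free2: "carrier free2 = {w. reduced w}"
  by (simp add: free2_def)

lemma one_free2: "\<one>\<^bsub>free2\<^esub> = []"
  by (simp add: free2_def)

lemma mult_free2: "reduced v \<Longrightarrow> u \<otimes>\<^bsub>free2\<^esub> v = foldr push u v"
  using reduce_reduced[of v] by (simp add: free2_def reduce_def)

definition inv_word :: "word2 \<Rightarrow> word2" where
  "inv_word w = rev (map inv_letter w)"

lemma foldr_push_inv_word: "reduced z \<Longrightarrow> foldr push (inv_word u) (foldr push u z) = z"
proof (induction u)
  case (Cons x u)
  then show ?case
    by (simp add: inv_word_def push_inv_push reduced_foldr_push)
qed (simp add: inv_word_def)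

lemma group_free2: "group free2"
proof (rule groupI)
  fix u v w assume "u \<in> carrier free2" "v \<in> carrier free2" "w \<in> carrier free2"
  then have r: "reduced u" "reduced v" "reduced w"
    by (auto simp: carrier_free2)
  then show "u \<otimes>\<^bsub>free2\<^esub> v \<otimes>\<^bsub>free2\<^esub> w = u \<otimes>\<^bsub>free2\<^esub> (v \<otimes>\<^bsub>free2\<^esub> w)"
    using foldr_push_reduce[OF r(3), of "u @ v"]
    by (simp add: mult_free2 reduced_foldr_push) (simp add: reduce_def reduce_reduced[unfolded reduce_def])
next
  fix u assume u: "u \<in> carrier free2"
  show "\<exists>v\<in>carrier free2. v \<otimes>\<^bsub>free2\<^esub> u = \<one>\<^bsub>free2\<^esub>"
  proof (intro bexI[of _ "reduce (inv_word u)"])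
    have "foldr push (inv_word u) (foldr push u []) = []"
      by (rule foldr_push_inv_word) simp
    then show "reduce (inv_word u) \<otimes>\<^bsub>free2\<^esub> u = \<one>\<^bsub>free2\<^esub>"
      using u foldr_push_reduce[of u "inv_word u"] reduce_reduced[of u]
      by (simp add: mult_free2 carrier_free2 one_free2 reduce_def)
  qed (simp add: carrier_free2 reduced_reduce)
qed (auto simp: carrier_free2 one_free2 mult_free2 reduced_foldr_push)

interpretation free2: group free2
  by (rule group_free2)

lemma letter_in_free2 [simp]: "[x] \<in> carrier free2"
  by (simp add: carrier_free2)

lemma letter_mult_free2: "w \<in> carrier free2 \<Longrightarrow> [x] \<otimes>\<^bsub>free2\<^esub> w = push x w"
  by (simp add: mult_free2 carrier_free2)

lemma letter_inverse_free2: "[x] \<otimes>\<^bsub>free2\<^esub> [inv_letter x] = \<one>\<^bsub>free2\<^esub>"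
  by (simp add: mult_free2 one_free2)

lemma generate_free2: "generate free2 ((\<lambda>b. [(b, True)]) ` UNIV) = carrier free2"
proof
  let ?S = "(\<lambda>b. [(b, True)]) ` UNIV"
  show "generate free2 ?S \<subseteq> carrier free2"
    by (rule free2.generate_incl) auto
  have letter: "[x] \<in> generate free2 ?S" for x
  proof (cases x)
    case (Pair b s)
    show ?thesis
    proof (cases s)
      case True
      then show ?thesis unfolding Pair by (auto intro: generate.incl)
    next
      case False
      have "inv\<^bsub>free2\<^esub> [(b, True)] = [x]"
        using letter_inverse_free2[of x] False unfolding Pair inv_letter_def
        by (intro free2.inv_equality) simp_all
      moreover have "inv\<^bsub>free2\<^esub> [(b, True)] \<in> generate free2 ?S"
        by (rule generate.inv) simp
      ultimately show ?thesis by simp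
    qed
  qed
  show "carrier free2 \<subseteq> generate free2 ?S"
  proof
    fix w assume "w \<in> carrier free2"
    then have "reduced w" by (simp add: carrier_free2)
    then show "w \<in> generate free2 ?S"
    proof (induction w)
      case Nil
      then show ?case using generate.one[of free2 ?S] by (simp add: one_free2)
    next
      case (Cons x w)
      then have w: "w \<in> generate free2 ?S" "reduced w"
        using reduced_tl by blast+
      have "[x] \<otimes>\<^bsub>free2\<^esub> w = x # w"
        using letter_mult_free2[of w x] push_eq_Cons[OF Cons.prems] w by (simp add: carrier_free2)
      then show ?case
        using generate.eng[OF letter[of x] w(1)] by simp
    qed
  qed
qed

section \<open>Labelled coset graphs and the characters given by path sums\<close>

text \<open>\<open>c\<close> labels the edges of the Schreier coset graph: \<open>c (C, b)\<close> belongs to the edge leaving the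
  coset \<open>C\<close> along generator \<open>b\<close>. Path sums of closed paths at \<open>N\<close> are the characters of \<open>N\<close>.\<close>

definition edge_val :: "(word2 set \<times> bool \<Rightarrow> rat) \<Rightarrow> word2 set \<Rightarrow> bool \<times> bool \<Rightarrow> rat" where
  "edge_val c C x = (if snd x then c (C, fst x) else - c (C #>\<^bsub>free2\<^esub> [x], fst x))"

fun path_sum :: "(word2 set \<times> bool \<Rightarrow> rat) \<Rightarrow> word2 set \<Rightarrow> word2 \<Rightarrow> rat" where
  "path_sum c C [] = 0"
| "path_sum c C (x # w) = edge_val c C x + path_sum c (C #>\<^bsub>free2\<^esub> [x]) w"

lemma r_coset_letter_inverse:
  assumes "C \<subseteq> carrier free2"
  shows "C #>\<^bsub>free2\<^esub> [x] #>\<^bsub>free2\<^esub> [inv_letter x] = C"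
  using assms by (simp add: free2.coset_mult_assoc letter_inverse_free2)

lemma edge_val_inverse:
  assumes "C \<subseteq> carrier free2"
  shows "edge_val c (C #>\<^bsub>free2\<^esub> [x]) (inv_letter x) = - edge_val c C x"
  using r_coset_letter_inverse[OF assms, of x]
  by (cases x; cases "snd x") (simp_all add: edge_val_def inv_letter_def)

lemma r_coset_subset: "C \<subseteq> carrier free2 \<Longrightarrow> g \<in> carrier free2 \<Longrightarrow> C #>\<^bsub>free2\<^esub> g \<subseteq> carrier free2"
  by (rule free2.r_coset_subset_G)

text \<open>An edge and its reverse contribute opposite values, so cancelling a letter against its
  inverse does not change the sum.\<close>

lemma path_sum_push:
  assumes C: "C \<subseteq> carrier free2"
  shows "path_sum c C (push x w) = edge_val c C x + path_sum c (C #>\<^bsub>free2\<^esub> [x]) w"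
proof (cases w)
  case (Cons y v)
  show ?thesis
  proof (cases "y = inv_letter x")
    case True
    then show ?thesis
      using Cons edge_val_inverse[OF C] r_coset_letter_inverse[OF C] by simp
  qed (use Cons in simp)
qed simp

lemma path_sum_foldr_push:
  assumes "C \<subseteq> carrier free2" "reduced z"
  shows "path_sum c C (foldr push u z) = path_sum c C u + path_sum c (C #>\<^bsub>free2\<^esub> reduce u) z"
  using assms(1)
proof (induction u arbitrary: C)
  case Nil
  then show ?case
    using free2.coset_mult_one[of C] by (simp add: reduce_def one_free2)
next
  case (Cons x u)
  have r: "reduce u \<in> carrier free2"
    by (simp add: carrier_free2 reduced_reduce)
  have "reduce (x # u) = [x] \<otimes>\<^bsub>free2\<^esub> reduce u"
    using letter_mult_free2[OF r, of x] by (simp add: reduce_def)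
  then have "C #>\<^bsub>free2\<^esub> reduce (x # u) = C #>\<^bsub>free2\<^esub> [x] #>\<^bsub>free2\<^esub> reduce u"
    using free2.coset_mult_assoc[OF Cons.prems letter_in_free2 r] by simp
  then show ?case
    using path_sum_push[OF Cons.prems, of c x "foldr push u z"] Cons.IH[OF r_coset_subset[OF Cons.prems letter_in_free2]]
    by simp
qed

lemma path_sum_mult:
  assumes "C \<subseteq> carrier free2" "u \<in> carrier free2" "v \<in> carrier free2"
  shows "path_sum c C (u \<otimes>\<^bsub>free2\<^esub> v) = path_sum c C u + path_sum c (C #>\<^bsub>free2\<^esub> u) v"
  using path_sum_foldr_push[OF assms(1), of v c u] assms(2,3)
  by (simp add: carrier_free2 mult_free2 reduce_reduced)

lemma path_sum_linear: "path_sum (\<lambda>i. c i + r * d i) C w = path_sum c C w + r * path_sum d C w"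
  by (induction w arbitrary: C) (simp_all add: edge_val_def ring_distribs)

text \<open>Inflow minus outflow at the vertex \<open>C\<close>: the edge entering \<open>C\<close>
  along generator \<open>b\<close> starts at \<open>C\<close> moved by the inverse of
  \<open>b\<close>. Its vanishing excludes the nonzero gradients, which are labels with trivial
  character.\<close>

definition divergence :: "word2 set \<Rightarrow> (word2 set \<times> bool \<Rightarrow> rat) \<Rightarrow> rat" where
  "divergence C c = (\<Sum>b\<in>UNIV. c (C #>\<^bsub>free2\<^esub> [(b, False)], b) - c (C, b))"

context
  fixes N :: "word2 set"
  assumes N: "N \<lhd> free2" "finite (rcosets\<^bsub>free2\<^esub> N)"
begin

interpretation N: normal N free2
  by (rule N(1))

lemma rcoset_carrier: "C \<in> rcosets\<^bsub>free2\<^esub> N \<Longrightarrow> C \<subseteq> carrier free2"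
  by (rule N.rcosets_carrier[OF group_free2])

lemma rcoset_closed:
  assumes "C \<in> rcosets\<^bsub>free2\<^esub> N" "g \<in> carrier free2"
  shows "C #>\<^bsub>free2\<^esub> g \<in> rcosets\<^bsub>free2\<^esub> N"
proof -
  obtain h where h: "h \<in> carrier free2" "C = N #>\<^bsub>free2\<^esub> h"
    using assms(1) unfolding RCOSETS_def by blast
  then show ?thesis
    using assms(2) N.subset by (auto simp: free2.coset_mult_assoc intro!: free2.rcosetsI)
qed

lemma N_rcoset: "N \<in> rcosets\<^bsub>free2\<^esub> N"
  by (rule N.subgroup_in_rcosets[OF group_free2])

lemma N_mult_coset: "a \<in> N \<Longrightarrow> N #>\<^bsub>free2\<^esub> a = N"
  using free2.coset_join2[OF _ N.is_subgroup] N.subset by blast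

lemma rcoset_mult_normal:
  assumes "C \<in> rcosets\<^bsub>free2\<^esub> N" "r \<in> N"
  shows "C #>\<^bsub>free2\<^esub> r = C"
proof -
  obtain g where g: "g \<in> carrier free2" "C = N #>\<^bsub>free2\<^esub> g"
    using assms(1) unfolding RCOSETS_def by blast
  have r: "r \<in> carrier free2"
    using assms(2) N.subset by blast
  have "N #>\<^bsub>free2\<^esub> (g \<otimes>\<^bsub>free2\<^esub> r [^]\<^bsub>free2\<^esub> (0 :: nat)) = N #>\<^bsub>free2\<^esub> (g \<otimes>\<^bsub>free2\<^esub> r [^]\<^bsub>free2\<^esub> (1 :: nat))"
    using free2.rcosets_pow_eq_iff[OF N(1) g(1) r, of 0 1] assms(2) r by simp
  then have "N #>\<^bsub>free2\<^esub> (g \<otimes>\<^bsub>free2\<^esub> r) = C"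
    using g r by simp
  then show ?thesis
    unfolding g(2) free2.coset_mult_assoc[OF N.subset g(1) r] .
qed

text \<open>If the character vanishes, \<open>c\<close> is the gradient of a potential \<open>p\<close>; being divergence free, it is
  orthogonal to all gradients, in particular to itself.\<close>

lemma path_sum_zero_coboundary:
  assumes supp: "\<forall>i. i \<notin> (rcosets\<^bsub>free2\<^esub> N) \<times> UNIV \<longrightarrow> c i = 0"
    and div: "\<forall>C\<in>rcosets\<^bsub>free2\<^esub> N. divergence C c = 0"
    and zero: "\<forall>a\<in>N. path_sum c N a = 0"
  shows "c i = 0"
proof -
  let ?Q = "rcosets\<^bsub>free2\<^esub> N"
  define rep :: "word2 set \<Rightarrow> word2" where "rep C = (SOME g. g \<in> C)" for C
  define p where "p C = path_sum c N (rep C)" for C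
  \<comment> \<open>The sum along a path from \<open>N\<close> depends only on the coset reached:
    two such paths differ by an element of \<open>N\<close>, where the sum vanishes.\<close>
  have p: "path_sum c N g = p (N #>\<^bsub>free2\<^esub> g)" if g: "g \<in> carrier free2" for g
  proof -
    let ?t = "rep (N #>\<^bsub>free2\<^esub> g)"
    have t: "?t \<in> N #>\<^bsub>free2\<^esub> g"
      unfolding rep_def by (rule someI[of _ g]) (rule free2.rcos_self[OF g N.is_subgroup])
    then have tc: "?t \<in> carrier free2"
      using free2.r_coset_subset_G[OF N.subset g] by blast
    have a: "?t \<otimes>\<^bsub>free2\<^esub> inv\<^bsub>free2\<^esub> g \<in> N" (is "?a \<in> N")
      by (rule N.rcos_module_imp[OF group_free2 g t])
    have "?t = ?a \<otimes>\<^bsub>free2\<^esub> g"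
      using tc g by (simp add: free2.m_assoc)
    then have "path_sum c N ?t = path_sum c N (?a \<otimes>\<^bsub>free2\<^esub> g)"
      by (rule arg_cong)
    also have "\<dots> = path_sum c N ?a + path_sum c (N #>\<^bsub>free2\<^esub> ?a) g"
      using tc g by (intro path_sum_mult N.subset) auto
    finally show ?thesis
      using bspec[OF zero a] N_mult_coset[OF a] by (simp add: p_def)
  qed
  have c_p: "c (C, b) = p (C #>\<^bsub>free2\<^esub> [(b, True)]) - p C" if C: "C \<in> ?Q" for C b
  proof -
    obtain g where g: "g \<in> carrier free2" "C = N #>\<^bsub>free2\<^esub> g"
      using C unfolding RCOSETS_def by blast
    have "path_sum c N (g \<otimes>\<^bsub>free2\<^esub> [(b, True)]) = path_sum c N g + path_sum c C [(b, True)]"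
      unfolding g(2) by (rule path_sum_mult[OF N.subset g(1) letter_in_free2])
    moreover have "path_sum c C [(b, True)] = c (C, b)"
      by (simp add: edge_val_def)
    moreover have "path_sum c N (g \<otimes>\<^bsub>free2\<^esub> [(b, True)]) = p (C #>\<^bsub>free2\<^esub> [(b, True)])"
      using p[of "g \<otimes>\<^bsub>free2\<^esub> [(b, True)]"] g N.subset by (simp add: free2.coset_mult_assoc)
    ultimately show ?thesis
      using p[OF g(1)] g(2) by simp
  qed
  \<comment> \<open>Summation by parts: an edge is regrouped under the coset it enters instead of
    the one it leaves.\<close>
  have shift: "(\<Sum>C\<in>?Q. c (C, b) * p (C #>\<^bsub>free2\<^esub> [(b, True)])) = (\<Sum>C\<in>?Q. c (C #>\<^bsub>free2\<^esub> [(b, False)], b) * p C)" for b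
  proof (rule sum.reindex_bij_witness[where i = "\<lambda>C. C #>\<^bsub>free2\<^esub> [(b, False)]" and j = "\<lambda>C. C #>\<^bsub>free2\<^esub> [(b, True)]"])
    fix C assume C: "C \<in> ?Q"
    show "C #>\<^bsub>free2\<^esub> [(b, True)] #>\<^bsub>free2\<^esub> [(b, False)] = C"
      using r_coset_letter_inverse[OF rcoset_carrier[OF C], of "(b, True)"] by (simp add: inv_letter_def)
    then show "c (C #>\<^bsub>free2\<^esub> [(b, True)] #>\<^bsub>free2\<^esub> [(b, False)], b) * p (C #>\<^bsub>free2\<^esub> [(b, True)]) = c (C, b) * p (C #>\<^bsub>free2\<^esub> [(b, True)])"
      by simp
    show "C #>\<^bsub>free2\<^esub> [(b, False)] #>\<^bsub>free2\<^esub> [(b, True)] = C"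
      using r_coset_letter_inverse[OF rcoset_carrier[OF C], of "(b, False)"] by (simp add: inv_letter_def)
  qed (auto intro: rcoset_closed)
  have "(\<Sum>b\<in>UNIV. \<Sum>C\<in>?Q. c (C, b) ^ 2) = (\<Sum>b\<in>UNIV. \<Sum>C\<in>?Q. c (C, b) * p (C #>\<^bsub>free2\<^esub> [(b, True)]) - c (C, b) * p C)"
    by (intro sum.cong refl) (simp add: c_p power2_eq_square algebra_simps)
  also have "\<dots> = (\<Sum>b\<in>UNIV. \<Sum>C\<in>?Q. p C * (c (C #>\<^bsub>free2\<^esub> [(b, False)], b) - c (C, b)))"
    by (simp add: sum_subtractf shift right_diff_distrib mult.commute[of "p _"])
  also have "\<dots> = (\<Sum>C\<in>?Q. p C * divergence C c)"
    unfolding divergence_def sum_distrib_left by (rule sum.swap)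
  also have "\<dots> = 0"
    by (rule sum.neutral) (use div in simp)
  finally have "(\<Sum>b\<in>UNIV. \<Sum>C\<in>?Q. c (C, b) ^ 2) = 0" .
  then have "\<forall>b\<in>UNIV. (\<Sum>C\<in>?Q. c (C, b) ^ 2) = 0"
    by (subst (asm) sum_nonneg_eq_0_iff) (auto intro: sum_nonneg)
  then have sq: "\<forall>C\<in>?Q. c (C, b) ^ 2 = 0" for b
    using N(2) by (subst (asm) sum_nonneg_eq_0_iff) auto
  obtain C b where i: "i = (C, b)" by (cases i)
  show "c i = 0"
  proof (cases "C \<in> ?Q")
    case True
    then show ?thesis using sq[of b] i by simp
  next
    case False
    then show ?thesis using supp i by simp
  qed
qed

text \<open>The path of a conjugate of \<open>r\<close> by \<open>g\<close> runs to the coset of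
  \<open>g\<close>, around the loop \<open>r\<close> there, and back the same way. Killing all
  conjugates thus means a zero loop sum at every coset.\<close>

lemma path_sum_rat_homs:
  assumes R: "R \<subseteq> N" and rel: "\<And>C r. C \<in> rcosets\<^bsub>free2\<^esub> N \<Longrightarrow> r \<in> R \<Longrightarrow> path_sum c C r = 0"
  shows "path_sum c N \<in> rat_homs free2 N R"
  unfolding rat_homs_def
proof (intro CollectI conjI ballI)
  fix a b assume ab: "a \<in> N" "b \<in> N"
  then show "path_sum c N (a \<otimes>\<^bsub>free2\<^esub> b) = path_sum c N a + path_sum c N b"
    using path_sum_mult[OF N.subset, of a b c] N.subset N_mult_coset[OF ab(1)] by auto
next
  fix g r assume g: "g \<in> carrier free2" and r: "r \<in> R"
  have rN: "r \<in> N" "r \<in> carrier free2"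
    using r R N.subset by auto
  let ?C = "N #>\<^bsub>free2\<^esub> g"
  have C: "?C \<in> rcosets\<^bsub>free2\<^esub> N"
    by (rule free2.rcosetsI[OF N.subset g])
  have "path_sum c N (g \<otimes>\<^bsub>free2\<^esub> r \<otimes>\<^bsub>free2\<^esub> inv\<^bsub>free2\<^esub> g) =
      path_sum c N (g \<otimes>\<^bsub>free2\<^esub> r) + path_sum c (N #>\<^bsub>free2\<^esub> (g \<otimes>\<^bsub>free2\<^esub> r)) (inv\<^bsub>free2\<^esub> g)"
    using g rN by (intro path_sum_mult N.subset) auto
  also have "path_sum c N (g \<otimes>\<^bsub>free2\<^esub> r) = path_sum c N g + path_sum c ?C r"
    by (rule path_sum_mult[OF N.subset g rN(2)])
  also have "path_sum c ?C r = 0"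
    by (rule rel[OF C r])
  also have "N #>\<^bsub>free2\<^esub> (g \<otimes>\<^bsub>free2\<^esub> r) = ?C"
    using rcoset_mult_normal[OF C rN(1)] free2.coset_mult_assoc[OF N.subset g rN(2)] by simp
  also have "path_sum c N g + 0 + path_sum c ?C (inv\<^bsub>free2\<^esub> g) = path_sum c N (g \<otimes>\<^bsub>free2\<^esub> inv\<^bsub>free2\<^esub> g)"
    using path_sum_mult[OF N.subset g free2.inv_closed[OF g], of c] by simp
  also have "\<dots> = 0"
    using g by (simp add: one_free2)
  finally show "path_sum c N (g \<otimes>\<^bsub>free2\<^esub> r \<otimes>\<^bsub>free2\<^esub> inv\<^bsub>free2\<^esub> g) = 0" .
qed

end

text \<open>With \<open>m\<close> the index of \<open>N\<close>, there are \<open>2 m\<close> unknown labels. Being divergence free amounts to \<open>m\<close>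
  equations, \<open>Y\<close> to at most \<open>m / 2\<close>, and a relator \<open>x\<^sup>k\<close> to only \<open>m / k\<close>: its path sum is constant along
  the orbits of \<open>x\<close> on the cosets, which have length \<open>k\<close>.\<close>

lemma many_homs_free2:
  assumes st: "good_state free2 N P" and Y: "finite Y" "2 * card Y \<le> card (rcosets\<^bsub>free2\<^esub> N)" "\<And>y. y \<in> Y \<Longrightarrow> lin_fun y"
  shows "\<exists>\<phi>\<in>rat_homs free2 N (relators free2 P). (\<exists>a\<in>N. \<phi> a \<noteq> 0) \<and> (\<forall>y\<in>Y. y \<phi> = 0)"
proof -
  let ?Q = "rcosets\<^bsub>free2\<^esub> N"
  have N: "N \<lhd> free2" "finite ?Q" and finP: "finite P"
    and P: "\<And>x k. (x, k) \<in> P \<Longrightarrow> x \<in> carrier free2 \<and> k > 0 \<and> (\<forall>j :: nat. x [^]\<^bsub>free2\<^esub> j \<in> N \<longleftrightarrow> k dvd j)"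
    and sum: "(\<Sum>(x, k)\<in>P. 1 / real k) < 1 / 2"
    using st unfolding good_state_def by auto
  define m where "m = card ?Q"
  have m: "m > 0"
    unfolding m_def using N(2) N_rcoset[OF N] by (auto simp: card_gt_0_iff)
  have "\<forall>xk\<in>P. \<exists>S\<subseteq>?Q. snd xk * card S \<le> m \<and> (\<forall>C\<in>?Q. \<exists>s\<in>S. \<exists>i :: nat. C = s #>\<^bsub>free2\<^esub> fst xk [^]\<^bsub>free2\<^esub> i)"
  proof
    fix xk assume xk: "xk \<in> P"
    show "\<exists>S\<subseteq>?Q. snd xk * card S \<le> m \<and> (\<forall>C\<in>?Q. \<exists>s\<in>S. \<exists>i :: nat. C = s #>\<^bsub>free2\<^esub> fst xk [^]\<^bsub>free2\<^esub> i)"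
      unfolding m_def using P[of "fst xk" "snd xk"] xk
      by (intro free2.rcosets_orbit_representatives[OF N]) auto
  qed
  then obtain S where S: "\<forall>xk\<in>P. S xk \<subseteq> ?Q \<and> snd xk * card (S xk) \<le> m \<and>
      (\<forall>C\<in>?Q. \<exists>s\<in>S xk. \<exists>i :: nat. C = s #>\<^bsub>free2\<^esub> fst xk [^]\<^bsub>free2\<^esub> i)"
    by (rule bchoice[THEN exE])
  have finS: "finite (S xk)" if "xk \<in> P" for xk
    using S that N(2) finite_subset by blast
  \<comment> \<open>The equations form sets of functionals; coinciding conditions are merged, which
    can only lower their number.\<close>
  define J1 where "J1 = divergence ` ?Q"
  define J2 where "J2 = (\<Union>xk\<in>P. (\<lambda>s c. path_sum c s (fst xk [^]\<^bsub>free2\<^esub> snd xk)) ` S xk)"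
  define J3 where "J3 = (\<lambda>y c. y (path_sum c N)) ` Y"
  have "real (card J2) \<le> real m * (\<Sum>(x, k)\<in>P. 1 / real k)"
  proof -
    have "card J2 \<le> (\<Sum>xk\<in>P. card ((\<lambda>s c. path_sum c s (fst xk [^]\<^bsub>free2\<^esub> snd xk)) ` S xk))"
      unfolding J2_def by (rule card_UN_le[OF finP])
    also have "\<dots> \<le> (\<Sum>xk\<in>P. card (S xk))"
      by (intro sum_mono card_image_le finS)
    finally have "real (card J2) \<le> (\<Sum>xk\<in>P. real (card (S xk)))"
      by (simp flip: of_nat_sum)
    also have "\<dots> \<le> (\<Sum>xk\<in>P. real m * (1 / real (snd xk)))"
    proof (rule sum_mono)
      fix xk assume xk: "xk \<in> P"
      then have "real (snd xk) * real (card (S xk)) \<le> real m"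
        using S by (simp flip: of_nat_mult)
      moreover have "snd xk > 0"
        using P[of "fst xk" "snd xk"] xk by simp
      ultimately show "real (card (S xk)) \<le> real m * (1 / real (snd xk))"
        by (simp add: field_simps)
    qed
    also have "\<dots> = real m * (\<Sum>(x, k)\<in>P. 1 / real k)"
      by (simp add: sum_distrib_left case_prod_beta)
    finally show ?thesis .
  qed
  \<comment> \<open>The strictness of the final count comes from here; the other two families may
    exhaust their shares \<open>m\<close> and \<open>m / 2\<close>.\<close>
  also have "\<dots> < real m * (1 / 2)"
    using m sum by (intro mult_strict_left_mono) auto
  finally have J2: "2 * card J2 < m"
    by simp
  have J1: "card J1 \<le> m"
    unfolding J1_def m_def by (rule card_image_le[OF N(2)])
  have J3: "2 * card J3 \<le> m"
    using card_image_le[OF Y(1), of "\<lambda>y c. y (path_sum c N)"] Y(2) unfolding J3_def m_def by linarith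
  have "card (J1 \<union> J2 \<union> J3) \<le> card J1 + card J2 + card J3"
    using card_Un_le[of "J1 \<union> J2" J3] card_Un_le[of J1 J2] by linarith
  also have "\<dots> < 2 * m"
    using J1 J2 J3 by linarith
  also have "2 * m = card (?Q \<times> (UNIV :: bool set))"
    unfolding m_def by (simp add: card_cartesian_product)
  finally have card: "card (J1 \<union> J2 \<union> J3) < card (?Q \<times> (UNIV :: bool set))" .
  have lin: "lin_fun L" if "L \<in> J1 \<union> J2 \<union> J3" for L
  proof -
    have "lin_fun (divergence C)" for C
      unfolding lin_fun_def divergence_def
      by (simp add: sum.distrib sum_subtractf sum_distrib_left algebra_simps)
    moreover have "lin_fun (\<lambda>c. path_sum c s w)" for s w
      unfolding lin_fun_def by (simp add: path_sum_linear)
    moreover have "lin_fun (\<lambda>c. y (path_sum c N))" if y: "y \<in> Y" for y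
      unfolding lin_fun_def
    proof (intro allI)
      fix c d :: "word2 set \<times> bool \<Rightarrow> rat" and r
      have "path_sum (\<lambda>i. c i + r * d i) N = (\<lambda>w. path_sum c N w + r * path_sum d N w)"
        by (rule ext) (rule path_sum_linear)
      then have "y (path_sum (\<lambda>i. c i + r * d i) N) = y (\<lambda>w. path_sum c N w + r * path_sum d N w)"
        by (rule arg_cong)
      also have "\<dots> = y (path_sum c N) + r * y (path_sum d N)"
        by (rule lin_funD[OF Y(3)[OF y]])
      finally show "y (path_sum (\<lambda>i. c i + r * d i) N) = y (path_sum c N) + r * y (path_sum d N)" .
    qed
    ultimately show ?thesis
      using that unfolding J1_def J2_def J3_def by (elim UnE UN_E imageE) simp_all
  qed
  have fin: "finite (J1 \<union> J2 \<union> J3)"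
    unfolding J1_def J2_def J3_def using N(2) finP finS Y(1) by auto
  have "\<exists>c. (\<forall>i. i \<notin> ?Q \<times> UNIV \<longrightarrow> c i = 0) \<and> (\<exists>i\<in>?Q \<times> UNIV. c i \<noteq> 0) \<and> (\<forall>L\<in>J1 \<union> J2 \<union> J3. L c = 0)"
    by (rule homogeneous_system_nontrivial[OF fin _ card, where L = "\<lambda>L. L"]) (use N(2) lin in auto)
  then obtain c where c: "\<forall>i. i \<notin> ?Q \<times> UNIV \<longrightarrow> c i = 0" "\<exists>i\<in>?Q \<times> UNIV. c i \<noteq> 0" "\<forall>L\<in>J1 \<union> J2 \<union> J3. L c = 0"
    by (elim exE conjE)
  have rel: "path_sum c C r = 0" if C: "C \<in> ?Q" and r: "r \<in> relators free2 P" for C r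
  proof -
    obtain x k where xk: "(x, k) \<in> P" "r = x [^]\<^bsub>free2\<^esub> k"
      using r unfolding relators_def by auto
    have x: "x \<in> carrier free2" and xN: "x [^]\<^bsub>free2\<^esub> k \<in> N"
      using P[OF xk(1)] by auto
    obtain s and i :: nat where s: "s \<in> S (x, k)" "C = s #>\<^bsub>free2\<^esub> x [^]\<^bsub>free2\<^esub> i"
      using bspec[OF S xk(1)] C by force
    have sQ: "s \<in> ?Q"
      using bspec[OF S xk(1)] s(1) by blast
    have "(\<lambda>c. path_sum c s (x [^]\<^bsub>free2\<^esub> k)) \<in> J1 \<union> J2 \<union> J3"
      unfolding J2_def using xk(1) s(1) by force
    from bspec[OF c(3) this] have 0: "path_sum c s (x [^]\<^bsub>free2\<^esub> k) = 0" .
    \<comment> \<open>The two powers of \<open>x\<close> commute, so travelling in either order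
      gives the same sum; the common part along \<open>x [^] i\<close> cancels.\<close>
    have "path_sum c s (x [^]\<^bsub>free2\<^esub> i) + path_sum c C (x [^]\<^bsub>free2\<^esub> k) = path_sum c s (x [^]\<^bsub>free2\<^esub> i \<otimes>\<^bsub>free2\<^esub> x [^]\<^bsub>free2\<^esub> k)"
      unfolding s(2) using path_sum_mult[OF rcoset_carrier[OF N sQ]] x by simp
    also have "x [^]\<^bsub>free2\<^esub> i \<otimes>\<^bsub>free2\<^esub> x [^]\<^bsub>free2\<^esub> k = x [^]\<^bsub>free2\<^esub> k \<otimes>\<^bsub>free2\<^esub> x [^]\<^bsub>free2\<^esub> i"
      using x by (simp add: free2.nat_pow_mult add.commute)
    also have "path_sum c s (x [^]\<^bsub>free2\<^esub> k \<otimes>\<^bsub>free2\<^esub> x [^]\<^bsub>free2\<^esub> i) =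
        path_sum c s (x [^]\<^bsub>free2\<^esub> k) + path_sum c (s #>\<^bsub>free2\<^esub> x [^]\<^bsub>free2\<^esub> k) (x [^]\<^bsub>free2\<^esub> i)"
      using path_sum_mult[OF rcoset_carrier[OF N sQ]] x by simp
    also have "s #>\<^bsub>free2\<^esub> x [^]\<^bsub>free2\<^esub> k = s"
      by (rule rcoset_mult_normal[OF N sQ xN])
    finally show ?thesis
      using 0 xk(2) by simp
  qed
  have RN: "relators free2 P \<subseteq> N"
    unfolding relators_def using P by auto
  have hom: "path_sum c N \<in> rat_homs free2 N (relators free2 P)"
    by (rule path_sum_rat_homs[OF N RN rel])
  have div: "\<forall>C\<in>?Q. divergence C c = 0"
    using c(3) unfolding J1_def by blast
  have "\<exists>a\<in>N. path_sum c N a \<noteq> 0"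
  proof (rule ccontr)
    assume "\<not> (\<exists>a\<in>N. path_sum c N a \<noteq> 0)"
    then have "\<forall>a\<in>N. path_sum c N a = 0" by simp
    from path_sum_zero_coboundary[OF N c(1) div this]
    show False using c(2) by blast
  qed
  moreover have "\<forall>y\<in>Y. y (path_sum c N) = 0"
  proof
    fix y assume "y \<in> Y"
    then have "(\<lambda>c. y (path_sum c N)) \<in> J1 \<union> J2 \<union> J3"
      unfolding J3_def by blast
    from bspec[OF c(3) this] show "y (path_sum c N) = 0" .
  qed
  ultimately show ?thesis
    using hom by (intro bexI[of _ "path_sum c N"] conjI)
qed

lemma large_group_free2: "large_group free2 ((\<lambda>b. [(b, True)]) ` UNIV)"
  by unfold_locales (auto simp: generate_free2 intro: many_homs_free2)

section \<open>Passing to the quotient\<close>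

text \<open>Residual finiteness asks for finite groups on \<open>nat\<close>: the quotient is
  transported along an injection \<open>e\<close>, a weak morphism with trivial kernel.\<close>

lemma (in group) finite_quotient_on_nat:
  assumes N: "N \<lhd> G" "finite (rcosets N)" and g: "g \<in> carrier G" "g \<notin> N"
  shows "\<exists>(Q :: nat monoid) \<epsilon>. group Q \<and> finite (carrier Q) \<and> \<epsilon> \<in> hom G Q \<and> \<epsilon> g \<noteq> \<one>\<^bsub>Q\<^esub>"
proof -
  interpret N: normal N G by (rule N(1))
  interpret M: group "G Mod N" by (rule N.factorgroup_is_group)
  have carM: "carrier (G Mod N) = rcosets N"
    by (simp add: FactGroup_def)
  obtain e :: "'a set \<Rightarrow> nat" where e: "inj_on e (carrier (G Mod N))"
    using finite_imp_inj_to_nat_seg[OF N(2)] carM by auto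
  have wm: "weak_group_morphism e {\<one>\<^bsub>G Mod N\<^esub>} (G Mod N)"
  proof (rule weak_group_morphismsI)
    show "{\<one>\<^bsub>G Mod N\<^esub>} \<lhd> G Mod N"
      by (rule M.one_is_normal)
    fix a b assume ab: "a \<in> carrier (G Mod N)" "b \<in> carrier (G Mod N)"
    have "e a = e b \<longleftrightarrow> a = b"
      using ab e by (auto dest: inj_onD)
    also have "\<dots> \<longleftrightarrow> a \<otimes>\<^bsub>G Mod N\<^esub> inv\<^bsub>G Mod N\<^esub> b \<in> {\<one>\<^bsub>G Mod N\<^esub>}"
    proof
      assume "a \<otimes>\<^bsub>G Mod N\<^esub> inv\<^bsub>G Mod N\<^esub> b \<in> {\<one>\<^bsub>G Mod N\<^esub>}"
      then have "a \<otimes>\<^bsub>G Mod N\<^esub> inv\<^bsub>G Mod N\<^esub> b = \<one>\<^bsub>G Mod N\<^esub>" by simp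
      from M.inv_equality[OF this] show "a = b"
        using ab by simp
    next
      assume "a = b"
      then show "a \<otimes>\<^bsub>G Mod N\<^esub> inv\<^bsub>G Mod N\<^esub> b \<in> {\<one>\<^bsub>G Mod N\<^esub>}"
        using M.r_inv[OF ab(2)] by (simp only: singleton_iff)
    qed
    finally show "e a = e b \<longleftrightarrow> a \<otimes>\<^bsub>G Mod N\<^esub> inv\<^bsub>G Mod N\<^esub> b \<in> {\<one>\<^bsub>G Mod N\<^esub>}" .
  qed
  let ?Q = "image_group e (G Mod N)"
  have "group ?Q"
    by (rule M.image_group_is_group[OF wm])
  moreover have "finite (carrier ?Q)"
    using N(2) by (simp add: image_group_carrier carM)
  moreover have "e \<circ> (\<lambda>a. N #> a) \<in> hom G ?Q"
    by (rule Group.hom_compose[OF N.r_coset_hom_Mod M.weak_group_morphism_is_hom[OF wm]])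
  moreover have "(e \<circ> (\<lambda>a. N #> a)) g \<noteq> \<one>\<^bsub>?Q\<^esub>"
  proof
    assume "(e \<circ> (\<lambda>a. N #> a)) g = \<one>\<^bsub>?Q\<^esub>"
    then have "e (N #> g) = e N"
      by (simp add: image_group_one FactGroup_def)
    moreover have "N #> g \<in> carrier (G Mod N)" "N \<in> carrier (G Mod N)"
      using g(1) N.subset N.subgroup_in_rcosets[OF is_group] by (auto simp: carM intro!: rcosetsI)
    ultimately have "N #> g = N"
      using e by (auto dest: inj_onD)
    then show False
      using rcos_self[OF g(1) N.is_subgroup] g(2) by simp
  qed
  ultimately show ?thesis by blast
qed

text \<open>The quotient by \<open>K\<close> realised on another type: \<open>\<pi>\<close> is any
  function that identifies exactly the elements congruent modulo \<open>K\<close>, and its image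
  inherits the group structure.\<close>

locale image_quotient = group G for G :: "('a, 'm) monoid_scheme" (structure) +
  fixes K :: "'a set" and \<pi> :: "'a \<Rightarrow> 'b"
  assumes weak_morphism: "weak_group_morphism \<pi> K G"
begin

abbreviation "H \<equiv> image_group \<pi> G"

sublocale K: weak_group_morphism \<pi> K G
  by (rule weak_morphism)

sublocale H: group H
  by (rule image_group_is_group[OF weak_morphism])

sublocale \<pi>: group_hom G H \<pi>
  by unfold_locales (rule weak_group_morphism_is_hom[OF weak_morphism])

lemma carrier_H: "carrier H = \<pi> ` carrier G"
  by (rule image_group_carrier)

lemma \<pi>_mult: "g \<in> carrier G \<Longrightarrow> h \<in> carrier G \<Longrightarrow> \<pi> (g \<otimes> h) = \<pi> g \<otimes>\<^bsub>H\<^esub> \<pi> h"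
  by (rule \<pi>.hom_mult)

lemma \<pi>_eq_one:
  assumes "k \<in> K"
  shows "\<pi> k = \<one>\<^bsub>H\<^esub>"
proof -
  have k: "k \<in> carrier G"
    using assms K.subset by blast
  have "k \<otimes> inv \<one> \<in> K"
    using assms k by simp
  then have "\<pi> k = \<pi> \<one>"
    by (rule iffD2[OF K.inj_mod_subgroup[OF k one_closed]])
  then show ?thesis
    unfolding image_group_one .
qed

end

locale image_subgroup = image_quotient +
  fixes N
  assumes N: "N \<lhd> G" and KN: "K \<subseteq> N"
begin

sublocale N: normal N G
  by (rule N)

lemma \<pi>_mem_image_iff:
  assumes "g \<in> carrier G"
  shows "\<pi> g \<in> \<pi> ` N \<longleftrightarrow> g \<in> N"
proof
  assume "\<pi> g \<in> \<pi> ` N"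
  then obtain n where n: "n \<in> N" "\<pi> g = \<pi> n" by blast
  then have nc: "n \<in> carrier G" using N.subset by blast
  have "g \<otimes> inv n \<in> N"
    using iffD1[OF K.inj_mod_subgroup[OF assms nc] n(2)] KN by blast
  then have "g \<otimes> inv n \<otimes> n \<in> N"
    using n(1) by (rule N.m_closed)
  then show "g \<in> N"
    using assms nc by (simp add: m_assoc)
qed simp

lemma image_normal: "\<pi> ` N \<lhd> H"
proof -
  have "subgroup (\<pi> ` N) H"
    by (rule \<pi>.subgroup_img_is_subgroup[OF N.is_subgroup])
  moreover have "x \<otimes>\<^bsub>H\<^esub> y \<otimes>\<^bsub>H\<^esub> inv\<^bsub>H\<^esub> x \<in> \<pi> ` N" if xy: "x \<in> carrier H" "y \<in> \<pi> ` N" for x y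
  proof -
    obtain g n where g: "g \<in> carrier G" "x = \<pi> g" and n: "n \<in> N" "y = \<pi> n"
      using xy unfolding carrier_H by blast
    have "n \<in> carrier G" using n(1) N.subset by blast
    then have "x \<otimes>\<^bsub>H\<^esub> y \<otimes>\<^bsub>H\<^esub> inv\<^bsub>H\<^esub> x = \<pi> (g \<otimes> n \<otimes> inv g)"
      using g n by simp
    then show ?thesis
      using N.inv_op_closed2[OF g(1) n(1)] by blast
  qed
  ultimately show ?thesis
    by (simp add: H.normal_inv_iff)
qed

lemma image_r_coset:
  assumes "g \<in> carrier G"
  shows "\<pi> ` (N #> g) = \<pi> ` N #>\<^bsub>H\<^esub> \<pi> g"
proof -
  have "\<pi> (n \<otimes> g) = \<pi> n \<otimes>\<^bsub>H\<^esub> \<pi> g" if "n \<in> N" for n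
    using that assms N.subset by (intro \<pi>_mult) auto
  then have "(\<Union>n\<in>N. {\<pi> (n \<otimes> g)}) = (\<Union>n\<in>N. {\<pi> n \<otimes>\<^bsub>H\<^esub> \<pi> g})"
    by (intro SUP_cong refl) simp
  then show ?thesis
    unfolding r_coset_def image_UN by simp
qed

lemma bij_betw_rcosets: "bij_betw (image \<pi>) (rcosets N) (rcosets\<^bsub>H\<^esub> (\<pi> ` N))"
  unfolding bij_betw_def
proof
  show "inj_on (image \<pi>) (rcosets N)"
  proof (rule inj_onI)
    fix C D assume CD: "C \<in> rcosets N" "D \<in> rcosets N" and eq: "\<pi> ` C = \<pi> ` D"
    obtain g h where g: "g \<in> carrier G" "C = N #> g" and h: "h \<in> carrier G" "D = N #> h"
      using CD unfolding RCOSETS_def by blast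
    have "\<pi> g \<in> \<pi> ` D"
      using eq rcos_self[OF g(1) N.is_subgroup] g(2) by blast
    then obtain n where n: "n \<in> N" "\<pi> g = \<pi> (n \<otimes> h)"
      unfolding h(2) r_coset_def by blast
    have nc: "n \<in> carrier G" using n(1) N.subset by blast
    have "\<pi> (g \<otimes> inv h) = \<pi> n"
      using g h nc n(2) \<pi>_mult[of g "inv h"] \<pi>_mult[of "n \<otimes> h" "inv h"] by (simp add: m_assoc)
    then have "\<pi> (g \<otimes> inv h) \<in> \<pi> ` N"
      using n(1) by simp
    then have "g \<otimes> inv h \<in> N"
      using \<pi>_mem_image_iff[of "g \<otimes> inv h"] g(1) h(1) by simp
    then have "g \<in> N #> h"
      by (rule N.rcos_module_rev[OF is_group h(1) g(1)])
    then show "C = D"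
      using repr_independence[OF _ h(1) N.is_subgroup, of g] g h by simp
  qed
  show "image \<pi> ` (rcosets N) = rcosets\<^bsub>H\<^esub> (\<pi> ` N)"
  proof -
    have "(\<Union>g\<in>carrier G. {\<pi> ` (N #> g)}) = (\<Union>g\<in>carrier G. {\<pi> ` N #>\<^bsub>H\<^esub> \<pi> g})"
      by (intro SUP_cong refl) (simp add: image_r_coset)
    then show ?thesis
      unfolding RCOSETS_def carrier_H image_UN by simp
  qed
qed

lemma finite_rcosets_image: "finite (rcosets\<^bsub>H\<^esub> (\<pi> ` N)) \<longleftrightarrow> finite (rcosets N)"
  by (rule bij_betw_finite[OF bij_betw_rcosets, symmetric])

lemma card_rcosets_image: "card (rcosets\<^bsub>H\<^esub> (\<pi> ` N)) = card (rcosets N)"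
  by (rule bij_betw_same_card[OF bij_betw_rcosets, symmetric])

abbreviation "HN \<equiv> H\<lparr>carrier := \<pi> ` N\<rparr>"

lemma group_HN: "group HN"
  using H.subgroup_imp_group[OF normal_imp_subgroup[OF image_normal]] .

lemma rat_characters_comp:
  assumes \<phi>: "\<phi> \<in> rat_characters HN" and R: "\<And>g r. g \<in> carrier G \<Longrightarrow> r \<in> R \<Longrightarrow> g \<otimes> r \<otimes> inv g \<in> K"
  shows "\<phi> \<circ> \<pi> \<in> rat_homs G N R"
  unfolding rat_homs_def
proof (intro CollectI conjI ballI)
  have hom: "\<phi> (\<pi> a \<otimes>\<^bsub>H\<^esub> \<pi> b) = \<phi> (\<pi> a) + \<phi> (\<pi> b)" if "a \<in> N" "b \<in> N" for a b
    using \<phi> that by (simp add: rat_characters_def)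
  show "(\<phi> \<circ> \<pi>) (a \<otimes> b) = (\<phi> \<circ> \<pi>) a + (\<phi> \<circ> \<pi>) b" if "a \<in> N" "b \<in> N" for a b
    using hom[OF that] that N.subset \<pi>_mult[of a b] by auto
  fix g r assume "g \<in> carrier G" "r \<in> R"
  then have "\<pi> (g \<otimes> r \<otimes> inv g) = \<one>\<^bsub>H\<^esub>"
    by (intro \<pi>_eq_one R)
  moreover have "\<phi> \<one>\<^bsub>H\<^esub> = 0"
    using hom[of \<one> \<one>] by simp
  ultimately show "(\<phi> \<circ> \<pi>) (g \<otimes> r \<otimes> inv g) = 0"
    by simp
qed

text \<open>Characters of the image pull back to characters of \<open>N\<close> that kill
  \<open>K\<close>, in particular all conjugates of \<open>R\<close>. Whatever else \<open>K\<close>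
  contains can only lower the Betti number.\<close>

lemma betti1_image_le:
  assumes E: "finite E" "E \<subseteq> N" and R: "\<And>g r. g \<in> carrier G \<Longrightarrow> r \<in> R \<Longrightarrow> g \<otimes> r \<otimes> inv g \<in> K"
    and det: "\<forall>\<phi>\<in>rat_homs G N R. (\<forall>e\<in>E. \<phi> e = 0) \<longrightarrow> (\<forall>b\<in>N. \<phi> b = 0)"
  shows "betti1 HN \<le> card E"
proof -
  have "betti1 HN \<le> card (\<pi> ` E)"
  proof (rule betti1_le_card[OF group_HN])
    show "finite (\<pi> ` E)" using E(1) by simp
    show "\<pi> ` E \<subseteq> carrier HN" using E(2) by auto
    show "\<forall>\<phi>\<in>rat_characters HN. (\<forall>e\<in>\<pi> ` E. \<phi> e = 0) \<longrightarrow> (\<forall>g\<in>carrier HN. \<phi> g = 0)"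
    proof (intro ballI impI)
      fix \<phi> h assume \<phi>: "\<phi> \<in> rat_characters HN" and zero: "\<forall>e\<in>\<pi> ` E. \<phi> e = 0" and h: "h \<in> carrier HN"
      have "\<forall>e\<in>E. (\<phi> \<circ> \<pi>) e = 0"
        using zero by simp
      from mp[OF bspec[OF det rat_characters_comp[OF \<phi> R]] this]
      have "\<forall>b\<in>N. (\<phi> \<circ> \<pi>) b = 0" by simp
      then show "\<phi> h = 0"
        using h by auto
    qed
  qed
  also have "\<dots> \<le> card E"
    by (rule card_image_le[OF E(1)])
  finally show ?thesis .
qed

text \<open>The opposite direction: characters of \<open>N\<close> that vanish on \<open>K\<close>
  descend to the image, so chains detecting the characters there yield equally few functionals
  detecting these.\<close>

lemma betti1_image_detecting:
  assumes E: "finite E" "E \<subseteq> N" "generate G E = N"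
  obtains Y :: "(('a \<Rightarrow> rat) \<Rightarrow> rat) set" where "finite Y" "card Y \<le> betti1 HN" "\<And>y. y \<in> Y \<Longrightarrow> lin_fun y"
    "\<And>\<phi> a R. \<phi> \<in> rat_homs G N R \<Longrightarrow> \<forall>k\<in>K. \<phi> k = 0 \<Longrightarrow> \<forall>y\<in>Y. y \<phi> = 0 \<Longrightarrow> a \<in> N \<Longrightarrow> \<phi> a = 0"
proof -
  have det: "\<forall>\<phi>\<in>rat_characters HN. (\<forall>e\<in>\<pi> ` E. \<phi> e = 0) \<longrightarrow> (\<forall>g\<in>carrier HN. \<phi> g = 0)"
  proof (intro ballI impI)
    fix \<phi> h assume \<phi>: "\<phi> \<in> rat_characters HN" and zero: "\<forall>e\<in>\<pi> ` E. \<phi> e = 0" and h: "h \<in> carrier HN"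
    have \<phi>\<pi>: "\<phi> \<circ> \<pi> \<in> rat_homs G N {}"
      by (rule rat_characters_comp[OF \<phi>]) simp
    have zero': "\<forall>e\<in>E. (\<phi> \<circ> \<pi>) e = 0"
      using zero by simp
    obtain b where b: "b \<in> N" "h = \<pi> b"
      using h by auto
    have "(\<phi> \<circ> \<pi>) b = 0"
      by (rule rat_homs_zero_generate[OF \<phi>\<pi> N.is_subgroup E(2,3) zero' b(1)])
    then show "\<phi> h = 0"
      using b(2) by simp
  qed
  have fE: "finite (\<pi> ` E)" and sE: "\<pi> ` E \<subseteq> carrier HN"
    using E by auto
  obtain Y where Y: "finite Y" "card Y \<le> betti1 HN" "Y \<subseteq> fsupp_on (carrier HN)"
    "\<forall>\<phi>\<in>rat_characters HN. (\<forall>y\<in>Y. chain_eval y \<phi> = 0) \<longrightarrow> (\<forall>g\<in>carrier HN. \<phi> g = 0)"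
    by (rule betti1_detecting_chains[OF group_HN fE sE det])
  \<comment> \<open>A mere set-theoretic section. Composition with it gives a homomorphism on the
    image, since a character vanishing on \<open>K\<close> is constant on the fibres of
    \<open>\<pi>\<close> inside \<open>N\<close>.\<close>
  define s where "s = inv_into (carrier G) \<pi>"
  define F where "F y \<phi> = chain_eval y (\<phi> \<circ> s)" for y and \<phi> :: "'a \<Rightarrow> rat"
  show thesis
  proof (rule that[of "F ` Y"])
    show "finite (F ` Y)" using Y(1) by simp
    show "card (F ` Y) \<le> betti1 HN"
      using card_image_le[OF Y(1), of F] Y(2) by (rule order_trans)
    show "lin_fun L" if "L \<in> F ` Y" for L
      using that unfolding lin_fun_def F_def chain_eval_def
      by (auto simp: ring_distribs sum.distrib sum_distrib_left mult.left_commute)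
    fix \<phi> a R assume \<phi>: "\<phi> \<in> rat_homs G N R" and \<phi>K: "\<forall>k\<in>K. \<phi> k = 0" and zero: "\<forall>y\<in>F ` Y. y \<phi> = 0" and a: "a \<in> N"
    have \<phi>s: "\<phi> (s (\<pi> b)) = \<phi> b" if b: "b \<in> N" for b
    proof -
      have bc: "b \<in> carrier G" using b N.subset by blast
      have sc: "s (\<pi> b) \<in> carrier G" "\<pi> (s (\<pi> b)) = \<pi> b"
        unfolding s_def using bc by (auto intro!: inv_into_into f_inv_into_f)
      have k: "s (\<pi> b) \<otimes> inv b \<in> K"
        by (rule iffD1[OF K.inj_mod_subgroup[OF sc(1) bc] sc(2)])
      have "\<phi> (s (\<pi> b) \<otimes> inv b \<otimes> b) = \<phi> (s (\<pi> b) \<otimes> inv b) + \<phi> b"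
        using k KN b by (intro rat_homs_mult[OF \<phi>]) auto
      moreover have "s (\<pi> b) \<otimes> inv b \<otimes> b = s (\<pi> b)"
        using sc(1) bc by (simp add: m_assoc)
      ultimately show ?thesis
        using bspec[OF \<phi>K k] by simp
    qed
    have chi: "\<phi> \<circ> s \<in> rat_characters HN"
      unfolding rat_characters_def
    proof (intro CollectI ballI)
      fix x y assume "x \<in> carrier HN" "y \<in> carrier HN"
      then obtain b c where b: "b \<in> N" "x = \<pi> b" and c: "c \<in> N" "y = \<pi> c"
        by auto
      have "x \<otimes>\<^bsub>HN\<^esub> y = \<pi> (b \<otimes> c)"
        using b c N.subset \<pi>_mult[of b c] by auto
      then show "(\<phi> \<circ> s) (x \<otimes>\<^bsub>HN\<^esub> y) = (\<phi> \<circ> s) x + (\<phi> \<circ> s) y"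
        using \<phi>s[OF N.m_closed[OF b(1) c(1)]] \<phi>s[OF b(1)] \<phi>s[OF c(1)] rat_homs_mult[OF \<phi> b(1) c(1)] b(2) c(2)
        by (simp del: monoid.simps)
    qed
    have "\<forall>y\<in>Y. chain_eval y (\<phi> \<circ> s) = 0"
      using zero unfolding F_def by simp
    then have "\<forall>g\<in>carrier HN. (\<phi> \<circ> s) g = 0"
      by (rule mp[OF bspec[OF Y(4) chi]])
    then have "\<phi> (s (\<pi> a)) = 0"
      using a by simp
    then show "\<phi> a = 0"
      using \<phi>s[OF a] by simp
  qed
qed

end

section \<open>The oscillating chain\<close>

text \<open>\<open>B\<close> lies between the consecutive states \<open>s\<close> and
  \<open>t\<close>. Its characters are bounded with the relators of \<open>t\<close>, as it is the
  newly added ones that kill the excess.\<close>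

definition refines ::
    "('a, 'm) monoid_scheme \<Rightarrow> nat \<Rightarrow> 'a set \<times> ('a \<times> nat) set \<Rightarrow> 'a set \<Rightarrow> 'a set \<times> ('a \<times> nat) set \<Rightarrow> bool" where
  "refines G n s B t \<longleftrightarrow> B \<lhd> G \<and> finite (rcosets\<^bsub>G\<^esub> B) \<and> B \<subseteq> fst s \<and> fst t \<subseteq> B \<and> snd s \<subseteq> snd t \<and>
    rat_homs G (fst s) (relators G (snd s)) \<subseteq> rat_homs G (fst s) (relators G (snd t)) \<and>
    (\<forall>\<phi>\<in>rat_homs G (fst s) (relators G (snd s)). \<phi> ` fst s \<subseteq> \<int> \<longrightarrow> (\<forall>b\<in>B. \<phi> b / of_nat (Suc n) \<in> \<int>)) \<and>
    (\<exists>E\<subseteq>B. finite E \<and> 4 * card E \<le> card (rcosets\<^bsub>G\<^esub> B) \<and>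
      (\<forall>\<phi>\<in>rat_homs G B (relators G (snd t)). (\<forall>e\<in>E. \<phi> e = 0) \<longrightarrow> (\<forall>b\<in>B. \<phi> b = 0)))"

lemma Ints_zero_if_divisible:
  fixes x :: rat
  assumes "x \<in> \<int>" and div: "\<And>m. m \<ge> n \<Longrightarrow> x / of_nat (Suc m) \<in> \<int>"
  shows "x = 0"
proof -
  obtain z where z: "x = of_int z"
    using assms(1) by (elim Ints_cases)
  define m where "m = max n (nat \<bar>z\<bar>)"
  have m: "\<bar>z\<bar> < int (Suc m)"
    unfolding m_def by linarith
  have "x / of_nat (Suc m) \<in> \<int>"
    by (rule div) (simp add: m_def)
  then obtain w where "x / of_nat (Suc m) = of_int w"
    by (elim Ints_cases)
  then have "x = of_int w * of_nat (Suc m)"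
    by (simp add: nonzero_divide_eq_eq del: of_nat_Suc)
  then have "(of_int z :: rat) = of_int (w * int (Suc m))"
    unfolding z by (simp del: of_nat_Suc)
  then have zw: "z = w * int (Suc m)"
    by (simp only: of_int_eq_iff)
  have "z = 0"
  proof (rule ccontr)
    assume z0: "z \<noteq> 0"
    have "int (Suc m) dvd z"
      unfolding zw by (rule dvd_triv_right)
    from dvd_imp_le_int[OF z0 this] m show False
      by linarith
  qed
  then show ?thesis
    using z by simp
qed

context large_group
begin

lemma ex_refining_sequence:
  "\<exists>s B. \<forall>n. good_state G (fst (s n)) (snd (s n)) \<and> refines G n (s n) (B n) (s (Suc n))"
proof -
  have "\<exists>s. \<forall>n. good_state G (fst (s n)) (snd (s n)) \<and> (\<exists>B. refines G n (s n) B (s (Suc n)))"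
  proof (rule dependent_nat_choice[where P = "\<lambda>_ s. good_state G (fst s) (snd s)" and
        Q = "\<lambda>n s t. \<exists>B. refines G n s B t"])
    have "carrier G \<lhd> G"
      by (simp add: normal_inv_iff subgroup_self)
    moreover have "finite (rcosets (carrier G))"
      by (rule finite_rcosets_if_finite_signature[OF subgroup_self, where \<tau> = "\<lambda>_. ()"]) auto
    ultimately have "good_state G (carrier G) {}"
      by (simp add: good_state_def)
    then show "\<exists>s. good_state G (fst s) (snd s)"
      by (intro exI[of _ "(carrier G, {})"]) simp
  next
    fix s n assume st: "good_state G (fst s) (snd s)"
    from next_good_state[OF st zero_less_Suc[of n]] obtain B A' P' where
      "B \<lhd> G \<and> finite (rcosets B) \<and> B \<subseteq> fst s \<and> A' \<subseteq> B \<and> good_state G A' P' \<and> snd s \<subseteq> P' \<and>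
      rat_homs G (fst s) (relators G (snd s)) \<subseteq> rat_homs G (fst s) (relators G P') \<and>
      (\<forall>\<phi>\<in>rat_homs G (fst s) (relators G (snd s)). \<phi> ` fst s \<subseteq> \<int> \<longrightarrow> (\<forall>b\<in>B. \<phi> b / of_nat (Suc n) \<in> \<int>)) \<and>
      (\<exists>E\<subseteq>B. finite E \<and> 4 * card E \<le> card (rcosets B) \<and>
        (\<forall>\<phi>\<in>rat_homs G B (relators G P'). (\<forall>e\<in>E. \<phi> e = 0) \<longrightarrow> (\<forall>b\<in>B. \<phi> b = 0)))"
      by (elim exE)
    then have "good_state G (fst (A', P')) (snd (A', P')) \<and> refines G n s B (A', P')"
      unfolding refines_def fst_conv snd_conv by (elim conjE) (intro conjI)
    then show "\<exists>t. good_state G (fst t) (snd t) \<and> (\<exists>B. refines G n s B t)"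
      by (intro exI[of _ "(A', P')"]) (elim conjE, intro conjI exI)
  qed
  then obtain s where s: "\<forall>n. good_state G (fst (s n)) (snd (s n)) \<and> (\<exists>B. refines G n (s n) B (s (Suc n)))"
    by (elim exE)
  then have "\<forall>n. \<exists>B. refines G n (s n) B (s (Suc n))"
    by simp
  from choice[OF this] obtain B where "\<forall>n. refines G n (s n) (B n) (s (Suc n))"
    by (elim exE)
  then show ?thesis
    using s by (intro exI[of _ s] exI[of _ B]) simp
qed

end

section \<open>The intersection of the chain and the quotient by it\<close>

locale refining_sequence = large_group +
  fixes s :: "nat \<Rightarrow> 'a set \<times> ('a \<times> nat) set" and B :: "nat \<Rightarrow> 'a set"
  assumes good: "good_state G (fst (s n)) (snd (s n))"
    and refines: "refines G n (s n) (B n) (s (Suc n))"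
begin

definition A :: "nat \<Rightarrow> 'a set" where "A n = fst (s n)"
definition R :: "nat \<Rightarrow> 'a set" where "R n = relators G (snd (s n))"
definition K :: "'a set" where "K = (\<Inter>n. A n)"

lemma A_normal: "A n \<lhd> G"
  using good[of n] unfolding good_state_def A_def by (elim conjE)

lemma A_index: "finite (rcosets (A n))"
  using good[of n] unfolding good_state_def A_def by (elim conjE)

lemma B_normal: "B n \<lhd> G"
  using refines[of n] unfolding refines_def by (elim conjE)

lemma B_index: "finite (rcosets (B n))"
  using refines[of n] unfolding refines_def by (elim conjE)

lemma B_subset: "B n \<subseteq> A n"
  using refines[of n] unfolding refines_def A_def by (elim conjE)

lemma A_subset: "A (Suc n) \<subseteq> B n"
  using refines[of n] unfolding refines_def A_def by (elim conjE)

lemma R_subset: "R n \<subseteq> A n"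
  unfolding R_def A_def by (rule relators_subset[OF good])

lemma A_antimono: "m \<le> n \<Longrightarrow> A n \<subseteq> A m"
  by (rule lift_Suc_antimono_le[of A]) (rule subset_trans[OF A_subset B_subset])

lemma R_mono: "m \<le> n \<Longrightarrow> R m \<subseteq> R n"
proof (rule lift_Suc_mono_le[of R])
  show "R n \<subseteq> R (Suc n)" for n
    using refines[of n] unfolding refines_def R_def relators_def by (elim conjE) (rule image_mono)
qed

lemma K_subset_A: "K \<subseteq> A n"
  unfolding K_def by blast

lemma K_subset_B: "K \<subseteq> B n"
  using K_subset_A[of "Suc n"] A_subset[of n] by blast

lemma K_normal: "K \<lhd> G"
proof -
  have sub: "subgroup (A n) G" for n
    by (rule normal_imp_subgroup[OF A_normal])
  have "subgroup K G"
    unfolding K_def using sub by (intro subgroups_Inter) auto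
  moreover have "x \<otimes> h \<otimes> inv x \<in> K" if "x \<in> carrier G" "h \<in> K" for x h
    using that normal.inv_op_closed2[OF A_normal] unfolding K_def by blast
  ultimately show ?thesis
    by (simp add: normal_inv_iff)
qed

text \<open>A relator persists at all later stages, so it lies in their subgroups, and the earlier
  subgroups contain these.\<close>

lemma R_subset_K: "R n \<subseteq> K"
proof
  fix r assume r: "r \<in> R n"
  have "r \<in> A m" for m
  proof -
    have "r \<in> A (max m n)"
      using r R_mono[of n "max m n"] R_subset[of "max m n"] by auto
    then show ?thesis
      using A_antimono[of m "max m n"] by auto
  qed
  then show "r \<in> K" by (simp add: K_def)
qed

lemma R_conj_K: "g \<in> carrier G \<Longrightarrow> r \<in> R n \<Longrightarrow> g \<otimes> r \<otimes> inv g \<in> K"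
  using normal.inv_op_closed2[OF K_normal] R_subset_K by blast

lemma rat_homs_later:
  assumes "n \<le> m"
  shows "rat_homs G (A n) (R n) \<subseteq> rat_homs G (A m) (R m)"
proof (rule lift_Suc_mono_le[of "\<lambda>n. rat_homs G (A n) (R n)", OF _ assms])
  fix k
  have "rat_homs G (A k) (R k) \<subseteq> rat_homs G (A k) (R (Suc k))"
    using refines[of k] unfolding refines_def A_def R_def by (elim conjE)
  also have "\<dots> \<subseteq> rat_homs G (A (Suc k)) (R (Suc k))"
    by (rule rat_homs_mono[OF A_antimono[of k "Suc k"] subset_refl]) simp
  finally show "rat_homs G (A k) (R k) \<subseteq> rat_homs G (A (Suc k)) (R (Suc k))" .
qed

text \<open>An integral multiple of \<open>\<phi>\<close> is still an admissible integral character
  at every later stage \<open>m\<close>, where its values on \<open>K\<close> must be divisible by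
  \<open>Suc m\<close>. Only 0 has all these divisors.\<close>

lemma rat_homs_zero_on_K:
  assumes \<phi>: "\<phi> \<in> rat_homs G (A n) (R n)" and a: "a \<in> K"
  shows "\<phi> a = 0"
proof -
  obtain E where E: "finite E" "E \<subseteq> A n" "generate G E = A n"
    by (rule finite_index_generators[OF A_normal A_index])
  obtain q :: nat where q: "q > 0" and \<psi>: "(\<lambda>x. of_nat q * \<phi> x) \<in> rat_homs G (A n) (R n)"
    "(\<lambda>x. of_nat q * \<phi> x) ` A n \<subseteq> \<int>"
    by (rule rat_homs_integral_multiple[OF \<phi> normal_imp_subgroup[OF A_normal] E])
  have "of_nat q * \<phi> a = 0"
  proof (rule Ints_zero_if_divisible)
    show "of_nat q * \<phi> a \<in> \<int>"
      using \<psi>(2) a K_subset_A by blast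
    fix m assume m: "m \<ge> n"
    have hom: "(\<lambda>x. of_nat q * \<phi> x) \<in> rat_homs G (A m) (R m)"
      using rat_homs_later[OF m] \<psi>(1) by (rule subsetD)
    have int: "(\<lambda>x. of_nat q * \<phi> x) ` A m \<subseteq> \<int>"
      using image_mono[OF A_antimono[OF m]] \<psi>(2) by (rule order_trans)
    have div: "\<forall>\<phi>\<in>rat_homs G (A m) (R m). \<phi> ` A m \<subseteq> \<int> \<longrightarrow> (\<forall>b\<in>B m. \<phi> b / of_nat (Suc m) \<in> \<int>)"
      using refines[of m] unfolding refines_def A_def R_def by (elim conjE)
    from bspec[OF mp[OF bspec[OF div hom] int], of a]
    show "of_nat q * \<phi> a / of_nat (Suc m) \<in> \<int>"
      using a K_subset_B by blast
  qed
  then show ?thesis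
    using q by simp
qed

end

locale refining_sequence_image = refining_sequence +
  fixes \<pi> :: "'a \<Rightarrow> 'c"
  assumes weak_morphism: "weak_group_morphism \<pi> K G"
begin

sublocale image_quotient G K \<pi>
  by (rule image_quotient.intro[OF is_group image_quotient_axioms.intro[OF weak_morphism]])

text \<open>Otherwise at most half the index many functionals would detect the characters of
  \<open>A n\<close> vanishing on \<open>K\<close>. But \<open>many_homs\<close> yields a nonzero
  character killed by all of them, and it vanishes on \<open>K\<close> because it respects the
  relators of stage n.\<close>

lemma betti1_A:
  "card (rcosets (A n)) < 2 * betti1 (H\<lparr>carrier := \<pi> ` A n\<rparr>)"
proof (rule ccontr)
  interpret image_subgroup G K \<pi> "A n"
    by (rule image_subgroup.intro[OF image_quotient_axioms image_subgroup_axioms.intro[OF A_normal K_subset_A]])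
  assume "\<not> ?thesis"
  then have le: "2 * betti1 HN \<le> card (rcosets (A n))" by simp
  obtain E where E: "finite E" "E \<subseteq> A n" "generate G E = A n"
    by (rule finite_index_generators[OF A_normal A_index])
  obtain Y :: "(('a \<Rightarrow> rat) \<Rightarrow> rat) set" where Y: "finite Y" "card Y \<le> betti1 HN" "\<And>y. y \<in> Y \<Longrightarrow> lin_fun y"
    "\<And>\<phi> a R. \<phi> \<in> rat_homs G (A n) R \<Longrightarrow> \<forall>k\<in>K. \<phi> k = 0 \<Longrightarrow> \<forall>y\<in>Y. y \<phi> = 0 \<Longrightarrow> a \<in> A n \<Longrightarrow> \<phi> a = 0"
    by (rule betti1_image_detecting[OF E]) blast
  have cY: "2 * card Y \<le> card (rcosets (fst (s n)))"
    using Y(2) le unfolding A_def by linarith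
  have "\<exists>\<phi>\<in>rat_homs G (A n) (R n). (\<exists>a\<in>A n. \<phi> a \<noteq> 0) \<and> (\<forall>y\<in>Y. y \<phi> = 0)"
    unfolding A_def R_def by (rule many_homs[OF good Y(1) cY Y(3)])
  then obtain \<phi> a where \<phi>: "\<phi> \<in> rat_homs G (A n) (R n)" "a \<in> A n" "\<phi> a \<noteq> 0" "\<forall>y\<in>Y. y \<phi> = 0"
    by (elim bexE conjE)
  have "\<forall>k\<in>K. \<phi> k = 0"
    using rat_homs_zero_on_K[OF \<phi>(1)] by (rule ballI)
  from Y(4)[OF \<phi>(1) this \<phi>(4,2)] show False
    using \<phi>(3) by simp
qed

lemma betti1_B:
  "4 * betti1 (H\<lparr>carrier := \<pi> ` B n\<rparr>) \<le> card (rcosets (B n))"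
proof -
  interpret image_subgroup G K \<pi> "B n"
    by (rule image_subgroup.intro[OF image_quotient_axioms image_subgroup_axioms.intro[OF B_normal K_subset_B]])
  have "\<exists>E\<subseteq>B n. finite E \<and> 4 * card E \<le> card (rcosets (B n)) \<and>
      (\<forall>\<phi>\<in>rat_homs G (B n) (R (Suc n)). (\<forall>e\<in>E. \<phi> e = 0) \<longrightarrow> (\<forall>b\<in>B n. \<phi> b = 0))"
    using refines[of n] unfolding refines_def R_def by (elim conjE)
  then obtain E where E: "E \<subseteq> B n" "finite E" "4 * card E \<le> card (rcosets (B n))"
    "\<forall>\<phi>\<in>rat_homs G (B n) (R (Suc n)). (\<forall>e\<in>E. \<phi> e = 0) \<longrightarrow> (\<forall>b\<in>B n. \<phi> b = 0)"
    by (elim exE conjE)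
  have "betti1 HN \<le> card E"
    by (rule betti1_image_le[OF E(2,1) R_conj_K E(4)])
  then show ?thesis
    using E(3) by linarith
qed

definition chain :: "nat \<Rightarrow> 'c set" where
  "chain i = (if even i then \<pi> ` A (i div 2) else \<pi> ` B (i div 2))"

lemma chain_normal: "chain i \<lhd> H" and chain_index: "finite (rcosets\<^bsub>H\<^esub> (chain i))"
proof -
  interpret A: image_subgroup G K \<pi> "A (i div 2)"
    by (rule image_subgroup.intro[OF image_quotient_axioms image_subgroup_axioms.intro[OF A_normal K_subset_A]])
  interpret B: image_subgroup G K \<pi> "B (i div 2)"
    by (rule image_subgroup.intro[OF image_quotient_axioms image_subgroup_axioms.intro[OF B_normal K_subset_B]])
  show "chain i \<lhd> H"
    unfolding chain_def using A.image_normal B.image_normal by simp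
  show "finite (rcosets\<^bsub>H\<^esub> (chain i))"
    unfolding chain_def using A.finite_rcosets_image B.finite_rcosets_image A_index B_index by simp
qed

lemma chain_decreasing: "chain (Suc i) \<subseteq> chain i"
proof (cases "even i")
  case True
  then show ?thesis
    unfolding chain_def using image_mono[OF B_subset[of "i div 2"]] by simp
next
  case False
  then have "Suc i div 2 = Suc (i div 2)" by presburger
  then show ?thesis
    unfolding chain_def using False image_mono[OF A_subset[of "i div 2"]] by simp
qed

lemma chain_Inter: "(\<Inter>i. chain i) = {\<one>\<^bsub>H\<^esub>}"
proof
  show "{\<one>\<^bsub>H\<^esub>} \<subseteq> (\<Inter>i. chain i)"
    using subgroup.one_closed[OF normal_imp_subgroup[OF chain_normal]] by blast
  show "(\<Inter>i. chain i) \<subseteq> {\<one>\<^bsub>H\<^esub>}"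
  proof
    fix h assume h: "h \<in> (\<Inter>i. chain i)"
    \<comment> \<open>The even members already have trivial intersection; as
      \<open>K \<subseteq> A n\<close>, membership in the image of \<open>A n\<close> can be tested
      on a single preimage \<open>g\<close>.\<close>
    have hA: "h \<in> \<pi> ` A n" for n
      using INT_D[OF h, of "2 * n"] unfolding chain_def by simp
    obtain g where g: "g \<in> A 0" "h = \<pi> g"
      using hA[of 0] by blast
    have gc: "g \<in> carrier G"
      using g(1) subgroup.subset[OF normal_imp_subgroup[OF A_normal]] by blast
    have "g \<in> A n" for n
    proof -
      interpret A: image_subgroup G K \<pi> "A n"
        by (rule image_subgroup.intro[OF image_quotient_axioms image_subgroup_axioms.intro[OF A_normal K_subset_A]])
      show ?thesis
        using A.\<pi>_mem_image_iff[OF gc] hA[of n] g(2) by simp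
    qed
    then have "g \<in> K" by (simp add: K_def)
    then show "h \<in> {\<one>\<^bsub>H\<^esub>}"
      using \<pi>_eq_one g(2) by simp
  qed
qed

lemma finitely_generated_H: "finitely_generated_group H"
  unfolding finitely_generated_group_def
proof (intro conjI exI[of _ "\<pi> ` S"])
  show "group H" by (rule H.is_group)
  show "finite (\<pi> ` S)" using finite_gens(1) by simp
  show "\<pi> ` S \<subseteq> carrier H" unfolding carrier_H using finite_gens(2) by (rule image_mono)
  show "generate H (\<pi> ` S) = carrier H"
    unfolding carrier_H \<pi>.generate_img[OF finite_gens(2)] finite_gens(3) ..
qed

lemma residually_finite_H: "residually_finite_group H"
  unfolding residually_finite_group_def
proof (intro conjI ballI impI)
  show "group H" by (rule H.is_group)
  fix h assume h: "h \<in> carrier H" "h \<noteq> \<one>\<^bsub>H\<^esub>"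
  then obtain i where "h \<notin> chain i"
    using chain_Inter by blast
  from H.finite_quotient_on_nat[OF chain_normal chain_index h(1) this]
  show "\<exists>(Q :: nat monoid) \<epsilon>. group Q \<and> finite (carrier Q) \<and> \<epsilon> \<in> hom H Q \<and> \<epsilon> h \<noteq> \<one>\<^bsub>Q\<^esub>" .
qed

definition ratio :: "nat \<Rightarrow> real" where
  "ratio i = real (betti1 (H\<lparr>carrier := chain i\<rparr>)) / real (card (rcosets\<^bsub>H\<^esub> (chain i)))"

lemma ratio_even: "1 / 2 \<le> ratio (2 * n)"
proof -
  interpret A: image_subgroup G K \<pi> "A n"
    by (rule image_subgroup.intro[OF image_quotient_axioms image_subgroup_axioms.intro[OF A_normal K_subset_A]])
  have "A n \<in> rcosets (A n)"
    by (rule subgroup.subgroup_in_rcosets[OF normal_imp_subgroup[OF A_normal] is_group])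
  then have "card (rcosets (A n)) > 0"
    using A_index[of n] by (auto simp: card_gt_0_iff)
  then show ?thesis
    unfolding ratio_def chain_def using betti1_A[of n] by (simp add: A.card_rcosets_image field_simps)
qed

lemma ratio_odd: "ratio (2 * n + 1) \<le> 1 / 4"
proof -
  interpret B: image_subgroup G K \<pi> "B n"
    by (rule image_subgroup.intro[OF image_quotient_axioms image_subgroup_axioms.intro[OF B_normal K_subset_B]])
  have "B n \<in> rcosets (B n)"
    by (rule subgroup.subgroup_in_rcosets[OF normal_imp_subgroup[OF B_normal] is_group])
  then have "card (rcosets (B n)) > 0"
    using B_index[of n] by (auto simp: card_gt_0_iff)
  then show ?thesis
    unfolding ratio_def chain_def using betti1_B[of n] by (simp add: B.card_rcosets_image field_simps)
qed

text \<open>\<open>L\<close> is an arbitrary extended real, so this covers \<open>l2_betti1\<close>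
  whatever its value, infinity included.\<close>

lemma ratio_diverges: "\<not> (\<lambda>i. ereal (ratio i)) \<longlonglongrightarrow> L"
proof
  assume lim: "(\<lambda>i. ereal (ratio i)) \<longlonglongrightarrow> L"
  have "(\<lambda>n. ereal (ratio (2 * n))) \<longlonglongrightarrow> L"
    using LIMSEQ_subseq_LIMSEQ[OF lim, of "\<lambda>n. 2 * n"] by (simp add: strict_mono_def o_def)
  then have "ereal (1 / 2) \<le> L"
    by (rule LIMSEQ_le_const) (use ratio_even in auto)
  moreover have "(\<lambda>n. ereal (ratio (2 * n + 1))) \<longlonglongrightarrow> L"
    using LIMSEQ_subseq_LIMSEQ[OF lim, of "\<lambda>n. 2 * n + 1"] by (simp add: strict_mono_def o_def)
  then have "L \<le> ereal (1 / 4)"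
    by (rule LIMSEQ_le_const2) (use ratio_odd in auto)
  ultimately have "ereal (1 / 2) \<le> ereal (1 / 4)"
    by (rule order_trans)
  then show False by simp
qed

end

theorem corollary1p7:
  shows "\<not> ((\<forall>(G :: nat monoid) (N :: nat \<Rightarrow> nat set).
               finitely_generated_group G \<and> residually_finite_group G \<and>
               (\<forall>i. N i \<lhd> G) \<and> (\<forall>i. finite (rcosets\<^bsub>G\<^esub> (N i))) \<and>
               (\<forall>i. N (Suc i) \<subseteq> N i) \<and> (\<Inter>i. N i) = {\<one>\<^bsub>G\<^esub>} \<longrightarrow>
               (\<lambda>i. ereal (real (betti1 (G\<lparr>carrier := N i\<rparr>)) / real (card (rcosets\<^bsub>G\<^esub> (N i)))))
                 \<longlonglongrightarrow> l2_betti1 G) \<and>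
            (\<forall>G :: nat monoid. hyperbolic_group G \<longrightarrow> residually_finite_group G))"
proof
  assume asm: "(\<forall>(G :: nat monoid) (N :: nat \<Rightarrow> nat set).
               finitely_generated_group G \<and> residually_finite_group G \<and>
               (\<forall>i. N i \<lhd> G) \<and> (\<forall>i. finite (rcosets\<^bsub>G\<^esub> (N i))) \<and>
               (\<forall>i. N (Suc i) \<subseteq> N i) \<and> (\<Inter>i. N i) = {\<one>\<^bsub>G\<^esub>} \<longrightarrow>
               (\<lambda>i. ereal (real (betti1 (G\<lparr>carrier := N i\<rparr>)) / real (card (rcosets\<^bsub>G\<^esub> (N i)))))
                 \<longlonglongrightarrow> l2_betti1 G) \<and>
            (\<forall>G :: nat monoid. hyperbolic_group G \<longrightarrow> residually_finite_group G)"
  let ?S = "range (\<lambda>b. [(b, True)])"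
  interpret large_group free2 ?S
    by (rule large_group_free2)
  obtain s B where sB: "\<forall>n. good_state free2 (fst (s n)) (snd (s n)) \<and> refines free2 n (s n) (B n) (s (Suc n))"
    using ex_refining_sequence by (elim exE)
  interpret refining_sequence free2 ?S s B
    by unfold_locales (use sB in simp_all)
  interpret K: normal K free2
    by (rule K_normal)
  \<comment> \<open>Assertion (A) is about groups on \<open>nat\<close>: each coset of
    \<open>K\<close> is coded by the number of one chosen member.\<close>
  define \<pi> :: "word2 \<Rightarrow> nat" where "\<pi> g = to_nat (SOME h. h \<in> K #>\<^bsub>free2\<^esub> g)" for g
  have rep: "(SOME h. h \<in> K #>\<^bsub>free2\<^esub> g) \<in> K #>\<^bsub>free2\<^esub> g" if "g \<in> carrier free2" for g
    by (rule someI[of _ g]) (rule free2.rcos_self[OF that K.is_subgroup])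
  have \<pi>_iff: "\<pi> g = \<pi> h \<longleftrightarrow> g \<otimes>\<^bsub>free2\<^esub> inv\<^bsub>free2\<^esub> h \<in> K" if g: "g \<in> carrier free2" and h: "h \<in> carrier free2" for g h
  proof
    assume "\<pi> g = \<pi> h"
    then have "(SOME x. x \<in> K #>\<^bsub>free2\<^esub> g) = (SOME x. x \<in> K #>\<^bsub>free2\<^esub> h)"
      unfolding \<pi>_def by simp
    then have "(SOME x. x \<in> K #>\<^bsub>free2\<^esub> g) \<in> K #>\<^bsub>free2\<^esub> h"
      using rep[OF h] by simp
    then have "K #>\<^bsub>free2\<^esub> g = K #>\<^bsub>free2\<^esub> h"
      using free2.repr_independence[OF rep[OF g] g K.is_subgroup]
        free2.repr_independence[OF _ h K.is_subgroup] by simp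
    then have "g \<in> K #>\<^bsub>free2\<^esub> h"
      using free2.rcos_self[OF g K.is_subgroup] by simp
    then show "g \<otimes>\<^bsub>free2\<^esub> inv\<^bsub>free2\<^esub> h \<in> K"
      by (rule K.rcos_module_imp[OF group_free2 h])
  next
    assume "g \<otimes>\<^bsub>free2\<^esub> inv\<^bsub>free2\<^esub> h \<in> K"
    then have "g \<in> K #>\<^bsub>free2\<^esub> h"
      by (rule K.rcos_module_rev[OF group_free2 h g])
    then have "K #>\<^bsub>free2\<^esub> h = K #>\<^bsub>free2\<^esub> g"
      by (rule free2.repr_independence[OF _ h K.is_subgroup])
    then show "\<pi> g = \<pi> h"
      unfolding \<pi>_def by simp
  qed
  interpret refining_sequence_image free2 ?S s B \<pi>
    by (rule refining_sequence_image.intro[OF refining_sequence_axioms refining_sequence_image_axioms.intro])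
      (rule weak_group_morphismsI[OF K_normal \<pi>_iff])
  have "(\<lambda>i. ereal (real (betti1 (H\<lparr>carrier := chain i\<rparr>)) / real (card (rcosets\<^bsub>H\<^esub> (chain i))))) \<longlonglongrightarrow> l2_betti1 H"
    by (rule asm[THEN conjunct1, rule_format])
      (intro conjI allI finitely_generated_H residually_finite_H chain_normal chain_index chain_decreasing chain_Inter)
  then show False
    using ratio_diverges unfolding ratio_def by (rule notE[rotated])
qed

end
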